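(* The summed chain $\mathcal{A}'_B+\Pi_B$ on the torus $\mathbf{T}^2=(\mathbf{R}/2\pi\mathbf{Z})^2$ is a cycle, and hence equal to $m_B\mathbf{T}^2$, with some integer multiplicity $m_B$. In fact, provided that the vectors $b_k$ are ordered clockwise projectively, i.e. so that $\infty>\beta_1\ge\beta_2\ge\cdots\ge\beta_N\ge-\infty$, this multiplicity is given by the formula $$m_B=\frac12\sum_{j<k}\det\nolimits^{+}(b_j,b_k).$$
   Context: Let $B$ be an integer $N\times 2$ matrix with row vectors $b_j=(b_{j1},b_{j2})$, $j=1,\ldots,N$, such that $b_1+\cdots+b_N=(0,0)$, no row equals $(0,0)$, and the $2\times 2$ minors of $B$ are relatively prime. Put $\beta_j=-b_{j1}/b_{j2}$, with the convention $\beta_j=-\infty$ if $b_{j2}=0$; the rows are ordered so that $\infty>\beta_1\ge\cdots\ge\beta_N\ge-\infty$. Here $\det(b_j,b_k)=b_{j1}b_{k2}-b_{j2}b_{k1}$ and $\det^+(b_j,b_k)=\max\{\det(b_j,b_k),0\}$. Horn--Kapranov parametrization: $\Psi[1:t]=\Big(\prod_{j=1}^N(b_{j1}+b_{j2}t)^{b_{j1}},\ \prod_{j=1}^N(b_{j1}+b_{j2}t)^{b_{j2}}\Big)$, a rational map on $\mathbf{C}P_1$ (with $t$ identified with $[1:t]$ and $\infty$ with $[0:1]$). $\operatorname{Arg}(x_1,x_2)=(\arg x_1,\arg x_2)$, regarded as a multivalued map to $\mathbf{R}^2$. Principal branch: let $[\beta_N,\beta_1]\subset\mathbf{R}\cup\{\infty\}\subset\mathbf{C}P_1$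 be the real segment from $\beta_N$ to $\beta_1$ containing all the $\beta_j$ (if $\beta_N=-\infty$ it is $\{\infty\}\cup(-\infty,\beta_1]$). On the simply connected surface $\mathbf{C}P_1\setminus[\beta_N,\beta_1]$, $[\operatorname{Arg}\circ\Psi]_0$ denotes the continuous branch of $\operatorname{Arg}\circ\Psi$ with values in $\mathbf{R}^2$ that takes one of the values $(0,0),(0,\pi),(\pi,0),(\pi,\pi)$ for real $t>\beta_1$. Principal coamoeba chain: $\mathcal{A}'_0=\mathcal{A}'_++\mathcal{A}'_-$, where $\mathcal{A}'_+$ and $\mathcal{A}'_-$ are the images, counted with multiplicity, under $[\operatorname{Arg}\circ\Psi]_0$ of $\{\operatorname{Im}t>0\}$ and $\{\operatorname{Im}t<0\}$. That is, $\mathcal{A}'_\pm$ is the (polygonal, simplicial) $2$-chain in $\mathbf{R}^2$, with the standard orientation of $\mathbf{R}^2$, whose multiplicity at a point $p$ (off a finite union of line segments) is the number of preimages of $p$ in the corresponding half plane. Zonotope: $\Pi_0\subset\mathbf{R}^2$ is the Minkowski sum $S_1+S_2+\cdots+S_N$ of the line segments $S_k=\operatorname{conv}\{(0,0),\pi b_k\}$, regarded as a positively oriented $2$-chain with multiplicity one. $\mathcal{A}'_B$ and $\Pi_B$ are the images (push-forwards as chains, so multiplicities are summed over preimages) of $\mathcal{A}'_0$ and $\Pi_0$ under the canonical projection $\mathbf{R}^2\to\mathbf{T}^2$. Thus $\mathcal{A}'_B+\Pi_B=m_B\mathbf{T}^2$ means that at every point of $\mathbf{T}^2$ outside the projected boundary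 segments, the multiplicities of $\mathcal{A}'_B$ and $\Pi_B$ add up to $m_B$. *)

theory Defs
  imports "HOL-Analysis.Analysis"
begin

text \<open>An integer \<open>N \<times> 2\<close> matrix is given by its rows \<open>b 1, \<dots>, b N :: int \<times> int\<close>; the values of \<open>b\<close>
  at other indices are never used.\<close>

definition row_det :: "int \<times> int \<Rightarrow> int \<times> int \<Rightarrow> int" where
  "row_det u v = fst u * snd v - snd u * fst v"

definition row_det_pos :: "int \<times> int \<Rightarrow> int \<times> int \<Rightarrow> int" where
  "row_det_pos u v = max (row_det u v) 0"

definition beta :: "int \<times> int \<Rightarrow> ereal" where
  "beta u = (if snd u = 0 then -\<infinity> else ereal (- real_of_int (fst u) / real_of_int (snd u)))"


section \<open>The Horn--Kapranov parametrization and the principal branch of its argument\<close>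

definition linear_factor :: "int \<times> int \<Rightarrow> complex \<Rightarrow> complex" where
  "linear_factor u t = of_int (fst u) + of_int (snd u) * t"

definition horn_kapranov :: "nat \<Rightarrow> (nat \<Rightarrow> int \<times> int) \<Rightarrow> complex \<Rightarrow> complex \<times> complex" where
  "horn_kapranov N b t =
     (\<Prod>j=1..N. linear_factor (b j) t powi fst (b j),
      \<Prod>j=1..N. linear_factor (b j) t powi snd (b j))"

text \<open>The finite points of the complement of the real segment from \<open>\<beta>\<^sub>N\<close> to \<open>\<beta>\<^sub>1\<close> in the projective line.
  The point at infinity belongs to that complement exactly when \<open>\<beta>\<^sub>N \<noteq> -\<infinity>\<close>.\<close>

definition slit_plane :: "nat \<Rightarrow> (nat \<Rightarrow> int \<times> int) \<Rightarrow> complex set" where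
  "slit_plane N b = - {complex_of_real x | x. beta (b N) \<le> ereal x \<and> ereal x \<le> beta (b 1)}"

text \<open>The limit clause is continuity at the point at infinity whenever that point lies in the domain.
  The last clause fixes the branch: it selects the constant on the ray \<open>t > \<beta>\<^sub>1\<close>, where the
  parametrization is real.\<close>

definition is_principal_branch ::
    "nat \<Rightarrow> (nat \<Rightarrow> int \<times> int) \<Rightarrow> (complex \<Rightarrow> real \<times> real) \<Rightarrow> bool" where
  "is_principal_branch N b f \<longleftrightarrow>
     continuous_on (slit_plane N b) f \<and>
     (beta (b N) \<noteq> -\<infinity> \<longrightarrow> (\<exists>l. (f \<longlongrightarrow> l) at_infinity)) \<and>
     (\<forall>t\<in>slit_plane N b.
        is_Arg (fst (horn_kapranov N b t)) (fst (f t)) \<and>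
        is_Arg (snd (horn_kapranov N b t)) (snd (f t))) \<and>
     (\<forall>x::real. beta (b 1) < ereal x \<longrightarrow>
        f (complex_of_real x) \<in> {(0, 0), (0, pi), (pi, 0), (pi, pi)})"

text \<open>These conditions determine the branch on \<^term>\<open>slit_plane N b\<close>, which contains both open half planes;
  the values elsewhere are irrelevant below.\<close>

definition principal_branch :: "nat \<Rightarrow> (nat \<Rightarrow> int \<times> int) \<Rightarrow> complex \<Rightarrow> real \<times> real" where
  "principal_branch N b = (SOME f. is_principal_branch N b f)"


section \<open>Polygonal 2-chains as multiplicity functions\<close>

text \<open>A 2-chain in the plane or on the torus, with the standard orientation, is represented by its
  integer multiplicity function, which is relevant only off a finite union of segments.\<close>

definition upper_chain :: "nat \<Rightarrow> (nat \<Rightarrow> int \<times> int) \<Rightarrow> real \<times> real \<Rightarrow> int" where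
  "upper_chain N b p = int (card {t. Im t > 0 \<and> principal_branch N b t = p})"

definition lower_chain :: "nat \<Rightarrow> (nat \<Rightarrow> int \<times> int) \<Rightarrow> real \<times> real \<Rightarrow> int" where
  "lower_chain N b p = int (card {t. Im t < 0 \<and> principal_branch N b t = p})"

definition principal_coamoeba_chain :: "nat \<Rightarrow> (nat \<Rightarrow> int \<times> int) \<Rightarrow> real \<times> real \<Rightarrow> int" where
  "principal_coamoeba_chain N b p = upper_chain N b p + lower_chain N b p"

definition zonotope :: "nat \<Rightarrow> (nat \<Rightarrow> int \<times> int) \<Rightarrow> (real \<times> real) set" where
  "zonotope N b =
     {\<Sum>k=1..N. x k | x. \<forall>k\<in>{1..N}.
        x k \<in> convex hull {(0, 0), (pi * real_of_int (fst (b k)), pi * real_of_int (snd (b k)))}}"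

definition zonotope_chain :: "nat \<Rightarrow> (nat \<Rightarrow> int \<times> int) \<Rightarrow> real \<times> real \<Rightarrow> int" where
  "zonotope_chain N b p = (if p \<in> zonotope N b then 1 else 0)"


section \<open>Chains on the torus\<close>

text \<open>The torus is the quotient of the plane by the lattice \<open>2\<pi>\<int>\<^sup>2\<close>; its points are cosets.\<close>

definition torus_proj :: "real \<times> real \<Rightarrow> (real \<times> real) set" where
  "torus_proj p = {p + (2 * pi * real_of_int m, 2 * pi * real_of_int n) | m n. True}"

definition torus :: "(real \<times> real) set set" where
  "torus = range torus_proj"

definition pushforward :: "(real \<times> real \<Rightarrow> int) \<Rightarrow> (real \<times> real) set \<Rightarrow> int" where
  "pushforward c \<theta> = (\<Sum>p | torus_proj p = \<theta> \<and> c p \<noteq> 0. c p)"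

definition coamoeba_chain :: "nat \<Rightarrow> (nat \<Rightarrow> int \<times> int) \<Rightarrow> (real \<times> real) set \<Rightarrow> int" where
  "coamoeba_chain N b = pushforward (principal_coamoeba_chain N b)"

definition torus_zonotope_chain :: "nat \<Rightarrow> (nat \<Rightarrow> int \<times> int) \<Rightarrow> (real \<times> real) set \<Rightarrow> int" where
  "torus_zonotope_chain N b = pushforward (zonotope_chain N b)"

text \<open>A property holds off finitely many projected segments. Segments may degenerate to points: at the
  finitely many critical values of the branch, the plain number of preimages is smaller than the
  generic multiplicity nearby.\<close>

definition off_segments :: "((real \<times> real) set \<Rightarrow> bool) \<Rightarrow> bool" where
  "off_segments P \<longleftrightarrow>
     (\<exists>S. finite S \<and>
        (\<forall>\<theta>\<in>torus - torus_proj ` (\<Union>(x, y)\<in>S. closed_segment x y). P \<theta>))"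

definition torus_chain_eq :: "((real \<times> real) set \<Rightarrow> int) \<Rightarrow> ((real \<times> real) set \<Rightarrow> int) \<Rightarrow> bool" where
  "torus_chain_eq c d \<longleftrightarrow> off_segments (\<lambda>\<theta>. c \<theta> = d \<theta>)"

text \<open>A \<open>C\<^sup>1\<close> function on the torus, as a doubly periodic function \<open>P\<close> on the plane with gradient \<open>G\<close>.\<close>

definition torus_C1 :: "(real \<times> real \<Rightarrow> real) \<Rightarrow> (real \<times> real \<Rightarrow> real \<times> real) \<Rightarrow> bool" where
  "torus_C1 P G \<longleftrightarrow>
     (\<forall>p q. torus_proj p = torus_proj q \<longrightarrow> P p = P q) \<and>
     (\<forall>p. (P has_derivative (\<lambda>h. G p \<bullet> h)) (at p)) \<and>
     continuous_on UNIV G"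

text \<open>The boundary of the chain with multiplicity \<open>c\<close> sends a 1-form \<open>\<omega> = P dx + Q dy\<close> to the integral
  over \<open>c\<close> of \<open>d\<omega> = (\<partial>Q/\<partial>x - \<partial>P/\<partial>y) dx \<and> dy\<close> (Stokes). A cycle is a chain whose boundary vanishes.\<close>

definition torus_cycle :: "((real \<times> real) set \<Rightarrow> int) \<Rightarrow> bool" where
  "torus_cycle c \<longleftrightarrow>
     (\<forall>P Q G H. torus_C1 P G \<and> torus_C1 Q H \<longrightarrow>
        ((\<lambda>p. real_of_int (c (torus_proj p)) * (fst (H p) - snd (G p))) has_integral 0)
          (cbox (0, 0) (2 * pi, 2 * pi)))"

end

theory Submission
  imports Defs "HOL-Computational_Algebra.Polynomial"
begin

text \<open>
  On the upper half plane the principal branch is a constant plus \<open>\<Sum>j. \<alpha>\<^sub>j b\<^sub>j\<close> with \<open>\<alpha>\<^sub>j = arg (t - \<beta>\<^sub>j)\<close>.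
  Since the two logarithmic derivatives of the parametrization have quotient \<open>-t\<close>, this harmonic map
  behaves like \<open>cnj\<close> near its noncritical points. An argument principle therefore
  identifies the number of preimages of a generic point with the winding number of the polygon with
  vertices \<open>\<pi> (b\<^sub>1 + \<dots> + b\<^sub>k)\<close>, that is, with a signed number of crossings of its edges with a horizontal
  ray; the lower half plane is obtained by a point reflection. The zonotope is a crossing number as well.

  In units of \<open>\<pi>\<close> all vertices are integral, and summing crossings over the lattice \<open>2\<int>\<^sup>2\<close> turns each edge
  into a sawtooth of its abscissa plus half that abscissa. Modulo \<open>2\<int>\<^sup>2\<close> the boundary edges of the
  coamoeba and of the zonotope parallel to \<open>b\<^sub>k\<close> cancel, so the sawtooth terms disappear and the
  multiplicity depends only on the ordinate \<open>y\<close>. It is constant for \<open>y\<close> between consecutive integers and even,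
  hence has period one, and the sum of its values at \<open>y\<close> and \<open>y + 1\<close> is given by the shoelace formula.
\<close>

section \<open>Angles of linear factors\<close>

text \<open>The boundary values of the angle sum form a step function: a whole edge of the polygon
  is compressed into one real point, where the map is discontinuous. What survives there is the
  functional \<open>Re + \<beta> Im\<close>, which is constant on that edge and extends
  continuously. When it differs from its value at the target point, nearby differences stay in a
  half plane, and this controls their argument across the discontinuity. The map is not
  antiholomorphic either; only the antilinear part of its derivative dominates. Its zeros are
  therefore described by an estimate with relative error below one and divided out by conjugated
  Blaschke factors. Rows with second entry zero give constant linear factors and horizontal edges;
  these edges belong to the point at infinity and are never crossed at a nonintegral height. A
  lattice sum at ordinate y sees only the heights y + 2n. Joining y and y + 1 makes the crossed
  abscissae of an edge a full arithmetic progression, which is why the shoelace formula gives only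
  the sum of the two values. The cycle property comes last, as a consequence of constant
  multiplicity.\<close>

definition line_angle :: "real \<Rightarrow> complex \<Rightarrow> real" where
  "line_angle \<beta> t = arccos (Re (t - of_real \<beta>) / cmod (t - of_real \<beta>))"

lemma abs_Re_over_cmod_le: "\<bar>Re z / cmod z\<bar> \<le> 1"
  using abs_Re_le_cmod[of z] by (auto simp: divide_le_eq)

lemma Re_over_cmod_bounds: "-1 \<le> Re z / cmod z" "Re z / cmod z \<le> 1"
  using abs_Re_over_cmod_le[of z] by linarith+

lemma line_angle_bounds: "0 \<le> line_angle \<beta> t" "line_angle \<beta> t \<le> pi"
  unfolding line_angle_def by (intro arccos_lbound arccos_ubound Re_over_cmod_bounds)+

lemma line_angle_of_real_less: "\<beta> < x \<Longrightarrow> line_angle \<beta> (of_real x) = 0"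
  by (simp add: line_angle_def cmod_def)

lemma line_angle_of_real_greater: "x < \<beta> \<Longrightarrow> line_angle \<beta> (of_real x) = pi"
proof -
  assume "x < \<beta>"
  then have "Re (of_real x - of_real \<beta>) / cmod (of_real x - of_real \<beta>) = -1"
    by (simp add: cmod_def divide_simps)
  then show ?thesis by (simp only: line_angle_def arccos_minus_1)
qed

lemma line_angle_cnj: "line_angle \<beta> (cnj t) = line_angle \<beta> t"
  unfolding line_angle_def cmod_def by simp

lemma continuous_on_line_angle: "continuous_on (- {of_real \<beta>}) (line_angle \<beta>)"
  unfolding line_angle_def
  by (intro continuous_on_arccos continuous_intros ballI conjI Re_over_cmod_bounds) auto

text \<open>The arccosine sees only the real part, so \<open>line_angle\<close> is the polar angle
  above the real axis and its mirror image below. In exchange it has no branch cut: it is continuous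
  everywhere except at \<beta>.\<close>

lemma cis_line_angle:
  assumes "0 \<le> Im t"
  shows "t - of_real \<beta> = of_real (cmod (t - of_real \<beta>)) * cis (line_angle \<beta> t)"
proof (cases "t = of_real \<beta>")
  case False
  define z where "z = t - of_real \<beta>"
  have z: "cmod z > 0" "Im z \<ge> 0" using False assms by (auto simp: z_def)
  have le: "\<bar>Re z / cmod z\<bar> \<le> 1" by (rule abs_Re_over_cmod_le)
  have "1 - (Re z / cmod z)\<^sup>2 = (Im z / cmod z)\<^sup>2"
    using z cmod_power2[of z]
    by (auto simp: power_divide eq_divide_eq diff_divide_eq_iff complex_eq_iff)
  then have "sqrt (1 - (Re z / cmod z)\<^sup>2) = Im z / cmod z"
    using z by (simp add: real_sqrt_divide del: power_divide)
  moreover have "cos (arccos (Re z / cmod z)) = Re z / cmod z" "sin (arccos (Re z / cmod z)) = sqrt (1 - (Re z / cmod z)\<^sup>2)"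
    using le by (auto intro: cos_arccos_abs sin_arccos_abs)
  ultimately show ?thesis using z unfolding line_angle_def z_def[symmetric]
    by (auto simp: complex_eq_iff)
qed auto

lemma line_angle_eq_Im_Ln:
  assumes "0 < Im t"
  shows "line_angle \<beta> t = Im (Ln (t - of_real \<beta>))"
proof -
  have nz: "t - of_real \<beta> \<noteq> 0" using assms by auto
  have "Arg (t - of_real \<beta>) = line_angle \<beta> t"
  proof (rule Arg_unique)
    show "of_real (cmod (t - of_real \<beta>)) * exp (\<i> * of_real (line_angle \<beta> t)) = t - of_real \<beta>"
      using cis_line_angle[of t \<beta>] assms by (simp add: cis_conv_exp)
  qed (use nz line_angle_bounds[of \<beta> t] pi_gt_zero in \<open>auto intro: less_le_trans[of _ 0]\<close>)
  then show ?thesis using nz Arg_eq_Im_Ln by simp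
qed

text \<open>Moving a large t by a bounded amount hardly changes its direction, and arccos is
  uniformly continuous on [-1, 1]. Hence angle sums whose coefficients add up to zero tend to 0 at
  infinity.\<close>

lemma line_angle_diff_at_infinity:
  "((\<lambda>t. line_angle \<beta> t - line_angle \<gamma> t) \<longlongrightarrow> 0) at_infinity"
proof (rule tendstoI)
  fix e :: real assume "e > 0"
  have "uniformly_continuous_on {-1..1} arccos"
    by (intro compact_uniformly_continuous continuous_on_arccos') auto
  then obtain d where d: "d > 0" "\<And>x y. \<lbrakk>\<bar>x\<bar> \<le> 1; \<bar>y\<bar> \<le> 1; \<bar>x - y\<bar> < d\<rbrakk> \<Longrightarrow> \<bar>arccos x - arccos y\<bar> < e"
    using \<open>e > 0\<close> unfolding uniformly_continuous_on_def dist_real_def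
    by (metis abs_le_iff atLeastAtMost_iff minus_le_iff)
  have key: "\<bar>Re z / cmod z - Re w / cmod w\<bar> \<le> 2 * cmod (z - w) / cmod z" if "z \<noteq> 0" "w \<noteq> 0" for z w
  proof -
    have "Re z / cmod z - Re w / cmod w = Re (z - w) / cmod z + Re w / cmod w * ((cmod w - cmod z) / cmod z)"
      using that by (simp add: field_simps)
    also have "\<bar>\<dots>\<bar> \<le> \<bar>Re (z - w) / cmod z\<bar> + \<bar>Re w / cmod w * ((cmod w - cmod z) / cmod z)\<bar>"
      by (rule abs_triangle_ineq)
    also have "\<bar>Re (z - w) / cmod z\<bar> \<le> cmod (z - w) / cmod z"
      using abs_Re_le_cmod[of "z - w"] by (simp add: divide_right_mono del: minus_complex.sel)
    also have "\<bar>Re w / cmod w * ((cmod w - cmod z) / cmod z)\<bar> \<le> 1 * (cmod (z - w) / cmod z)"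
      unfolding abs_mult
    proof (rule mult_mono)
      have "\<bar>cmod w - cmod z\<bar> \<le> cmod (z - w)"
        using norm_triangle_ineq3[of w z] by (simp add: norm_minus_commute)
      then show "\<bar>(cmod w - cmod z) / cmod z\<bar> \<le> cmod (z - w) / cmod z" by (simp add: divide_right_mono)
    qed (use abs_Re_over_cmod_le[of w] in auto)
    finally show ?thesis by (simp add: field_simps)
  qed
  define R where "R = \<bar>\<beta>\<bar> + \<bar>\<gamma>\<bar> + 2 * \<bar>\<gamma> - \<beta>\<bar> / d + 1"
  have "\<bar>line_angle \<beta> t - line_angle \<gamma> t\<bar> < e" if "R \<le> cmod t" for t
    unfolding line_angle_def
  proof (rule d(2))
    have q: "0 \<le> 2 * \<bar>\<gamma> - \<beta>\<bar> / d" using d(1) by simp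
    have nb: "cmod (t - of_real \<beta>) \<ge> cmod t - \<bar>\<beta>\<bar>" using norm_triangle_ineq2[of t "of_real \<beta>"] by simp
    have ng: "cmod (t - of_real \<gamma>) \<ge> cmod t - \<bar>\<gamma>\<bar>" using norm_triangle_ineq2[of t "of_real \<gamma>"] by simp
    have gt: "cmod (t - of_real \<beta>) > 2 * \<bar>\<gamma> - \<beta>\<bar> / d"
      using nb that q unfolding R_def by linarith
    have pos: "cmod (t - of_real \<beta>) > 0" "cmod (t - of_real \<gamma>) > 0"
      using nb ng gt that q unfolding R_def by linarith+
    have "\<bar>Re (t - of_real \<beta>) / cmod (t - of_real \<beta>) - Re (t - of_real \<gamma>) / cmod (t - of_real \<gamma>)\<bar>
        \<le> 2 * cmod ((t - of_real \<beta>) - (t - of_real \<gamma>)) / cmod (t - of_real \<beta>)"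
      using pos by (intro key) auto
    also have "cmod ((t - of_real \<beta>) - (t - of_real \<gamma>)) = \<bar>\<gamma> - \<beta>\<bar>"
      by (simp add: norm_of_real flip: of_real_diff)
    also have "2 * \<bar>\<gamma> - \<beta>\<bar> / cmod (t - of_real \<beta>) < d"
      using gt pos d(1) by (simp add: field_simps)
    finally show "\<bar>Re (t - of_real \<beta>) / cmod (t - of_real \<beta>) - Re (t - of_real \<gamma>) / cmod (t - of_real \<gamma>)\<bar> < d" .
  qed (rule abs_Re_over_cmod_le)+
  then show "\<forall>\<^sub>F t in at_infinity. dist (line_angle \<beta> t - line_angle \<gamma> t) 0 < e"
    unfolding eventually_at_infinity by (auto simp: dist_real_def)
qed

lemma is_Arg_mult: "\<lbrakk>is_Arg z r; is_Arg w s\<rbrakk> \<Longrightarrow> is_Arg (z * w) (r + s)"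
  unfolding is_Arg_def by (simp add: norm_mult distrib_left exp_add) (metis mult.assoc mult.left_commute)

lemma is_Arg_prod: "(\<And>j. j \<in> S \<Longrightarrow> is_Arg (f j) (r j)) \<Longrightarrow> is_Arg (\<Prod>j\<in>S. f j) (\<Sum>j\<in>S. r j)"
proof (induction S rule: infinite_finite_induct)
  case (insert j S)
  then show ?case by (simp add: is_Arg_mult)
qed (simp_all add: is_Arg_def)

lemma is_Arg_power_int: "is_Arg z r \<Longrightarrow> is_Arg (z powi n) (of_int n * r)"
proof -
  assume "is_Arg z r"
  then have "z powi n = (of_real (norm z) * exp (\<i> * of_real r)) powi n" by (simp add: is_Arg_def)
  also have "\<dots> = of_real (norm (z powi n)) * exp (\<i> * of_real (of_int n * r))"
    by (simp add: power_int_mult_distrib exp_power_int norm_power_int of_real_power_int mult_ac)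
  finally show ?thesis by (simp add: is_Arg_def)
qed

lemma is_Arg_diff_exp:
  assumes "is_Arg z r" "is_Arg z s" "z \<noteq> 0"
  shows "exp (\<i> * of_real (r - s)) = 1"
proof -
  have "of_real (norm z) * exp (\<i> * of_real r) = of_real (norm z) * exp (\<i> * of_real s)"
    using assms(1,2) unfolding is_Arg_def by metis
  then have "exp (\<i> * of_real r) = exp (\<i> * of_real s)" using assms(3) by simp
  then show ?thesis by (simp add: right_diff_distrib exp_diff)
qed

section \<open>Continuous logarithms in the half plane\<close>

text \<open>Polar coordinates present the set as an image of I times [0, pi]. Punctured half discs
  around real points and the exterior of a half disc both have this form.\<close>

lemma connected_upper_annulus:
  assumes "connected I" "I \<subseteq> {0<..}"
  shows "connected {t. 0 \<le> Im t \<and> cmod (t - of_real x) \<in> I}"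
proof -
  have "{t. 0 \<le> Im t \<and> cmod (t - of_real x) \<in> I} =
      (\<lambda>(r, \<phi>). of_real x + of_real r * cis \<phi>) ` (I \<times> {0..pi})" (is "?A = ?f ` _")
  proof (intro equalityI subsetI)
    fix t assume t: "t \<in> ?A"
    then have "t = ?f (cmod (t - of_real x), line_angle x t)"
      using cis_line_angle[of t x] by (simp add: algebra_simps)
    moreover have "(cmod (t - of_real x), line_angle x t) \<in> I \<times> {0..pi}"
      using t line_angle_bounds[of x t] by simp
    ultimately show "t \<in> ?f ` (I \<times> {0..pi})" by (rule image_eqI)
  next
    fix t assume "t \<in> ?f ` (I \<times> {0..pi})"
    then obtain r \<phi> where "t = of_real x + of_real r * cis \<phi>" "r \<in> I" "0 \<le> \<phi>" "\<phi> \<le> pi" by auto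
    with assms(2) show "t \<in> ?A"
      using mult_nonneg_nonneg[of r "sin \<phi>"] sin_ge_zero[of \<phi>] by (auto simp: norm_mult)
  qed
  moreover have cont: "continuous_on (I \<times> {0..pi}) ?f"
    unfolding case_prod_unfold cis_conv_exp by (intro continuous_intros)
  moreover have "connected (I \<times> {0..pi})"
    using assms(1) by (intro connected_Times) auto
  ultimately show ?thesis using connected_continuous_image[of _ ?f] cont by simp
qed

text \<open>Values with equal exponentials differ by multiples of 2 pi i, so the range is
  discrete.\<close>

lemma continuous_exp_const_imp_const:
  fixes h :: "'a::topological_space \<Rightarrow> complex"
  assumes "connected T" "continuous_on T h" "\<And>t. t \<in> T \<Longrightarrow> exp (h t) = c" "s \<in> T" "t \<in> T"
  shows "h s = h t"
proof -
  have "h constant_on T"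
  proof (rule continuous_discrete_range_constant[OF assms(1,2)])
    fix x assume x: "x \<in> T"
    show "\<exists>e>0. \<forall>y. y \<in> T \<and> h y \<noteq> h x \<longrightarrow> e \<le> norm (h y - h x)"
    proof (intro exI[of _ "2 * pi"] conjI allI impI)
      fix y assume y: "y \<in> T \<and> h y \<noteq> h x"
      then have "exp (h y) = exp (h x)" using assms(3) x by metis
      then obtain n :: int where n: "h y = h x + (of_int (2 * n) * pi) * \<i>"
        unfolding exp_eq by auto
      with y have "n \<noteq> 0" by auto
      then have "1 \<le> \<bar>real_of_int n\<bar>" by linarith
      moreover have "norm (h y - h x) = 2 * pi * \<bar>real_of_int n\<bar>"
        unfolding n by (simp add: norm_mult abs_mult)
      ultimately show "2 * pi \<le> norm (h y - h x)" by simp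
    qed simp
  qed
  with assms(4,5) show ?thesis by (auto simp: constant_on_def)
qed

text \<open>Multiplication by \<zeta> moves the values of w into the right half plane, where
  \<open>Ln\<close> is continuous and no winding is possible. Every continuous logarithm of w then
  changes by the same amount as the principal argument.\<close>

lemma log_change_in_half_plane:
  fixes w :: "complex \<Rightarrow> complex"
  assumes "connected T" "continuous_on T w" "continuous_on T \<Lambda>"
    and ex: "\<And>t. t \<in> T \<Longrightarrow> exp (\<Lambda> t) = w t"
    and hp: "\<And>t. t \<in> T \<Longrightarrow> Re (\<zeta> * w t) > 0"
    and "s \<in> T" "t \<in> T"
  shows "Im (\<Lambda> s) - Im (\<Lambda> t) = Arg (\<zeta> * w s) - Arg (\<zeta> * w t)"
proof -
  have nz: "\<zeta> * w t \<noteq> 0" if "t \<in> T" for t using hp[OF that] by auto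
  have "\<Lambda> s - Ln (\<zeta> * w s) = \<Lambda> t - Ln (\<zeta> * w t)"
  proof (rule continuous_exp_const_imp_const[OF assms(1) _ _ \<open>s \<in> T\<close> \<open>t \<in> T\<close>])
    show "continuous_on T (\<lambda>t. \<Lambda> t - Ln (\<zeta> * w t))"
    proof (intro continuous_intros assms)
      fix t assume "t \<in> T"
      from hp[OF this] show "\<zeta> * w t \<notin> \<real>\<^sub>\<le>\<^sub>0"
        by (auto simp: complex_nonpos_Reals_iff)
    qed
    show "exp (\<Lambda> t - Ln (\<zeta> * w t)) = 1 / \<zeta>" if "t \<in> T" for t
      using nz[OF that] ex[OF that] by (simp add: exp_diff)
  qed
  then have "Im (\<Lambda> s) - Im (\<Lambda> t) = Im (Ln (\<zeta> * w s)) - Im (Ln (\<zeta> * w t))"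
    by (simp add: complex_eq_iff)
  then show ?thesis using nz assms by (simp add: Arg_eq_Im_Ln)
qed

text \<open>\<open>Arg z\<close> lies strictly within pi/2 of 0 and a within pi/2, so their sum
  cannot leave the principal range.\<close>

lemma Arg_in_half_plane_eq:
  assumes "Re z > 0" "\<bar>a\<bar> \<le> pi / 2" "z * cis a = r * w" "(r::real) > 0"
  shows "Arg w = Arg z + a"
proof (rule Arg_unique)
  have nz: "z \<noteq> 0" using assms(1) by auto
  have b: "\<bar>Arg z\<bar> < pi / 2" using assms(1) Arg_lt_pi Re_Ln_pos_lt nz by (simp add: Arg_eq_Im_Ln)
  show "- pi < Arg z + a" "Arg z + a \<le> pi" using b assms(2) by auto
  have z: "z = of_real (cmod z) * cis (Arg z)" using nz by (metis rcis_cmod_Arg rcis_def)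
  have "of_real (cmod z / r) * exp (\<i> * of_real (Arg z + a)) = of_real (1 / r) * (of_real (cmod z) * cis (Arg z)) * cis a"
    using assms(4) by (simp only: cis_conv_exp[symmetric] mult.assoc cis_mult) simp
  also have "\<dots> = of_real (1 / r) * (z * cis a)" using z by simp
  also have "\<dots> = w" using assms(3,4) by simp
  finally show "of_real (cmod z / r) * exp (\<i> * of_real (Arg z + a)) = w" .
  show "cmod z / r > 0" using nz assms(4) by simp
qed

text \<open>Here \<open>\<eta>\<close> is the point where the line meets the real axis: moving along the line, the principal
  argument differs from a continuous one by a jump exactly when \<open>\<eta> < 0\<close>, i.e. on the branch cut.\<close>

lemma Arg_rotate_line:
  fixes w :: complex and \<beta> \<eta> :: real
  defines "\<zeta> \<equiv> of_real (sgn \<eta>) * Complex 1 (- \<beta>)"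
  assumes line: "Re w + \<beta> * Im w = \<eta>" and "\<eta> \<noteq> 0" "Im w \<noteq> 0"
  shows "Re (\<zeta> * w) = \<bar>\<eta>\<bar>"
    and "Arg (\<zeta> * w) - Arg w = Arg (Complex 1 (- \<beta>)) - (if \<eta> < 0 then if Im w > 0 then pi else - pi else 0)"
proof -
  show re: "Re (\<zeta> * w) = \<bar>\<eta>\<bar>"
    unfolding \<zeta>_def using line by (auto simp: sgn_if abs_if algebra_simps)
  define \<zeta>0 where "\<zeta>0 = Complex 1 (- \<beta>)"
  define \<phi> where "\<phi> = Arg \<zeta>0"
  have z0: "\<zeta>0 \<noteq> 0" by (simp add: \<zeta>0_def complex_eq_iff)
  have \<phi>: "\<bar>\<phi>\<bar> < pi / 2" using Re_Ln_pos_lt[OF z0] z0 unfolding \<phi>_def by (simp add: Arg_eq_Im_Ln \<zeta>0_def)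
  have \<zeta>0: "\<zeta>0 = of_real (cmod \<zeta>0) * cis \<phi>" using z0 unfolding \<phi>_def by (metis rcis_cmod_Arg rcis_def)
  have w0: "w \<noteq> 0" using assms(4) by auto
  have "Arg (of_real (sgn \<eta>) * w) = Arg (\<zeta> * w) + (- \<phi>)"
  proof (rule Arg_in_half_plane_eq[where r = "cmod \<zeta>0"])
    have "\<zeta> * w * cis (- \<phi>) = of_real (sgn \<eta>) * w * of_real (cmod \<zeta>0) * (cis \<phi> * cis (- \<phi>))"
      unfolding \<zeta>_def \<zeta>0_def[symmetric] by (subst \<zeta>0) (simp add: algebra_simps)
    then show "\<zeta> * w * cis (- \<phi>) = complex_of_real (cmod \<zeta>0) * (of_real (sgn \<eta>) * w)"
      by (simp only: cis_mult) (simp add: mult_ac)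
  qed (use re assms(3) \<phi> z0 in auto)
  \<comment> \<open>For negative \<eta> the factor \<open>sgn \<eta>\<close> replaces w by -w, which
    shifts the principal argument by pi in a direction determined by the sign of
    \<open>Im w\<close>.\<close>
  moreover have "Arg (of_real (sgn \<eta>) * w) = Arg w - (if \<eta> < 0 then if Im w > 0 then pi else - pi else 0)"
    using assms(3,4) w0 Arg_minus[OF w0] Arg_lt_pi[of w] Arg_less_0[of w] Arg_le_pi[of w]
    by (auto simp: sgn_if Arg_eq_0 complex_is_Real_iff)
  ultimately show "Arg (\<zeta> * w) - Arg w = Arg (Complex 1 (- \<beta>)) - (if \<eta> < 0 then if Im w > 0 then pi else - pi else 0)"
    unfolding \<phi>_def \<zeta>0_def by linarith
qed

section \<open>Dividing out zeros of antiholomorphic type\<close>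

text \<open>The complex conjugate of the Blaschke factor of the upper half plane at a, conjugated
  because the zeros to be removed reverse orientation.\<close>

definition half_plane_factor :: "complex \<Rightarrow> complex \<Rightarrow> complex" where
  "half_plane_factor a t = cnj ((t - a) / (t - cnj a))"

text \<open>Modelled on a zero of a differentiable map whose derivative has an antilinear part
  larger than its linear part. A relative error below 1, rather than an error of smaller order, is
  what such a zero provides, and it survives multiplication by continuous nonvanishing
  functions.\<close>

definition antiholomorphic_like_zero :: "(complex \<Rightarrow> complex) \<Rightarrow> complex \<Rightarrow> bool" where
  "antiholomorphic_like_zero F a \<longleftrightarrow> (\<exists>b \<kappa>. b \<noteq> 0 \<and> \<kappa> < 1 \<and>
     (\<forall>\<^sub>F t in at a. cmod (F t - b * cnj (t - a)) \<le> \<kappa> * (cmod b * cmod (t - a))))"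

text \<open>Freezing m at a costs an error proportional to \<open>cmod (m t - m a)\<close>, which
  tends to 0. The relative error therefore tends to \<kappa> and is eventually below the midpoint
  \<open>(1 + \<kappa>) / 2\<close> of \<kappa> and 1.\<close>

lemma antiholomorphic_like_zero_mult:
  assumes "antiholomorphic_like_zero F a" "isCont m a" "m a \<noteq> 0"
    and F': "\<forall>\<^sub>F t in at a. F' t = F t * m t"
  shows "antiholomorphic_like_zero F' a"
proof -
  obtain b \<kappa>0 where b: "b \<noteq> 0" "\<kappa>0 < 1"
    and F0: "\<forall>\<^sub>F t in at a. cmod (F t - b * cnj (t - a)) \<le> \<kappa>0 * (cmod b * cmod (t - a))"
    using assms(1) unfolding antiholomorphic_like_zero_def by blast
  define \<kappa> where "\<kappa> = max 0 \<kappa>0"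
  have \<kappa>: "0 \<le> \<kappa>" "\<kappa> < 1" using b by (auto simp: \<kappa>_def)
  have F: "\<forall>\<^sub>F t in at a. cmod (F t - b * cnj (t - a)) \<le> \<kappa> * (cmod b * cmod (t - a))"
    using F0 by eventually_elim (erule order_trans, simp add: \<kappa>_def mult_right_mono)
  have m: "m \<midarrow>a\<rightarrow> m a" using assms(2) by (simp add: isCont_def)
  have "((\<lambda>t. \<kappa> * cmod (m t) + cmod (m t - m a)) \<longlongrightarrow> \<kappa> * cmod (m a) + cmod (m a - m a)) (at a)"
    by (intro tendsto_intros m)
  moreover have "\<kappa> * cmod (m a) + cmod (m a - m a) < (1 + \<kappa>) / 2 * cmod (m a)"
    using \<kappa> assms(3) by (simp add: mult_strict_right_mono)
  ultimately have "\<forall>\<^sub>F t in at a. \<kappa> * cmod (m t) + cmod (m t - m a) < (1 + \<kappa>) / 2 * cmod (m a)"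
    by (rule order_tendstoD)
  with F F' have "\<forall>\<^sub>F t in at a. cmod (F' t - (b * m a) * cnj (t - a)) \<le> (1 + \<kappa>) / 2 * (cmod (b * m a) * cmod (t - a))"
  proof eventually_elim
    case (elim t)
    have "F' t - (b * m a) * cnj (t - a) = m t * (F t - b * cnj (t - a)) + b * cnj (t - a) * (m t - m a)"
      unfolding elim(2) by (simp add: algebra_simps)
    also have "cmod \<dots> \<le> cmod (m t) * cmod (F t - b * cnj (t - a)) + cmod b * cmod (t - a) * cmod (m t - m a)"
      by (rule order_trans[OF norm_triangle_ineq]) (simp add: norm_mult del: complex_cnj_diff)
    also have "cmod (m t) * cmod (F t - b * cnj (t - a)) \<le> cmod (m t) * (\<kappa> * (cmod b * cmod (t - a)))"
      by (intro mult_left_mono elim) auto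
    also have "cmod (m t) * (\<kappa> * (cmod b * cmod (t - a))) + cmod b * cmod (t - a) * cmod (m t - m a)
        = (\<kappa> * cmod (m t) + cmod (m t - m a)) * (cmod b * cmod (t - a))"
      by (simp add: algebra_simps)
    also have "\<dots> \<le> ((1 + \<kappa>) / 2 * cmod (m a)) * (cmod b * cmod (t - a))"
      by (intro mult_right_mono less_imp_le[OF elim(3)]) auto
    finally show ?case by (simp add: norm_mult algebra_simps)
  qed
  then show ?thesis unfolding antiholomorphic_like_zero_def
    using b assms(3) \<kappa> by (intro exI[of _ "b * m a"] exI[of _ "(1 + \<kappa>) / 2"]) auto
qed

text \<open>Near \<open>a\<close> the quotient of \<open>F\<close> by \<open>cnj (t - a)\<close> need not extend continuously, but it stays in a disc
  around \<open>b\<close> that avoids \<open>0\<close>; its deviation from \<open>b\<close> is damped linearly to \<open>0\<close> at \<open>a\<close>.\<close>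

lemma remove_antiholomorphic_like_zero:
  assumes S: "S \<subseteq> {t. 0 \<le> Im t}" and a: "0 < Im a" and F: "continuous_on S F"
    and z: "antiholomorphic_like_zero F a" and "\<epsilon> > 0"
  obtains r F' where "0 < r" "r \<le> \<epsilon>" "continuous_on S F'"
    "\<And>t. \<lbrakk>t \<in> S; dist a t < r\<rbrakk> \<Longrightarrow> F' t \<noteq> 0" "\<And>t. \<lbrakk>t \<noteq> a; dist a t \<le> r\<rbrakk> \<Longrightarrow> F t \<noteq> 0"
    "\<And>t. \<lbrakk>t \<in> S; r \<le> dist a t\<rbrakk> \<Longrightarrow> F t = F' t * half_plane_factor a t"
proof -
  obtain b \<kappa> where b: "b \<noteq> 0" "\<kappa> < 1"
    and ev: "\<forall>\<^sub>F t in at a. cmod (F t - b * cnj (t - a)) \<le> \<kappa> * (cmod b * cmod (t - a))"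
    using z unfolding antiholomorphic_like_zero_def by blast
  then obtain r0 where r0: "r0 > 0"
    "\<And>t. \<lbrakk>t \<noteq> a; dist t a < r0\<rbrakk> \<Longrightarrow> cmod (F t - b * cnj (t - a)) \<le> \<kappa> * (cmod b * cmod (t - a))"
    unfolding eventually_at by auto
  define r where "r = min (r0 / 2) \<epsilon>"
  have r: "0 < r" "r \<le> \<epsilon>" "r < r0" using r0 \<open>\<epsilon> > 0\<close> by (auto simp: r_def)
  have den: "t \<noteq> cnj a" "cnj t \<noteq> a" if "t \<in> S" for t using S a that by (auto simp: complex_eq_iff)
  define Q where "Q t = F t / cnj (t - a) - b" for t
  have Q: "cmod (Q t) < cmod b" if "dist a t \<le> r" "t \<noteq> a" for t
  proof -
    have "Q t = (F t - b * cnj (t - a)) / cnj (t - a)"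
      using that by (simp add: Q_def diff_divide_distrib)
    then have "cmod (Q t) = cmod (F t - b * cnj (t - a)) / cmod (t - a)"
      by (simp add: norm_divide del: complex_cnj_diff)
    also have "\<dots> \<le> \<kappa> * cmod b"
      using r0(2)[of t] that r by (simp add: divide_le_eq dist_commute mult_ac)
    also have "\<dots> < cmod b" using b by simp
    finally show ?thesis .
  qed
  define \<mu> where "\<mu> t = min 1 (cmod (t - a) / r)" for t
  have mu: "0 \<le> \<mu> t" "\<mu> t \<le> 1" for t using r by (auto simp: \<mu>_def)
  define F' where "F' t = cnj (t - cnj a) * (b + of_real (\<mu> t) * Q t)" for t
  show thesis
  proof
    show "F' t \<noteq> 0" if "t \<in> S" "dist a t < r" for t
    proof (cases "t = a")
      case True
      then show ?thesis using den[OF that(1)] b by (simp add: F'_def \<mu>_def)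
    next
      case False
      have "\<mu> t * cmod (Q t) \<le> 1 * cmod (Q t)" by (intro mult_right_mono mu) auto
      then have "cmod (of_real (\<mu> t) * Q t) < cmod b"
        using Q[OF less_imp_le[OF that(2)] False] mu[of t] by (simp add: norm_mult)
      then have "b + of_real (\<mu> t) * Q t \<noteq> 0"
        by (metis add.inverse_inverse add_eq_0_iff norm_minus_cancel order_less_irrefl)
      then show ?thesis using den[OF that(1)] by (simp add: F'_def)
    qed
    show "F t \<noteq> 0" if "t \<noteq> a" "dist a t \<le> r" for t
      using Q[OF that(2,1)] by (auto simp: Q_def)
    show "F t = F' t * half_plane_factor a t" if "t \<in> S" "r \<le> dist a t" for t
    proof -
      have "\<mu> t = 1" "t \<noteq> a" using that r by (auto simp: \<mu>_def dist_norm norm_minus_commute)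
      then show ?thesis using den[OF that(1)] by (simp add: F'_def Q_def half_plane_factor_def)
    qed
    have "continuous (at t within S) (\<lambda>t. of_real (\<mu> t) * Q t)" if "t \<in> S" for t
    proof (cases "t = a")
      case False
      have "continuous (at t within S) F" using F that by (simp add: continuous_on_eq_continuous_within)
      then show ?thesis unfolding \<mu>_def Q_def using False r
        by (intro continuous_intros) auto
    next
      case True
      have "((\<lambda>t. of_real (\<mu> t) * Q t) \<longlongrightarrow> 0) (at a within S)"
      proof (rule Lim_null_comparison)
        show "\<forall>\<^sub>F t in at a within S. norm (of_real (\<mu> t) * Q t) \<le> cmod (t - a) / r * cmod b"
          unfolding eventually_at
        proof (intro exI[of _ r] conjI ballI impI r)
          fix t assume t: "t \<in> S" "t \<noteq> a \<and> dist t a < r"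
          have "\<mu> t * cmod (Q t) \<le> cmod (t - a) / r * cmod b"
            using Q[of t] t r by (intro mult_mono) (auto simp: \<mu>_def dist_commute)
          then show "norm (of_real (\<mu> t) * Q t) \<le> cmod (t - a) / r * cmod b"
            using mu[of t] by (simp add: norm_mult)
        qed
        have "((\<lambda>t. cmod (t - a) / r * cmod b) \<longlongrightarrow> cmod (a - a) / r * cmod b) (at a within S)"
          using r by (intro tendsto_intros) auto
        then show "((\<lambda>t. cmod (t - a) / r * cmod b) \<longlongrightarrow> 0) (at a within S)" by simp
      qed
      then show ?thesis using True by (simp add: continuous_within \<mu>_def)
    qed
    then have c: "continuous_on S (\<lambda>t. of_real (\<mu> t) * Q t)"
      by (simp add: continuous_on_eq_continuous_within)
    show "continuous_on S F'"
      unfolding F'_def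
      by (rule continuous_on_mult, intro continuous_intros, rule continuous_on_add, rule continuous_on_const, rule c)
  qed (use r in auto)
qed

text \<open>Zeros are removed one at a time. Removing a divides F by its factor outside a disc of
  radius at most \<epsilon> that contains no other zero, so the remaining zeros keep their type.
  Inside the disc the new function is merely nonvanishing, which is why the factorization is claimed
  only at distance \<epsilon> from the zeros.\<close>

lemma factor_antiholomorphic_like_zeros:
  assumes S: "S \<subseteq> {t. 0 \<le> Im t}" and "finite D"
  shows "\<lbrakk>continuous_on S F; {t \<in> S. F t = 0} = D; \<And>a. a \<in> D \<Longrightarrow> 0 < Im a;
      \<And>a. a \<in> D \<Longrightarrow> antiholomorphic_like_zero F a; \<And>a. a \<in> D \<Longrightarrow> a \<in> interior S; 0 < \<epsilon>\<rbrakk> \<Longrightarrow>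
    \<exists>F'. continuous_on S F' \<and> (\<forall>t\<in>S. F' t \<noteq> 0) \<and>
      (\<forall>t\<in>S. (\<forall>a\<in>D. \<epsilon> \<le> dist a t) \<longrightarrow> F t = F' t * (\<Prod>a\<in>D. half_plane_factor a t))"
  using \<open>finite D\<close>
proof (induction D arbitrary: F rule: finite_induct)
  case empty
  then show ?case by (intro exI[of _ F]) auto
next
  case (insert a D)
  have a: "0 < Im a" "antiholomorphic_like_zero F a" "a \<in> S"
    using insert.prems interior_subset by auto
  obtain r F1 where r: "0 < r" "r \<le> \<epsilon>" and F1: "continuous_on S F1"
    and nz: "\<And>t. \<lbrakk>t \<in> S; dist a t < r\<rbrakk> \<Longrightarrow> F1 t \<noteq> 0"
    and nzF: "\<And>t. \<lbrakk>t \<noteq> a; dist a t \<le> r\<rbrakk> \<Longrightarrow> F t \<noteq> 0"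
    and eq: "\<And>t. \<lbrakk>t \<in> S; r \<le> dist a t\<rbrakk> \<Longrightarrow> F t = F1 t * half_plane_factor a t"
    using remove_antiholomorphic_like_zero[OF S a(1) insert.prems(1) a(2) insert.prems(6)] by metis
  have den: "t \<noteq> cnj a" "cnj t \<noteq> a" if "t \<in> S" for t using S a that by (auto simp: complex_eq_iff)
  have hpf: "half_plane_factor a t \<noteq> 0" if "t \<in> S" "t \<noteq> a" for t
    using den[OF that(1)] that(2) by (simp add: half_plane_factor_def)
  have dist: "r < dist a d" if "d \<in> D" for d
  proof -
    have "F d = 0" "d \<noteq> a" using that insert by auto
    then show ?thesis using nzF[of d] by fastforce
  qed
  have zeros: "{t \<in> S. F1 t = 0} = D"
  proof (intro equalityI subsetI)
    fix t assume t: "t \<in> {t \<in> S. F1 t = 0}"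
    then have "r \<le> dist a t" using nz by force
    then have "F t = 0" "t \<noteq> a" using eq[of t] t r by auto
    then show "t \<in> D" using t insert.prems(2) by auto
  next
    fix t assume "t \<in> D"
    then have "F t = 0" "t \<in> S" "t \<noteq> a" "r \<le> dist a t" using insert dist by fastforce+
    then show "t \<in> {t \<in> S. F1 t = 0}" using eq[of t] hpf[of t] by auto
  qed
  have anti: "antiholomorphic_like_zero F1 d" if d: "d \<in> D" for d
  proof (rule antiholomorphic_like_zero_mult[where m = "\<lambda>t. 1 / half_plane_factor a t"])
    have "d \<in> S" "d \<noteq> a" using d insert by auto
    then show "isCont (\<lambda>t. 1 / half_plane_factor a t) d"
      using hpf[of d] den[of d] unfolding half_plane_factor_def by (intro continuous_intros) auto
    show "1 / half_plane_factor a d \<noteq> 0" using hpf[OF \<open>d \<in> S\<close> \<open>d \<noteq> a\<close>] by simp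
    have "\<forall>\<^sub>F t in at d. t \<in> interior S \<inter> - cball a r"
      using insert.prems(5) d dist[OF d] by (intro eventually_at_in_open') auto
    then show "\<forall>\<^sub>F t in at d. F1 t = F t * (1 / half_plane_factor a t)"
    proof eventually_elim
      case (elim t)
      then have "t \<in> S" "r \<le> dist a t" "t \<noteq> a" using interior_subset r by auto
      then show ?case using eq[of t] hpf[of t] by simp
    qed
  qed (use insert.prems d in auto)
  obtain F' where F': "continuous_on S F'" "\<forall>t\<in>S. F' t \<noteq> 0"
    "\<forall>t\<in>S. (\<forall>a\<in>D. \<epsilon> \<le> dist a t) \<longrightarrow> F1 t = F' t * (\<Prod>a\<in>D. half_plane_factor a t)"
    using insert.IH[OF F1 zeros _ anti] insert.prems by auto
  show ?case
    using F' eq r insert.hyps by (intro exI[of _ F']) (auto simp: mult_ac)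
qed

text \<open>The values at the centres are uncontrolled, so f itself may be discontinuous. The local
  constant, as a function of the centre, is locally constant and hence constant.\<close>

lemma punctured_locally_constant:
  fixes f :: "real \<Rightarrow> real"
  assumes "\<And>x0. \<exists>e>0. \<exists>c. \<forall>x. 0 < \<bar>x - x0\<bar> \<and> \<bar>x - x0\<bar> < e \<longrightarrow> f x = c"
  obtains C where "\<And>x0. \<exists>e>0. \<forall>x. 0 < \<bar>x - x0\<bar> \<and> \<bar>x - x0\<bar> < e \<longrightarrow> f x = C"
proof -
  obtain e c where e: "\<And>x0. e x0 > 0" and c: "\<And>x0 x. \<lbrakk>0 < \<bar>x - x0\<bar>; \<bar>x - x0\<bar> < e x0\<rbrakk> \<Longrightarrow> f x = c x0"
    using assms by metis
  have "(c has_real_derivative 0) (at x0)" for x0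
  proof (rule has_field_derivative_transform_within[where f = "\<lambda>_. c x0"])
    fix x assume x: "dist x x0 < e x0"
    show "c x0 = c x"
    proof (cases "x = x0")
      case False
      obtain \<delta> where \<delta>: "0 < \<delta>" "\<delta> < e x" "\<delta> < e x0 - \<bar>x - x0\<bar>"
        using e[of x] x field_lbound_gt_zero[of "e x" "e x0 - \<bar>x - x0\<bar>"]
        by (metis diff_gt_0_iff_gt dist_real_def)
      \<comment> \<open>Stepping from x away from x0 keeps y in both punctured neighbourhoods: its
        distance to x0 is \<open>\<bar>x - x0\<bar> + \<delta>\<close>.\<close>
      define y where "y = (if x < x0 then x - \<delta> else x + \<delta>)"
      have "0 < \<bar>y - x\<bar>" "\<bar>y - x\<bar> < e x" "0 < \<bar>y - x0\<bar>" "\<bar>y - x0\<bar> < e x0"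
        using \<delta> unfolding y_def by (cases "x < x0"; simp)+
      then have "f y = c x" "f y = c x0" using c[of y x] c[of y x0] by auto
      then show ?thesis by simp
    qed simp
  qed (use e in \<open>auto intro!: derivative_eq_intros\<close>)
  then have cc: "c x = c 0" for x using DERIV_isconst_all[of c x 0] by blast
  show thesis
  proof (rule that[of "c 0"])
    fix x0
    show "\<exists>e>0. \<forall>x. 0 < \<bar>x - x0\<bar> \<and> \<bar>x - x0\<bar> < e \<longrightarrow> f x = c 0"
      using e[of x0] c[of _ x0] cc[of x0] by (intro exI[of _ "e x0"]) auto
  qed
qed

lemma half_plane_factor_at_infinity: "(half_plane_factor a \<longlongrightarrow> 1) at_infinity"
proof -
  have "filterlim (\<lambda>t. t + (- cnj a)) at_infinity at_infinity"
    by (rule tendsto_add_filterlim_at_infinity'[OF filterlim_ident tendsto_const])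
  from filterlim_compose[OF tendsto_inverse_0 this]
  have lim: "((\<lambda>t. (a - cnj a) * inverse (t - cnj a)) \<longlongrightarrow> (a - cnj a) * 0) at_infinity"
    by (intro tendsto_mult tendsto_const) simp
  have "((\<lambda>t. cnj (1 - (a - cnj a) * inverse (t - cnj a))) \<longlongrightarrow> cnj (1 - (a - cnj a) * 0)) at_infinity"
    by (intro tendsto_cnj tendsto_diff tendsto_const lim)
  moreover have "\<forall>\<^sub>F t in at_infinity. cnj (1 - (a - cnj a) * inverse (t - cnj a)) = half_plane_factor a t"
    unfolding eventually_at_infinity
  proof (intro exI[of _ "cmod a + 1"] allI impI)
    fix t assume "cmod a + 1 \<le> cmod t"
    then have "t \<noteq> cnj a" by auto
    then show "cnj (1 - (a - cnj a) * inverse (t - cnj a)) = half_plane_factor a t"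
      unfolding half_plane_factor_def by (simp add: field_simps)
  qed
  ultimately show ?thesis by (simp add: tendsto_cong)
qed

text \<open>On the real line the factor is \<open>z / cnj z\<close> with
  \<open>z = x - cnj a\<close>, so its argument is twice \<open>Arg z\<close>. Right of a the
  doubled angle is below pi and principal; left of a it exceeds pi and wraps by 2 pi. This records
  the single turn of the factor along the line.\<close>

lemma half_plane_factor_Arg_of_real:
  assumes a: "0 < Im a" and re: "Re (half_plane_factor a (of_real x)) > 0" and x: "\<bar>x\<bar> > \<bar>Re a\<bar>"
  shows "Arg (of_real x - cnj a) - Arg (of_real x - a) =
    Arg (half_plane_factor a (of_real x)) + (if x < 0 then 2 * pi else 0)"
proof -
  define z where "z = of_real x - cnj a"
  have cz: "cnj z = of_real x - a" by (simp add: z_def)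
  have im: "Im z > 0" using a by (simp add: z_def)
  then have z0: "z \<noteq> 0" by auto
  define \<phi> where "\<phi> = Arg z"
  have \<phi>: "0 < \<phi>" "\<phi> < pi" using Arg_lt_pi[of z] im by (auto simp: \<phi>_def)
  have cnj: "Arg (cnj z) = - \<phi>"
    using Arg_cnj[of z] im by (auto simp: \<phi>_def complex_is_Real_iff)
  have h: "half_plane_factor a (of_real x) = z / cnj z"
    by (simp add: half_plane_factor_def z_def)
  have zr: "z = of_real (cmod z) * exp (\<i> * of_real \<phi>)" unfolding \<phi>_def using Arg_eq[OF z0] .
  have hz: "z / cnj z = exp (\<i> * of_real (2 * \<phi>))"
  proof -
    have "cnj z = cnj (of_real (cmod z) * exp (\<i> * of_real \<phi>))" using zr by (rule arg_cong)
    also have "\<dots> = of_real (cmod z) * exp (- (\<i> * of_real \<phi>))" by (simp add: exp_cnj)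
    finally have c: "cnj z = of_real (cmod z) * exp (- (\<i> * of_real \<phi>))" .
    have "z / cnj z = exp (\<i> * of_real \<phi>) / exp (- (\<i> * of_real \<phi>))"
      using arg_cong2[OF zr c, of "(/)"] z0 by simp
    also have "\<dots> = exp (\<i> * of_real (2 * \<phi>))" by (simp add: exp_minus field_simps flip: exp_add)
    finally show ?thesis .
  qed
  have cos: "cos (2 * \<phi>) > 0" using re unfolding h hz by (simp add: Re_exp)
  have rez: "Re z = x - Re a" by (simp add: z_def)
  have cosz: "cos \<phi> = Re z / cmod z" unfolding \<phi>_def using z0 by (simp add: cos_Arg)
  show ?thesis
  proof (cases "x < 0")
    case True
    then have "Re z < 0" using x rez by auto
    then have "cos \<phi> < 0" using cosz z0 by (simp add: divide_neg_pos)
    then have p2: "\<phi> > pi / 2" using \<phi> cos_ge_zero[of \<phi>] by (smt (verit) pi_half_gt_zero)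
    have "Arg (z / cnj z) = 2 * \<phi> - 2 * pi"
    proof (rule Arg_unique[where r = 1])
      show "of_real 1 * exp (\<i> * of_real (2 * \<phi> - 2 * pi)) = z / cnj z"
        unfolding hz by (simp add: algebra_simps exp_diff)
    qed (use p2 \<phi> in auto)
    then show ?thesis using True unfolding h cz[symmetric] z_def[symmetric] cnj by (simp add: \<phi>_def)
  next
    case False
    then have "Re z > 0" using x rez by auto
    then have "cos \<phi> > 0" using cosz z0 by simp
    then have p2: "\<phi> < pi / 2" using \<phi> cos_monotone_0_pi_le[of "pi/2" \<phi>] by (smt (verit) cos_pi_half pi_half_gt_zero)
    have "Arg (z / cnj z) = 2 * \<phi>"
      by (rule Arg_unique[where r = 1]) (use p2 \<phi> hz in auto)
    then show ?thesis using False unfolding h cz[symmetric] z_def[symmetric] cnj by (simp add: \<phi>_def)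
  qed
qed

section \<open>Angle sums as maps of the upper half plane\<close>

lemma antiholomorphic_like_zero_isolated:
  assumes "antiholomorphic_like_zero F a"
  shows "\<forall>\<^sub>F t in at a. F t \<noteq> 0"
proof -
  obtain b \<kappa> where b: "b \<noteq> 0" "\<kappa> < 1"
    and ev: "\<forall>\<^sub>F t in at a. cmod (F t - b * cnj (t - a)) \<le> \<kappa> * (cmod b * cmod (t - a))"
    using assms unfolding antiholomorphic_like_zero_def by blast
  have "\<forall>\<^sub>F t in at a. t \<noteq> a" by (simp add: eventually_at_filter)
  with ev show ?thesis
  proof eventually_elim
    case (elim t)
    show ?case
    proof
      assume "F t = 0"
      then have "cmod b * cmod (t - a) \<le> \<kappa> * (cmod b * cmod (t - a))"
        using elim by (simp add: norm_mult del: complex_cnj_diff)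
      then have "(1 - \<kappa>) * (cmod b * cmod (t - a)) \<le> 0" by (simp add: algebra_simps)
      then show False using b elim by (simp add: mult_le_0_iff)
    qed
  qed
qed

text \<open>The vector \<open>d j\<close> spans the kernel direction of the functional attached to
  the slope \<open>\<beta> j\<close>. Only the imaginary parts balance: rows with second entry zero
  have no slope and are left out, so the real parts may have a nonzero sum.\<close>

locale line_arrangement =
  fixes J :: "nat set" and \<beta> :: "nat \<Rightarrow> real" and d :: "nat \<Rightarrow> complex"
  assumes fin: "finite J"
    and line: "j \<in> J \<Longrightarrow> Re (d j) + \<beta> j * Im (d j) = 0"
    and sum_Im: "(\<Sum>j\<in>J. Im (d j)) = 0"
begin

definition angle_sum :: "complex \<Rightarrow> complex" where
  "angle_sum t = (\<Sum>j\<in>J. of_real (line_angle (\<beta> j) t) * d j)"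

text \<open>Boundary values of the angle sum on the real line, hence the vertices of the polygon
  relative to the first one. The strict inequality selects the limit from the right at a
  slope.\<close>

definition step :: "real \<Rightarrow> complex" where
  "step x = of_real pi * (\<Sum>j\<in>{j \<in> J. x < \<beta> j}. d j)"

definition upper :: "complex set" where
  "upper = {t. 0 \<le> Im t} - of_real ` \<beta> ` J"

lemma continuous_on_angle_sum: "continuous_on (- of_real ` \<beta> ` J) angle_sum"
  unfolding angle_sum_def
  by (intro continuous_intros continuous_on_subset[OF continuous_on_line_angle]) auto

lemma angle_sum_of_real: "x \<notin> \<beta> ` J \<Longrightarrow> angle_sum (of_real x) = step x"
proof -
  assume x: "x \<notin> \<beta> ` J"
  have "angle_sum (of_real x) = (\<Sum>j\<in>J. if x < \<beta> j then of_real pi * d j else 0)"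
    unfolding angle_sum_def
  proof (intro sum.cong refl)
    fix j assume "j \<in> J"
    then have "\<beta> j \<noteq> x" using x by auto
    then show "of_real (line_angle (\<beta> j) (of_real x)) * d j = (if x < \<beta> j then of_real pi * d j else 0)"
      by (cases "x < \<beta> j") (auto simp: line_angle_of_real_less line_angle_of_real_greater)
  qed
  also have "\<dots> = step x"
    unfolding step_def sum_distrib_left by (intro sum.inter_filter[symmetric] fin)
  finally show ?thesis .
qed

lemma Im_angle_sum_at_infinity: "((\<lambda>t. Im (angle_sum t)) \<longlongrightarrow> 0) at_infinity"
proof -
  have eq: "Im (angle_sum t) = (\<Sum>j\<in>J. (line_angle (\<beta> j) t - line_angle 0 t) * Im (d j))" for t
    using sum_Im unfolding angle_sum_def Im_sum
    by (simp add: left_diff_distrib sum_subtractf flip: sum_distrib_left)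
  have "((\<lambda>t. \<Sum>j\<in>J. (line_angle (\<beta> j) t - line_angle 0 t) * Im (d j)) \<longlongrightarrow> (\<Sum>j\<in>J. 0 * Im (d j))) at_infinity"
    by (intro tendsto_sum tendsto_mult_right line_angle_diff_at_infinity)
  then show ?thesis unfolding eq by simp
qed

text \<open>Exactly the angles that jump at x have coefficient zero in this functional. So the
  component transverse to the edge has a limit where the angle sum has none.\<close>

lemma line_functional_angle_sum:
  "((\<lambda>t. Re (angle_sum t) + x * Im (angle_sum t)) \<longlongrightarrow> Re (step x) + x * Im (step x)) (at (of_real x))"
proof -
  define c where "c j = Re (d j) + x * Im (d j)" for j
  have c0: "c j = 0" if "j \<in> J" "\<beta> j = x" for j using line[OF that(1)] that by (simp add: c_def)
  have eq: "Re (angle_sum t) + x * Im (angle_sum t) = (\<Sum>j\<in>{j\<in>J. \<beta> j \<noteq> x}. line_angle (\<beta> j) t * c j)" for t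
  proof -
    have "Re (angle_sum t) + x * Im (angle_sum t) = (\<Sum>j\<in>J. line_angle (\<beta> j) t * c j)"
      unfolding angle_sum_def c_def by (simp add: sum_distrib_left algebra_simps flip: sum.distrib)
    also have "\<dots> = (\<Sum>j\<in>{j\<in>J. \<beta> j \<noteq> x}. line_angle (\<beta> j) t * c j)"
      using fin c0 by (intro sum.mono_neutral_right) auto
    finally show ?thesis .
  qed
  have "isCont (\<lambda>t. \<Sum>j\<in>{j\<in>J. \<beta> j \<noteq> x}. line_angle (\<beta> j) t * c j) (of_real x)"
  proof (intro continuous_intros)
    fix j assume "j \<in> {j\<in>J. \<beta> j \<noteq> x}"
    then show "isCont (line_angle (\<beta> j)) (of_real x)"
      using continuous_on_line_angle[of "\<beta> j"] by (simp add: continuous_on_eq_continuous_at open_Compl)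
  qed
  then have "((\<lambda>t. Re (angle_sum t) + x * Im (angle_sum t)) \<longlongrightarrow>
      (\<Sum>j\<in>{j\<in>J. \<beta> j \<noteq> x}. line_angle (\<beta> j) (of_real x) * c j)) (at (of_real x))"
    unfolding eq isCont_def .
  also have "(\<Sum>j\<in>{j\<in>J. \<beta> j \<noteq> x}. line_angle (\<beta> j) (of_real x) * c j) =
      (\<Sum>j\<in>{j\<in>J. x < \<beta> j}. pi * c j)"
  proof (rule sum.mono_neutral_cong_right)
    show "\<forall>i\<in>{j \<in> J. \<beta> j \<noteq> x} - {j \<in> J. x < \<beta> j}. line_angle (\<beta> i) (of_real x) * c i = 0"
    proof
      fix i assume "i \<in> {j \<in> J. \<beta> j \<noteq> x} - {j \<in> J. x < \<beta> j}"
      then have "\<beta> i < x" by auto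
      then show "line_angle (\<beta> i) (complex_of_real x) * c i = 0" by (simp add: line_angle_of_real_less)
    qed
  qed (use fin line_angle_of_real_less in \<open>fastforce simp: line_angle_of_real_greater\<close>)+
  also have "\<dots> = Re (step x) + x * Im (step x)"
    unfolding step_def c_def by (simp add: sum_distrib_left algebra_simps flip: sum.distrib)
  finally show ?thesis .
qed

text \<open>With the matrix rows in place of d, this is the logarithmic derivative of the second
  coordinate of the parametrization. Its zeros are the critical points of the angle sum.\<close>

definition slope_sum :: "complex \<Rightarrow> complex" where
  "slope_sum t = (\<Sum>j\<in>J. of_real (Im (d j)) / (t - of_real (\<beta> j)))"

text \<open>Since \<open>Re (d j) = - \<beta> j * Im (d j)\<close>, the companion sum with real
  parts is \<open>- t * slope_sum t\<close>: writing -\<beta>/(t - \<beta>) as 1 - t/(t - \<beta>)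
  leaves constants that cancel by \<open>sum_Im\<close>.\<close>

lemma sum_over_factors:
  assumes "t \<notin> of_real ` \<beta> ` J"
  shows "(\<Sum>j\<in>J. d j / (t - of_real (\<beta> j))) = \<i> * slope_sum t * (1 + \<i> * t)"
    and "(\<Sum>j\<in>J. cnj (d j) / (t - of_real (\<beta> j))) = - \<i> * slope_sum t * (1 - \<i> * t)"
proof -
  have re: "(\<Sum>j\<in>J. of_real (Re (d j)) / (t - of_real (\<beta> j))) = - t * slope_sum t"
  proof -
    have "of_real (Re (d j)) / (t - of_real (\<beta> j)) = of_real (Im (d j)) - t * (of_real (Im (d j)) / (t - of_real (\<beta> j)))"
      if "j \<in> J" for j
    proof -
      have "t - of_real (\<beta> j) \<noteq> 0" using assms that by auto
      moreover have "Re (d j) = - \<beta> j * Im (d j)" using line[OF that] by simp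
      ultimately show ?thesis by (simp add: field_simps)
    qed
    then have "(\<Sum>j\<in>J. of_real (Re (d j)) / (t - of_real (\<beta> j))) =
        (\<Sum>j\<in>J. of_real (Im (d j))) - t * slope_sum t"
      unfolding slope_sum_def sum_distrib_left sum_subtractf[symmetric] by (intro sum.cong) auto
    also have "(\<Sum>j\<in>J. complex_of_real (Im (d j))) = of_real (\<Sum>j\<in>J. Im (d j))" by simp
    finally show ?thesis by (simp only: sum_Im) simp
  qed
  have d: "d j = of_real (Re (d j)) + \<i> * of_real (Im (d j))"
    "cnj (d j) = of_real (Re (d j)) - \<i> * of_real (Im (d j))" for j
    by (auto simp: complex_eq_iff)
  have "(\<Sum>j\<in>J. d j / (t - of_real (\<beta> j))) = (\<Sum>j\<in>J. of_real (Re (d j)) / (t - of_real (\<beta> j))) + \<i> * slope_sum t"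
    unfolding slope_sum_def sum_distrib_left sum.distrib[symmetric]
    by (subst d(1)) (simp add: add_divide_distrib)
  then show "(\<Sum>j\<in>J. d j / (t - of_real (\<beta> j))) = \<i> * slope_sum t * (1 + \<i> * t)"
    unfolding re by (simp add: algebra_simps)
  have id: "- t * s - \<i> * s = - \<i> * s * (1 - \<i> * t)" for s by (simp add: algebra_simps)
  have "(\<Sum>j\<in>J. cnj (d j) / (t - of_real (\<beta> j))) = (\<Sum>j\<in>J. of_real (Re (d j)) / (t - of_real (\<beta> j))) - \<i> * slope_sum t"
    unfolding slope_sum_def sum_distrib_left sum_subtractf[symmetric]
    by (subst d(2)) (simp add: diff_divide_distrib)
  then show "(\<Sum>j\<in>J. cnj (d j) / (t - of_real (\<beta> j))) = - \<i> * slope_sum t * (1 - \<i> * t)"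
    unfolding re using id by simp
qed

lemma angle_sum_has_derivative:
  assumes "0 < Im t"
  shows "(angle_sum has_derivative (\<lambda>h. \<Sum>j\<in>J. of_real (Im (h / (t - of_real (\<beta> j)))) * d j)) (at t)"
proof -
  have la: "(line_angle b has_derivative (\<lambda>h. Im (h / (t - of_real b)))) (at t)" for b
  proof (rule has_derivative_transform_within_open)
    have "((\<lambda>t. Ln (t - of_real b)) has_field_derivative inverse (t - of_real b)) (at t)"
      using assms by (auto intro!: derivative_eq_intros simp: complex_nonpos_Reals_iff field_simps)
    then have "((\<lambda>t. Ln (t - of_real b)) has_derivative (\<lambda>h. inverse (t - of_real b) * h)) (at t)"
      by (simp add: has_field_derivative_def)
    then show "((\<lambda>t. Im (Ln (t - of_real b))) has_derivative (\<lambda>h. Im (h / (t - of_real b)))) (at t)"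
      by (auto dest!: has_derivative_Im simp: divide_inverse mult.commute)
    show "open {t. 0 < Im t}" by (rule open_halfspace_Im_gt)
  qed (use assms in \<open>auto simp: line_angle_eq_Im_Ln\<close>)
  show ?thesis unfolding angle_sum_def
    by (rule has_derivative_sum, rule has_derivative_mult_left, rule has_derivative_of_real, rule la)
qed

text \<open>The two coefficients are the Wirtinger derivatives. In the upper half plane
  \<open>1 + \<i> * t\<close> has smaller modulus than \<open>1 - \<i> * t\<close>, so the
  antilinear part dominates wherever \<open>slope_sum\<close> is nonzero.\<close>

lemma angle_sum_has_derivative_split:
  assumes t: "0 < Im t"
  shows "(angle_sum has_derivative (\<lambda>h. slope_sum t * (1 + \<i> * t) / 2 * h - cnj (slope_sum t * (1 - \<i> * t)) / 2 * cnj h)) (at t)"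
proof -
  have nB: "t \<notin> of_real ` \<beta> ` J" using t by auto
  have "(\<Sum>j\<in>J. of_real (Im (h / (t - of_real (\<beta> j)))) * d j) =
      slope_sum t * (1 + \<i> * t) / 2 * h - cnj (slope_sum t * (1 - \<i> * t)) / 2 * cnj h" for h
  proof -
    have Im: "of_real (Im z) = (z - cnj z) / (2 * \<i>)" for z by (simp add: complex_eq_iff)
    have "(\<Sum>j\<in>J. of_real (Im (h / (t - of_real (\<beta> j)))) * d j) =
        (\<Sum>j\<in>J. d j / (t - of_real (\<beta> j))) * (h / (2 * \<i>)) - cnj (\<Sum>j\<in>J. cnj (d j) / (t - of_real (\<beta> j))) * (cnj h / (2 * \<i>))"
      unfolding Im cnj_sum sum_distrib_right sum_subtractf[symmetric]
      by (intro sum.cong) (auto simp: field_simps diff_divide_distrib)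
    moreover have "\<i> * s * y * (h / (2 * \<i>)) = s * y / 2 * h" for s y :: complex
      by (simp add: field_simps)
    moreover have "cnj (- \<i> * s * y) * (cnj h / (2 * \<i>)) = cnj (s * y) / 2 * cnj h" for s y :: complex
      by (simp add: field_simps)
    ultimately show ?thesis unfolding sum_over_factors[OF nB] by (simp only:)
  qed
  then show ?thesis using angle_sum_has_derivative[OF t] by (simp only:)
qed

lemma antiholomorphic_like_zero_angle_sum:
  assumes t: "0 < Im t" and nz: "slope_sum t \<noteq> 0" and p: "angle_sum t = p"
  shows "antiholomorphic_like_zero (\<lambda>t. angle_sum t - p) t"
proof -
  define a where "a = slope_sum t * (1 + \<i> * t) / 2"
  define b where "b = - cnj (slope_sum t * (1 - \<i> * t)) / 2"
  define L where "L = (\<lambda>h. a * h + b * cnj h)"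
  have cb: "cmod b = cmod (slope_sum t) * cmod (1 - \<i> * t) / 2"
    unfolding b_def by (simp only: norm_divide norm_minus_cancel complex_mod_cnj norm_mult norm_numeral)
  have "(cmod (1 + \<i> * t))\<^sup>2 < (cmod (1 - \<i> * t))\<^sup>2"
    using t unfolding cmod_power2 by (simp add: power2_eq_square algebra_simps)
  then have lt: "cmod (1 + \<i> * t) < cmod (1 - \<i> * t)" by (rule power_less_imp_less_base) simp
  have ab: "cmod a < cmod b"
    unfolding cb a_def using lt nz by (simp add: norm_mult norm_divide)
  have b0: "cmod b \<noteq> 0" using ab by (metis norm_ge_zero not_less)
  \<comment> \<open>Half the gap between the two coefficients is spent on the linearization error,
    which leaves a relative error below 1.\<close>
  define e where "e = (cmod b - cmod a) / 2"
  have e: "e > 0" using ab by (simp add: e_def)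
  have "(angle_sum has_derivative L) (at t)"
    using angle_sum_has_derivative_split[OF t] by (simp add: L_def a_def b_def)
  then obtain \<delta> where \<delta>: "\<delta> > 0"
    "\<And>y. norm (y - t) < \<delta> \<Longrightarrow> norm (angle_sum y - angle_sum t - L (y - t)) \<le> e * norm (y - t)"
    using e unfolding has_derivative_at_alt by meson
  have ev: "\<forall>\<^sub>F u in at t. cmod (angle_sum u - p - b * cnj (u - t)) \<le> (cmod a + e) / cmod b * (cmod b * cmod (u - t))"
    unfolding eventually_at
  proof (intro exI[of _ \<delta>] conjI ballI impI)
    fix u assume "u \<noteq> t \<and> dist u t < \<delta>"
    then have "norm (angle_sum u - angle_sum t - L (u - t)) \<le> e * norm (u - t)" by (intro \<delta>(2)) (auto simp: dist_norm)
    have "angle_sum u - p - b * cnj (u - t) = (angle_sum u - angle_sum t - L (u - t)) + a * (u - t)"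
      unfolding L_def p[symmetric] by simp
    also have "cmod \<dots> \<le> e * norm (u - t) + cmod a * cmod (u - t)"
      by (rule order_trans[OF norm_triangle_ineq]) (use \<open>norm _ \<le> _\<close> in \<open>simp add: norm_mult\<close>)
    also have "\<dots> = (cmod a + e) * cmod (u - t)" by (simp add: algebra_simps)
    also have "\<dots> = (cmod a + e) / cmod b * (cmod b * cmod (u - t))"
      using b0 by (metis (no_types) divide_divide_eq_left' divide_eq_eq mult.assoc)
    finally show "cmod (angle_sum u - p - b * cnj (u - t)) \<le> (cmod a + e) / cmod b * (cmod b * cmod (u - t))" .
  qed (use \<delta> in auto)
  have "b \<noteq> 0" "(cmod a + e) / cmod b < 1" using ab by (auto simp: e_def divide_less_eq field_simps)
  with ev show ?thesis unfolding antiholomorphic_like_zero_def by blast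
qed

definition left_step :: "real \<Rightarrow> complex" where
  "left_step x = step x + of_real pi * (\<Sum>j\<in>{j \<in> J. \<beta> j = x}. d j)"

lemma step_near:
  obtains e where "e > 0" "\<And>x. \<lbrakk>0 < \<bar>x - x0\<bar>; \<bar>x - x0\<bar> < e\<rbrakk> \<Longrightarrow> x \<notin> \<beta> ` J \<and>
      step x = (if x0 < x then step x0 else left_step x0)"
proof -
  obtain e where e: "e > 0" "\<And>b. \<lbrakk>b \<in> \<beta> ` J; b \<noteq> x0\<rbrakk> \<Longrightarrow> e \<le> dist x0 b"
    using finite_set_avoid[of "\<beta> ` J" x0] fin by auto
  show thesis
  proof (rule that[OF e(1)])
    fix x assume x: "0 < \<bar>x - x0\<bar>" "\<bar>x - x0\<bar> < e"
    then have nB: "x \<notin> \<beta> ` J" using e(2)[of x] by (auto simp: dist_real_def)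
    have sep: "x0 < \<beta> j \<longleftrightarrow> x < \<beta> j" if "j \<in> J" "\<beta> j \<noteq> x0" for j
      using e(2)[of "\<beta> j"] that x by (auto simp: dist_real_def abs_if split: if_splits)
    show "x \<notin> \<beta> ` J \<and> step x = (if x0 < x then step x0 else left_step x0)"
    proof (cases "x0 < x")
      case True
      then have "{j \<in> J. x < \<beta> j} = {j \<in> J. x0 < \<beta> j}" using sep by force
      then show ?thesis using nB True by (simp add: step_def)
    next
      case False
      then have "{j \<in> J. x < \<beta> j} = {j \<in> J. x0 < \<beta> j} \<union> {j \<in> J. \<beta> j = x0}" using sep x by force
      then have "(\<Sum>j\<in>{j \<in> J. x < \<beta> j}. d j) = (\<Sum>j\<in>{j \<in> J. x0 < \<beta> j}. d j) + (\<Sum>j\<in>{j \<in> J. \<beta> j = x0}. d j)"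
        using fin by (simp only:) (intro sum.union_disjoint, auto)
      then show ?thesis using nB False by (simp add: step_def left_step_def distrib_left)
    qed
  qed
qed

text \<open>The jump at x is a sum of vectors in the kernel of the functional, so both ends of the
  edge lie on one of its level lines.\<close>

lemma line_left_step: "Re (left_step x) + x * Im (left_step x) = Re (step x) + x * Im (step x)"
proof -
  have "(\<Sum>j\<in>{j \<in> J. \<beta> j = x}. Re (d j) + x * Im (d j)) = 0"
    using line by (intro sum.neutral) auto
  then have "pi * ((\<Sum>j\<in>{j \<in> J. \<beta> j = x}. Re (d j)) + x * (\<Sum>j\<in>{j \<in> J. \<beta> j = x}. Im (d j))) = 0"
    by (simp add: sum.distrib sum_distrib_left)
  then show ?thesis unfolding left_step_def by (simp add: algebra_simps)
qed

lemma isCont_angle_sum: "t \<notin> of_real ` \<beta> ` J \<Longrightarrow> isCont angle_sum t"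
  using continuous_on_angle_sum fin
  by (simp add: continuous_on_eq_continuous_at open_Compl finite_imp_closed)

text \<open>The set is starlike about the point i: a segment from there reaches the real axis at
  most in its far end, so it avoids the removed points.\<close>

lemma contractible_upper: "contractible upper"
proof (rule starlike_imp_contractible)
  show "starlike upper" unfolding starlike_def
  proof (intro bexI[of _ \<i>] ballI subsetI)
    fix x t assume x: "x \<in> upper" and "t \<in> closed_segment \<i> x"
    then obtain u where u: "0 \<le> u" "u \<le> 1" "t = (1 - u) *\<^sub>R \<i> + u *\<^sub>R x"
      by (auto simp: closed_segment_def)
    have im: "0 \<le> Im x" using x by (simp add: upper_def)
    show "t \<in> upper"
    proof (cases "u = 1")
      case False
      then have "Im t > 0" using u im by (simp add: add_pos_nonneg)
      then show ?thesis by (auto simp: upper_def)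
    qed (use u x in simp)
  qed (auto simp: upper_def complex_eq_iff)
qed

lemma open_upper_half_subset: "{t. 0 < Im t} \<subseteq> interior upper"
  by (rule interior_maximal) (auto simp: upper_def open_halfspace_Im_gt)

lemma angle_sum_cnj: "angle_sum (cnj t) = angle_sum t"
  by (simp add: angle_sum_def line_angle_cnj)

lemma angle_sum_at_infinity:
  assumes "(\<Sum>j\<in>J. d j) = 0"
  shows "(angle_sum \<longlongrightarrow> 0) at_infinity"
proof -
  have eq: "angle_sum = (\<lambda>t. \<Sum>j\<in>J. of_real (line_angle (\<beta> j) t - line_angle 0 t) * d j)"
    using assms unfolding angle_sum_def
    by (simp add: left_diff_distrib sum_subtractf flip: sum_distrib_left)
  have "((\<lambda>t. \<Sum>j\<in>J. of_real (line_angle (\<beta> j) t - line_angle 0 t) * d j) \<longlongrightarrow> (\<Sum>j\<in>J. of_real 0 * d j)) at_infinity"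
    by (intro tendsto_sum tendsto_mult tendsto_const tendsto_of_real line_angle_diff_at_infinity)
  then show ?thesis unfolding eq by simp
qed

text \<open>Clearing denominators turns \<open>slope_sum\<close> into a polynomial. If that
  polynomial is zero, the critical points fill the half plane, but then the derivative vanishes and
  there is only one critical value.\<close>

lemma finite_critical_values: "finite (angle_sum ` {t. 0 < Im t \<and> slope_sum t = 0})"
proof -
  define P :: "complex poly" where "P = (\<Sum>j\<in>J. [:of_real (Im (d j)):] * (\<Prod>i\<in>J - {j}. [:- of_real (\<beta> i), 1:]))"
  have P: "poly P t = slope_sum t * (\<Prod>i\<in>J. t - of_real (\<beta> i))" if t: "0 < Im t" for t
  proof -
    have nz: "t - of_real (\<beta> i) \<noteq> 0" for i using t by (auto simp: complex_eq_iff)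
    have "of_real (Im (d j)) * (\<Prod>i\<in>J - {j}. t - of_real (\<beta> i)) =
        of_real (Im (d j)) / (t - of_real (\<beta> j)) * (\<Prod>i\<in>J. t - of_real (\<beta> i))" if "j \<in> J" for j
      using nz[of j] fin that by (simp add: prod.remove[of J j])
    then show ?thesis
      unfolding P_def slope_sum_def sum_distrib_right by (simp add: poly_sum poly_prod)
  qed
  show ?thesis
  proof (cases "P = 0")
    case False
    have "{t. 0 < Im t \<and> slope_sum t = 0} \<subseteq> {t. poly P t = 0}" using P by auto
    then show ?thesis by (intro finite_imageI) (rule finite_subset[OF _ poly_roots_finite[OF False]])
  next
    case True
    have zero: "slope_sum t = 0" if "0 < Im t" for t
    proof -
      have "t \<noteq> of_real r" for r using that by auto
      then have "(\<Prod>i\<in>J. t - of_real (\<beta> i)) \<noteq> 0" using fin by (simp add: prod_zero_iff)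
      then show ?thesis using P[OF that] True by simp
    qed
    have der: "(angle_sum has_derivative (\<lambda>h. 0)) (at t within {t. 0 < Im t})" if t: "0 < Im t" for t
    proof (rule has_derivative_at_withinI)
      show "(angle_sum has_derivative (\<lambda>h. 0)) (at t)"
        using angle_sum_has_derivative_split[OF t] unfolding zero[OF t] by simp
    qed
    have "\<exists>c. \<forall>t\<in>{t. 0 < Im t}. angle_sum t = c"
      by (rule has_derivative_zero_constant[OF convex_halfspace_Im_gt]) (use der in auto)
    then obtain c where "\<forall>t\<in>{t. 0 < Im t}. angle_sum t = c" ..
    then have "angle_sum ` {t. 0 < Im t \<and> slope_sum t = 0} \<subseteq> {c}" by auto
    then show ?thesis by (rule finite_subset) simp
  qed
qed

end

section \<open>The argument principle for one fibre of the angle sum\<close>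

text \<open>\<open>Im_p\<close> keeps the boundary values minus p off the branch cut of the
  argument, \<open>off_lines\<close> confines the differences near a slope to a half plane, and
  \<open>noncritical\<close> makes every zero one of antiholomorphic type.\<close>

locale arrangement_fibre = line_arrangement +
  fixes p :: complex
  assumes Im_p: "Im p \<noteq> Im (step x)"
    and off_lines: "x \<in> \<beta> ` J \<Longrightarrow> Re (step x - p) + x * Im (step x - p) \<noteq> 0"
    and noncritical: "\<lbrakk>0 < Im t; angle_sum t = p\<rbrakk> \<Longrightarrow> slope_sum t \<noteq> 0"
begin

definition fibre :: "complex set" where
  "fibre = {t. 0 < Im t \<and> angle_sum t = p}"

text \<open>A negative functional means that the line of the edge meets the horizontal line through
  p to the left of p. So this counts passages through the branch cut, upward ones positively, from
  \<open>left_step\<close> to \<open>step\<close>. Such a passage is clockwise about p, in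
  accordance with a map that reverses orientation.\<close>

definition crossing :: "real \<Rightarrow> int" where
  "crossing x = (if Re (step x - p) + x * Im (step x - p) < 0
     then of_bool (Im p < Im (step x)) - of_bool (Im p < Im (left_step x)) else 0)"

lemma Im_p_left: "Im p \<noteq> Im (left_step x)"
proof -
  obtain e where e: "e > 0" "\<And>y. \<lbrakk>0 < \<bar>y - x\<bar>; \<bar>y - x\<bar> < e\<rbrakk> \<Longrightarrow> y \<notin> \<beta> ` J \<and>
      step y = (if x < y then step x else left_step x)" using step_near by blast
  then have "step (x - e / 2) = left_step x" using e(2)[of "x - e / 2"] by auto
  then show ?thesis using Im_p by metis
qed

lemma angle_sum_real_neq: "x \<notin> \<beta> ` J \<Longrightarrow> angle_sum (of_real x) \<noteq> p"
  using angle_sum_of_real Im_p by metis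

lemma zeros_in_upper: "{t \<in> upper. angle_sum t - p = 0} = fibre"
proof -
  have "0 < Im t" if "t \<in> upper" "angle_sum t = p" for t
  proof (rule ccontr)
    assume "\<not> 0 < Im t"
    then have "t = of_real (Re t)" "Re t \<notin> \<beta> ` J" using that(1)
      by (auto simp: upper_def complex_eq_iff)
    then show False using angle_sum_real_neq that(2) by metis
  qed
  then show ?thesis by (auto simp: fibre_def upper_def)
qed

lemma large_points_of_line:
  obtains M where "M > 0" "\<And>x. \<bar>x\<bar> > M \<Longrightarrow> x \<notin> \<beta> ` J" "\<And>x. x > M \<Longrightarrow> \<forall>b\<in>\<beta> ` J. b < x"
    "\<And>x. x < - M \<Longrightarrow> \<forall>b\<in>\<beta> ` J. x < b"
proof -
  obtain M where M: "M > 0" "\<forall>b\<in>\<beta> ` J. \<bar>b\<bar> \<le> M"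
    using finite_imp_bounded[of "\<beta> ` J"] fin unfolding bounded_pos by auto
  then show thesis by (intro that[of M]) force+
qed

lemma Im_p_nonzero: "Im p \<noteq> 0"
proof -
  obtain M where "M > 0" "\<And>x. x > M \<Longrightarrow> \<forall>b\<in>\<beta> ` J. b < x" using large_points_of_line by metis
  then have "\<forall>j\<in>J. \<beta> j < M + 1" by force
  then have "{j \<in> J. M + 1 < \<beta> j} = {}" by force
  then have "step (M + 1) = 0" by (simp only: step_def) simp
  then show ?thesis using Im_p[of "M + 1"] by simp
qed

text \<open>The fibre is bounded because the imaginary part tends to 0 at infinity and
  \<open>Im p\<close> is not 0. Accumulation is excluded at a slope by the functional, at other real
  points by the boundary values, and at interior points because zeros of antiholomorphic type are
  isolated.\<close>

lemma finite_fibre: "finite fibre"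
proof -
  have "\<forall>\<^sub>F t in at_infinity. dist (Im (angle_sum t)) 0 < \<bar>Im p\<bar>"
    using Im_angle_sum_at_infinity Im_p_nonzero by (intro tendstoD) auto
  then obtain R where R: "\<And>t. R \<le> cmod t \<Longrightarrow> \<bar>Im (angle_sum t)\<bar> < \<bar>Im p\<bar>"
    unfolding eventually_at_infinity by auto
  have sub: "fibre \<subseteq> cball 0 R" using R by (force simp: fibre_def not_le)
  have "finite (cball 0 R \<inter> fibre)"
  proof (rule finite_not_islimpt_in_compact)
    fix z :: complex
    have "\<forall>\<^sub>F t in at z. t \<notin> fibre"
    proof (cases "z \<in> of_real ` \<beta> ` J")
      case True
      then obtain x where x: "z = of_real x" "x \<in> \<beta> ` J" by auto
      have "\<forall>\<^sub>F t in at z. Re (angle_sum t) + x * Im (angle_sum t) \<noteq> Re p + x * Im p"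
        unfolding x(1) using off_lines[OF x(2)]
        by (intro tendsto_imp_eventually_ne[OF line_functional_angle_sum]) (auto simp: algebra_simps)
      then show ?thesis by eventually_elim (auto simp: fibre_def)
    next
      case False
      show ?thesis
      proof (cases "angle_sum z = p")
        case True
        show ?thesis
        proof (cases "0 < Im z")
          case True
          then show ?thesis
            using antiholomorphic_like_zero_isolated[OF antiholomorphic_like_zero_angle_sum[OF True noncritical \<open>angle_sum z = p\<close>]] \<open>angle_sum z = p\<close>
            by (auto simp: fibre_def elim: eventually_mono)
        next
          case False
          have "Im z \<noteq> 0"
          proof
            assume "Im z = 0"
            then have "z = of_real (Re z)" by (simp add: complex_eq_iff)
            then show False using angle_sum_real_neq[of "Re z"] \<open>z \<notin> _\<close> \<open>angle_sum z = p\<close> by auto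
          qed
          then have "\<forall>\<^sub>F t in at z. t \<in> {t. Im t < 0}"
            using False by (intro eventually_at_in_open' open_halfspace_Im_lt) auto
          then show ?thesis by eventually_elim (auto simp: fibre_def)
        qed
      next
        case False
        have "\<forall>\<^sub>F t in at z. angle_sum t \<noteq> p"
          using isCont_angle_sum[OF \<open>z \<notin> _\<close>] False unfolding isCont_def by (rule tendsto_imp_eventually_ne)
        then show ?thesis by eventually_elim (auto simp: fibre_def)
      qed
    qed
    then show "\<not> z islimpt fibre" by (simp add: islimpt_iff_eventually)
  qed auto
  with sub show ?thesis by (simp add: Int_absorb1)
qed

text \<open>A continuous logarithm of \<open>angle_sum - p\<close> divided by factors of modulus one on the real line, each of
  which absorbs one zero and turns once around the origin along the line.\<close>

lemma logarithm_on_upper: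
  obtains v G where "0 < v" "\<And>a. a \<in> fibre \<Longrightarrow> 2 * v \<le> Im a" "continuous_on upper G"
    "\<And>t. \<lbrakk>t \<in> upper; \<And>a. a \<in> fibre \<Longrightarrow> v \<le> dist a t\<rbrakk> \<Longrightarrow>
      angle_sum t - p = exp (G t) * (\<Prod>a\<in>fibre. half_plane_factor a t)"
proof -
  have fin_im: "finite (Im ` fibre)" using finite_fibre by simp
  \<comment> \<open>The halving leaves a strip of height v along the real line at distance at least
    v from every zero; the entry 1 covers an empty fibre.\<close>
  define v where "v = Min (insert 1 (Im ` fibre)) / 2"
  have v: "0 < v" "\<And>a. a \<in> fibre \<Longrightarrow> 2 * v \<le> Im a"
    using fin_im by (auto simp: v_def fibre_def Min_gr_iff)
  have "\<exists>F'. continuous_on upper F' \<and> (\<forall>t\<in>upper. F' t \<noteq> 0) \<and>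
      (\<forall>t\<in>upper. (\<forall>a\<in>fibre. v \<le> dist a t) \<longrightarrow> angle_sum t - p = F' t * (\<Prod>a\<in>fibre. half_plane_factor a t))"
  proof (rule factor_antiholomorphic_like_zeros[OF _ finite_fibre _ zeros_in_upper _ _ _ v(1)])
    show "upper \<subseteq> {t. 0 \<le> Im t}" by (auto simp: upper_def)
    show "continuous_on upper (\<lambda>t. angle_sum t - p)"
      by (intro continuous_intros continuous_on_subset[OF continuous_on_angle_sum]) (auto simp: upper_def)
    show "antiholomorphic_like_zero (\<lambda>t. angle_sum t - p) a" if "a \<in> fibre" for a
      using that noncritical by (intro antiholomorphic_like_zero_angle_sum) (auto simp: fibre_def)
  qed (use open_upper_half_subset in \<open>auto simp: fibre_def\<close>)
  then obtain F' where F': "continuous_on upper F'" "\<And>t. t \<in> upper \<Longrightarrow> F' t \<noteq> 0"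
    "\<And>t. \<lbrakk>t \<in> upper; \<And>a. a \<in> fibre \<Longrightarrow> v \<le> dist a t\<rbrakk> \<Longrightarrow> angle_sum t - p = F' t * (\<Prod>a\<in>fibre. half_plane_factor a t)"
    by metis
  obtain G where "continuous_on upper G" "\<And>t. t \<in> upper \<Longrightarrow> F' t = exp (G t)"
    using continuous_logarithm_on_contractible[OF F'(1) contractible_upper F'(2)] by blast
  with v F'(3) show thesis by (intro that) auto
qed

text \<open>The imaginary part of a continuous logarithm near the real line is compared with the
  principal argument. Their difference is locally constant away from the slopes, and at a slope it
  drops by 2 pi times the crossing number. Between the right and the left end it gains 2 pi for each
  zero divided out.\<close>

lemma card_fibre: "int (card fibre) = (\<Sum>x\<in>\<beta> ` J. crossing x)"
proof -
  define B where "B = \<beta> ` J"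
  have finB: "finite B" using fin by (simp add: B_def)
  obtain v G where v: "0 < v" and v_le: "\<And>a. a \<in> fibre \<Longrightarrow> 2 * v \<le> Im a"
    and G: "continuous_on upper G"
    and w_eq: "\<And>t. \<lbrakk>t \<in> upper; \<And>a. a \<in> fibre \<Longrightarrow> v \<le> dist a t\<rbrakk> \<Longrightarrow>
      angle_sum t - p = exp (G t) * (\<Prod>a\<in>fibre. half_plane_factor a t)"
    using logarithm_on_upper by metis
  define w where "w t = angle_sum t - p" for t
  have w_cont: "continuous_on T w" if "T \<subseteq> upper" for T
    unfolding w_def using that
    by (intro continuous_intros continuous_on_subset[OF continuous_on_angle_sum]) (auto simp: upper_def)
  have w_real: "w (of_real x) = step x - p" if "x \<notin> B" for x
    using angle_sum_of_real that by (simp add: w_def B_def)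
  \<comment> \<open>The two logarithms are kept separate. Near the real line
    \<open>cnj (t - a)\<close> stays above the axis and \<open>cnj (t - cnj a)\<close> below it, so
    both are continuous, whereas \<open>Ln\<close> of the quotient jumps once along the
    line.\<close>
  define \<Lambda> where "\<Lambda> t = G t + (\<Sum>a\<in>fibre. Ln (cnj (t - a)) - Ln (cnj (t - cnj a)))" for t
  define J' where "J' x = Im (\<Lambda> (of_real x)) - Arg (w (of_real x))" for x :: real
  define cr where "cr x = (\<Sum>b\<in>{b \<in> B. b < x}. real_of_int (crossing b))" for x

  define T where "T x0 r = {t. 0 \<le> Im t \<and> cmod (t - of_real x0) \<in> {0<..<r}}" for x0 r
  \<comment> \<open>A point of the line, possibly a slope, is bypassed through the upper half disc
    around it. Because that half disc is connected, the same constant K serves on both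
    sides.\<close>
  have local: "\<exists>r>0. \<exists>K. \<forall>x. 0 < \<bar>x - x0\<bar> \<and> \<bar>x - x0\<bar> < r \<longrightarrow> Im (\<Lambda> (of_real x)) = K + Arg (\<zeta> * w (of_real x))"
    if ev: "\<forall>\<^sub>F t in at (of_real x0). 0 < Re (\<zeta> * w t)" for x0 \<zeta>
  proof -
    obtain e1 where e1: "e1 > 0" "\<And>x. \<lbrakk>0 < \<bar>x - x0\<bar>; \<bar>x - x0\<bar> < e1\<rbrakk> \<Longrightarrow> x \<notin> B"
      using step_near[of x0] unfolding B_def by metis
    obtain e2 where e2: "e2 > 0" "\<And>t. \<lbrakk>t \<noteq> of_real x0; dist t (of_real x0) < e2\<rbrakk> \<Longrightarrow> 0 < Re (\<zeta> * w t)"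
      using ev unfolding eventually_at by auto
    define r where "r = min v (min e1 e2)"
    have r: "0 < r" "r \<le> v" "r \<le> e1" "r \<le> e2" using v e1 e2 by (auto simp: r_def)
    have nB: "x \<notin> B" if "0 < \<bar>x - x0\<bar>" "\<bar>x - x0\<bar> < r" for x using e1(2)[of x] that r by auto
    have hp: "0 < Re (\<zeta> * w t)" if "t \<in> T x0 r" for t
      using that r by (intro e2) (auto simp: T_def dist_norm)
    have real_mem: "of_real x \<in> T x0 r \<longleftrightarrow> 0 < \<bar>x - x0\<bar> \<and> \<bar>x - x0\<bar> < r" for x
      by (simp add: T_def del: of_real_diff flip: of_real_diff)
    have sub: "T x0 r \<subseteq> upper"
    proof
      fix t assume t: "t \<in> T x0 r"
      have "t \<noteq> of_real b" if "b \<in> B" for b using t nB[of b] real_mem[of b] that by auto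
      then show "t \<in> upper" using t by (auto simp: upper_def T_def B_def)
    qed
    have Im_lt: "Im t < v" if "t \<in> T x0 r" for t
      using that abs_Im_le_cmod[of "t - of_real x0"] r by (auto simp: T_def)
    have far: "v \<le> dist a t" if "t \<in> T x0 r" "a \<in> fibre" for t a
      using Im_lt[OF that(1)] v_le[OF that(2)] abs_Im_le_cmod[of "a - t"] by (simp add: dist_norm)
    have im: "Im (cnj (t - a)) > 0" "Im (cnj (t - cnj a)) < 0" if "t \<in> T x0 r" "a \<in> fibre" for t a
      using Im_lt[OF that(1)] v_le[OF that(2)] v that(1) by (auto simp: T_def)
    have nz: "cnj (t - a) \<noteq> 0" "cnj (t - cnj a) \<noteq> 0" if "t \<in> T x0 r" "a \<in> fibre" for t a
      using im[OF that] by (metis less_irrefl zero_complex.sel(2))+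
    have ex: "exp (\<Lambda> t) = w t" if t: "t \<in> T x0 r" for t
    proof -
      have "exp (\<Lambda> t) = exp (G t) * (\<Prod>a\<in>fibre. exp (Ln (cnj (t - a)) - Ln (cnj (t - cnj a))))"
        by (simp add: \<Lambda>_def exp_add exp_sum finite_fibre del: complex_cnj_diff)
      also have "(\<Prod>a\<in>fibre. exp (Ln (cnj (t - a)) - Ln (cnj (t - cnj a)))) = (\<Prod>a\<in>fibre. half_plane_factor a t)"
        using nz[OF t] by (intro prod.cong refl) (simp add: exp_diff half_plane_factor_def del: complex_cnj_diff)
      also have "exp (G t) * \<dots> = w t"
        using w_eq[of t] far[OF t] sub t by (auto simp: w_def)
      finally show ?thesis .
    qed
    have cont: "continuous_on (T x0 r) \<Lambda>"
      unfolding \<Lambda>_def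
    proof (intro continuous_intros continuous_on_subset[OF G sub])
      fix t a assume ta: "t \<in> T x0 r" "a \<in> fibre"
      show "cnj (t - a) \<notin> \<real>\<^sub>\<le>\<^sub>0" "cnj (t - cnj a) \<notin> \<real>\<^sub>\<le>\<^sub>0"
        using im[OF ta] by (auto simp: complex_nonpos_Reals_iff)
    qed
    have conn: "connected (T x0 r)" unfolding T_def by (rule connected_upper_annulus) auto
    have change: "Im (\<Lambda> s) - Im (\<Lambda> t) = Arg (\<zeta> * w s) - Arg (\<zeta> * w t)"
      if "s \<in> T x0 r" "t \<in> T x0 r" for s t
      by (rule log_change_in_half_plane[OF conn w_cont[OF sub] cont ex hp that])
    have mem: "of_real (x0 + r / 2) \<in> T x0 r" unfolding real_mem using r by simp
    have "\<exists>K. \<forall>x. 0 < \<bar>x - x0\<bar> \<and> \<bar>x - x0\<bar> < r \<longrightarrow> Im (\<Lambda> (of_real x)) = K + Arg (\<zeta> * w (of_real x))"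
      by (rule exI[of _ "Im (\<Lambda> (of_real (x0 + r / 2))) - Arg (\<zeta> * w (of_real (x0 + r / 2)))"])
        (use change[OF _ mem] real_mem in fastforce)
    then show ?thesis using r(1) by blast
  qed

  have jump: "\<exists>e>0. \<exists>c. \<forall>x. 0 < \<bar>x - x0\<bar> \<and> \<bar>x - x0\<bar> < e \<longrightarrow> J' x + 2 * pi * cr x = c" for x0
  proof -
    obtain e1 where e1: "e1 > 0" and near: "\<And>x. \<lbrakk>0 < \<bar>x - x0\<bar>; \<bar>x - x0\<bar> < e1\<rbrakk> \<Longrightarrow> x \<notin> B \<and>
      step x = (if x0 < x then step x0 else left_step x0)"
      using step_near[of x0] unfolding B_def by metis
    define wr where "wr = step x0 - p"
    define wl where "wl = left_step x0 - p"
    have w_near: "w (of_real x) = (if x0 < x then wr else wl)" if "0 < \<bar>x - x0\<bar>" "\<bar>x - x0\<bar> < e1" for x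
      using near[OF that] w_real[of x] by (auto simp: wr_def wl_def)
    have cr_near: "cr x = cr x0 + (if x0 < x \<and> x0 \<in> B then real_of_int (crossing x0) else 0)"
      if "0 < \<bar>x - x0\<bar>" "\<bar>x - x0\<bar> < e1" for x
    proof -
      have "{b \<in> B. b < x} = {b \<in> B. b < x0} \<union> (if x0 < x \<and> x0 \<in> B then {x0} else {})"
      proof (intro equalityI subsetI)
        fix b assume b: "b \<in> {b \<in> B. b < x}"
        then have "\<not> (0 < \<bar>b - x0\<bar> \<and> \<bar>b - x0\<bar> < e1)" using near[of b] by auto
        then show "b \<in> {b \<in> B. b < x0} \<union> (if x0 < x \<and> x0 \<in> B then {x0} else {})"
          using b that by (auto simp: abs_if split: if_splits)
      next
        fix b assume b: "b \<in> {b \<in> B. b < x0} \<union> (if x0 < x \<and> x0 \<in> B then {x0} else {})"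
        show "b \<in> {b \<in> B. b < x}"
        proof (cases "b = x0")
          case False
          then have "b \<in> B" "b < x0" using b by (auto split: if_splits)
          moreover have "\<not> (0 < \<bar>b - x0\<bar> \<and> \<bar>b - x0\<bar> < e1)" using near[of b] \<open>b \<in> B\<close> by auto
          ultimately show ?thesis using that by (auto simp: abs_if split: if_splits)
        qed (use b in \<open>auto split: if_splits\<close>)
      qed
      then show ?thesis using finB by (auto simp: cr_def)
    qed
    show ?thesis
    proof (cases "x0 \<in> B")
      case True
      define \<eta> where "\<eta> = Re wr + x0 * Im wr"
      have \<eta>: "\<eta> \<noteq> 0" using off_lines True by (simp add: \<eta>_def wr_def B_def)
      have \<eta>l: "Re wl + x0 * Im wl = \<eta>"
        using line_left_step[of x0] by (simp add: wl_def wr_def \<eta>_def algebra_simps)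
      \<comment> \<open>This multiplier turns the transverse functional at x0 into a real part, up
        to the sign that makes its limit positive.\<close>
      define \<zeta> where "\<zeta> = of_real (sgn \<eta>) * Complex 1 (- x0)"
      have Re_\<zeta>: "Re (\<zeta> * z) = sgn \<eta> * (Re z + x0 * Im z)" for z
        by (simp add: \<zeta>_def algebra_simps)
      have "((\<lambda>t. Re (\<zeta> * w t)) \<longlongrightarrow> sgn \<eta> * \<eta>) (at (of_real x0))"
      proof -
        have "((\<lambda>t. sgn \<eta> * ((Re (angle_sum t) + x0 * Im (angle_sum t)) - (Re p + x0 * Im p))) \<longlongrightarrow>
            sgn \<eta> * ((Re (step x0) + x0 * Im (step x0)) - (Re p + x0 * Im p))) (at (of_real x0))"
          by (intro tendsto_intros line_functional_angle_sum)
        then show ?thesis unfolding Re_\<zeta> by (simp add: w_def \<eta>_def wr_def algebra_simps)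
      qed
      moreover have "sgn \<eta> * \<eta> > 0" using \<eta> by (simp add: sgn_if)
      ultimately have "\<forall>\<^sub>F t in at (of_real x0). 0 < Re (\<zeta> * w t)" by (rule order_tendstoD)
      then obtain e3 K where e3: "e3 > 0" and K: "\<And>x. \<lbrakk>0 < \<bar>x - x0\<bar>; \<bar>x - x0\<bar> < e3\<rbrakk> \<Longrightarrow>
          Im (\<Lambda> (of_real x)) = K + Arg (\<zeta> * w (of_real x))"
        using local by metis
      define r where "r = min e1 e3"
      have r: "0 < r" "r \<le> e1" "r \<le> e3" using e1 e3 by (auto simp: r_def)
      define \<phi> where "\<phi> z = (if \<eta> < 0 then if Im z > 0 then pi else - pi else 0)" for z
      have Im_nz: "Im wr \<noteq> 0" "Im wl \<noteq> 0" using Im_p[of x0] Im_p_left[of x0] by (auto simp: wr_def wl_def)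
      have rot: "Arg (\<zeta> * wr) - Arg wr = Arg (Complex 1 (- x0)) - \<phi> wr"
        "Arg (\<zeta> * wl) - Arg wl = Arg (Complex 1 (- x0)) - \<phi> wl"
        unfolding \<zeta>_def \<phi>_def 
        by (rule Arg_rotate_line(2)[OF \<eta>_def[symmetric] \<eta> Im_nz(1)] Arg_rotate_line(2)[OF \<eta>l \<eta> Im_nz(2)])+
      have cross: "2 * pi * real_of_int (crossing x0) = \<phi> wr - \<phi> wl"
        using Im_nz by (auto simp: crossing_def \<phi>_def \<eta>_def wr_def wl_def)
      have "J' x + 2 * pi * cr x = K + Arg (Complex 1 (- x0)) - \<phi> wl + 2 * pi * cr x0"
        if "0 < \<bar>x - x0\<bar>" "\<bar>x - x0\<bar> < r" for x
        using K[of x] w_near[of x] cr_near[of x] that r rot cross True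
        by (cases "x0 < x") (auto simp: J'_def algebra_simps)
      then show ?thesis using r(1) by blast
    next
      case False
      then have "left_step x0 = step x0" by (auto simp: left_step_def B_def intro!: sum.neutral)
      then have wlr: "wl = wr" by (simp add: wl_def wr_def)
      have w0: "w (of_real x0) = wr" using w_real[OF False] by (simp add: wr_def)
      have wr0: "wr \<noteq> 0" using Im_p[of x0] by (auto simp: wr_def)
      have "isCont angle_sum (of_real x0)" using False by (intro isCont_angle_sum) (auto simp: B_def)
      \<comment> \<open>Away from the slopes w is continuous with nonzero value \<open>wr\<close>,
        and multiplying by the conjugate of that value brings it to the positive axis.\<close>
      then have "((\<lambda>t. Re (cnj wr * w t)) \<longlongrightarrow> Re (cnj wr * wr)) (at (of_real x0))"
        unfolding w0[symmetric] isCont_def w_def by (intro tendsto_intros)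
      moreover have "Re (cnj wr * wr) > 0"
      proof -
        have "Re (cnj wr * wr) = (cmod wr)\<^sup>2" unfolding cmod_power2 by (simp add: power2_eq_square)
        then show ?thesis using wr0 by simp
      qed
      ultimately have "\<forall>\<^sub>F t in at (of_real x0). 0 < Re (cnj wr * w t)" by (rule order_tendstoD)
      then obtain e3 K where e3: "e3 > 0" and K: "\<And>x. \<lbrakk>0 < \<bar>x - x0\<bar>; \<bar>x - x0\<bar> < e3\<rbrakk> \<Longrightarrow>
          Im (\<Lambda> (of_real x)) = K + Arg (cnj wr * w (of_real x))"
        using local by metis
      define r where "r = min e1 e3"
      have r: "0 < r" "r \<le> e1" "r \<le> e3" using e1 e3 by (auto simp: r_def)
      have "J' x + 2 * pi * cr x = K + Arg (cnj wr * wr) - Arg wr + 2 * pi * cr x0"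
        if "0 < \<bar>x - x0\<bar>" "\<bar>x - x0\<bar> < r" for x
        using K[of x] w_near[of x] cr_near[of x] that r wlr False by (simp add: J'_def)
      then show ?thesis using r(1) by blast
    qed
  qed
  obtain C where C: "\<And>x0. \<exists>e>0. \<forall>x. 0 < \<bar>x - x0\<bar> \<and> \<bar>x - x0\<bar> < e \<longrightarrow> J' x + 2 * pi * cr x = C"
    using punctured_locally_constant[OF jump] by metis

  have "\<exists>R. \<forall>x y. R < x \<and> y < - R \<longrightarrow> J' y - J' x = 2 * pi * card fibre"
  proof -
    obtain M where M: "M > 0" "\<And>x. \<bar>x\<bar> > M \<Longrightarrow> x \<notin> B"
      using large_points_of_line unfolding B_def by metis
    have "\<forall>\<^sub>F t in at_infinity. dist (Im (angle_sum t)) 0 < \<bar>Im p\<bar>"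
      using Im_angle_sum_at_infinity Im_p_nonzero by (intro tendstoD) auto
    moreover have "\<forall>\<^sub>F t in at_infinity. \<forall>a\<in>fibre. 0 < Re (half_plane_factor a t)"
    proof (rule eventually_ball_finite[OF finite_fibre], rule ballI)
      fix a
      have "((\<lambda>t. Re (half_plane_factor a t)) \<longlongrightarrow> Re 1) at_infinity"
        by (intro tendsto_intros half_plane_factor_at_infinity)
      then show "\<forall>\<^sub>F t in at_infinity. 0 < Re (half_plane_factor a t)"
        by (rule order_tendstoD) simp
    qed
    moreover have "\<forall>\<^sub>F t in at_infinity. \<forall>a\<in>fibre. cmod a + v \<le> cmod t"
      by (rule eventually_ball_finite[OF finite_fibre]) (auto simp: eventually_at_infinity)
    ultimately have "\<forall>\<^sub>F t in at_infinity. \<bar>Im (angle_sum t)\<bar> < \<bar>Im p\<bar> \<and>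
        (\<forall>a\<in>fibre. 0 < Re (half_plane_factor a t)) \<and> (\<forall>a\<in>fibre. cmod a + v \<le> cmod t)"
      by eventually_elim auto
    then obtain R0 where R0: "\<And>t. R0 \<le> cmod t \<Longrightarrow> \<bar>Im (angle_sum t)\<bar> < \<bar>Im p\<bar> \<and>
        (\<forall>a\<in>fibre. 0 < Re (half_plane_factor a t)) \<and> (\<forall>a\<in>fibre. cmod a + v \<le> cmod t)"
      unfolding eventually_at_infinity by auto
    define R where "R = max R0 M"
    have R: "R0 \<le> R" "M \<le> R" by (auto simp: R_def)
    define U where "U = {t. 0 \<le> Im t \<and> cmod (t - of_real 0) \<in> {R<..}}"
    have U: "0 \<le> Im t" "R < cmod t" "R0 \<le> cmod t" if "t \<in> U" for t using that R by (auto simp: U_def)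
    have real_mem: "of_real x \<in> U" if "R < \<bar>x\<bar>" for x using that by (simp add: U_def)
    have sub: "U \<subseteq> upper"
    proof
      fix t assume t: "t \<in> U"
      have "t \<noteq> of_real b" if "b \<in> B" for b using U(2)[OF t] M(2)[of b] R that by auto
      then show "t \<in> upper" using U[OF t] by (auto simp: upper_def B_def)
    qed
    have conn: "connected U" unfolding U_def using M R by (intro connected_upper_annulus) auto
    have far: "v \<le> dist a t" if "t \<in> U" "a \<in> fibre" for t a
      using R0[OF U(3)[OF that(1)]] that(2) norm_triangle_ineq2[of t a] by (force simp: dist_norm norm_minus_commute)
    \<comment> \<open>Near infinity the factors are close to 1, so here \<open>Ln\<close> of each
      quotient is continuous. The comparison of L with \<Lambda> at the two ends of the line
      produces the 2 pi per zero.\<close>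
    define L where "L t = G t + (\<Sum>a\<in>fibre. Ln (half_plane_factor a t))" for t
    have Re_pos: "0 < Re (half_plane_factor a t)" if "t \<in> U" "a \<in> fibre" for t a
      using R0[OF U(3)[OF that(1)]] that(2) by auto
    have ex: "exp (L t) = w t" if t: "t \<in> U" for t
    proof -
      have "half_plane_factor a t \<noteq> 0" if "a \<in> fibre" for a using Re_pos[OF t that] by auto
      then have "exp (L t) = exp (G t) * (\<Prod>a\<in>fibre. half_plane_factor a t)"
        by (simp add: L_def exp_add exp_sum finite_fibre)
      then show ?thesis using w_eq[of t] far[OF t] sub t by (auto simp: w_def)
    qed
    have hpf_cont: "continuous_on U (half_plane_factor a)" if "a \<in> fibre" for a
      unfolding half_plane_factor_def
    proof (intro continuous_intros ballI)
      fix t assume "t \<in> U"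
      then show "t - cnj a \<noteq> 0" using U(1)[of t] that by (auto simp: fibre_def complex_eq_iff)
    qed
    have cont: "continuous_on U L"
      unfolding L_def
    proof (intro continuous_intros continuous_on_subset[OF G sub] hpf_cont)
      fix t a assume "t \<in> U" "a \<in> fibre"
      from Re_pos[OF this] show "half_plane_factor a t \<notin> \<real>\<^sub>\<le>\<^sub>0"
        by (auto simp: complex_nonpos_Reals_iff)
    qed auto
    \<comment> \<open>The sign of \<open>Im (w t)\<close> near infinity, where the angle sum has
      imaginary part smaller in modulus than that of p. The multiplier \<zeta> then turns this half
      plane into the right one.\<close>
    define \<sigma> where "\<sigma> = - sgn (Im p)"
    have \<sigma>: "\<sigma> = 1 \<or> \<sigma> = -1" using Im_p_nonzero by (auto simp: \<sigma>_def sgn_if)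
    define \<zeta> where "\<zeta> = - of_real \<sigma> * \<i>"
    have hp: "Re (\<zeta> * w t) > 0" if "t \<in> U" for t
      using R0[OF U(3)[OF that]] Im_p_nonzero by (auto simp: \<zeta>_def \<sigma>_def w_def sgn_if abs_if split: if_splits)
    have rot: "Arg (w t) = Arg (\<zeta> * w t) + \<sigma> * pi / 2" if "t \<in> U" for t
    proof (rule Arg_in_half_plane_eq[where r = 1])
      show "\<zeta> * w t * cis (\<sigma> * pi / 2) = complex_of_real 1 * w t"
        using \<sigma> by (auto simp: \<zeta>_def cis_minus_pi_half complex_eq_iff cis.ctr)
    qed (use hp[OF that] \<sigma> in auto)
    have Im_\<Lambda>: "Im (\<Lambda> (of_real x)) = Im (L (of_real x)) + (if x < 0 then 2 * pi * card fibre else 0)"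
      if x: "R < \<bar>x\<bar>" for x
    proof -
      have "Im (Ln (cnj (of_real x - a)) - Ln (cnj (of_real x - cnj a))) =
          Im (Ln (half_plane_factor a (of_real x))) + (if x < 0 then 2 * pi else 0)" if a: "a \<in> fibre" for a
      proof -
        have im: "0 < Im a" using a by (simp add: fibre_def)
        have n: "of_real x - cnj a \<noteq> 0" "of_real x - a \<noteq> 0" "half_plane_factor a (of_real x) \<noteq> 0"
          using im Re_pos[OF real_mem[OF x] a] by (auto simp: complex_eq_iff)
        have "\<bar>Re a\<bar> < \<bar>x\<bar>"
          using R0[OF U(3)[OF real_mem[OF x]]] a v abs_Re_le_cmod[of a] by force
        from half_plane_factor_Arg_of_real[OF im Re_pos[OF real_mem[OF x] a] this]
        show ?thesis using n by (simp add: Arg_eq_Im_Ln)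
      qed
      then have "(\<Sum>a\<in>fibre. Im (Ln (cnj (of_real x - a)) - Ln (cnj (of_real x - cnj a)))) =
          (\<Sum>a\<in>fibre. Im (Ln (half_plane_factor a (of_real x)))) + (if x < 0 then 2 * pi * card fibre else 0)"
        by (simp add: sum.distrib)
      then show ?thesis by (simp add: \<Lambda>_def L_def)
    qed
    have "J' y - J' x = 2 * pi * card fibre" if xy: "R < x" "y < - R" for x y
    proof -
      have mem: "of_real x \<in> U" "of_real y \<in> U" and ab: "R < \<bar>x\<bar>" "R < \<bar>y\<bar>" and sg: "\<not> x < 0" "y < 0"
        using xy M R by (auto intro!: real_mem)
      have "Im (L (of_real y)) - Im (L (of_real x)) = Arg (\<zeta> * w (of_real y)) - Arg (\<zeta> * w (of_real x))"
        by (rule log_change_in_half_plane[OF conn w_cont[OF sub] cont ex hp mem(2,1)])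
      then show ?thesis using rot[OF mem(1)] rot[OF mem(2)] Im_\<Lambda>[OF ab(1)] Im_\<Lambda>[OF ab(2)] sg
        by (simp add: J'_def)
    qed
    then show ?thesis by blast
  qed
  then obtain R where R: "\<And>x y. \<lbrakk>R < x; y < - R\<rbrakk> \<Longrightarrow> J' y - J' x = 2 * pi * card fibre" by blast
  obtain M where M: "M > 0" "\<And>x. x > M \<Longrightarrow> \<forall>b\<in>B. b < x" "\<And>x. x < - M \<Longrightarrow> \<forall>b\<in>B. x < b"
    using large_points_of_line unfolding B_def by metis
  \<comment> \<open>The identity is available only in punctured neighbourhoods, so each sample point
    is moved by less than 1.\<close>
  have pick: "\<exists>x. \<bar>x - x0\<bar> < 1 \<and> J' x + 2 * pi * cr x = C" for x0
  proof -
    obtain e where e: "e > 0" "\<And>x. \<lbrakk>0 < \<bar>x - x0\<bar>; \<bar>x - x0\<bar> < e\<rbrakk> \<Longrightarrow> J' x + 2 * pi * cr x = C"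
      using C by blast
    then show ?thesis by (intro exI[of _ "x0 + min e 1 / 2"] conjI e(2)) auto
  qed
  obtain x y where x: "\<bar>x - (\<bar>R\<bar> + M + 1)\<bar> < 1" "J' x + 2 * pi * cr x = C"
    and y: "\<bar>y - - (\<bar>R\<bar> + M + 1)\<bar> < 1" "J' y + 2 * pi * cr y = C"
    using pick by metis
  have "{b \<in> B. b < x} = B" "{b \<in> B. b < y} = {}"
    using M(2)[of x] M(3)[of y] x(1) y(1) by force+
  then have "cr x = (\<Sum>b\<in>B. real_of_int (crossing b))" "cr y = 0" unfolding cr_def by (simp_all only: sum.empty)
  moreover have "J' y - J' x = 2 * pi * card fibre" using x(1) y(1) M(1) by (intro R) auto
  ultimately have "2 * pi * (\<Sum>b\<in>B. real_of_int (crossing b)) = 2 * pi * card fibre"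
    using x(2) y(2) by (simp only:)
  then have "(\<Sum>b\<in>B. real_of_int (crossing b)) = card fibre" by simp
  then show ?thesis unfolding B_def by (metis of_int_eq_iff of_int_of_nat_eq of_int_sum)
qed

end

section \<open>Signed crossings of lattice edges\<close>

text \<open>Summation over the support, with value 0 when the support is infinite. Reindexing and
  scaling then hold without finiteness conditions, and only additivity needs them.\<close>

definition isum :: "(int \<Rightarrow> 'a::comm_monoid_add) \<Rightarrow> 'a" where
  "isum g = sum g {n. g n \<noteq> 0}"

lemma isum_eq: "\<lbrakk>finite S; \<And>n. n \<notin> S \<Longrightarrow> g n = 0\<rbrakk> \<Longrightarrow> isum g = sum g S"
  unfolding isum_def by (intro sum.mono_neutral_left) auto

lemma isum_bij:
  assumes "bij f"
  shows "isum (\<lambda>n. g (f n)) = isum g"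
proof -
  have "bij_betw f {n. g (f n) \<noteq> 0} {n. g n \<noteq> 0}"
    using assms by (auto simp: bij_betw_def bij_def inj_on_def image_iff surj_def)
  then show ?thesis unfolding isum_def by (rule sum.reindex_bij_betw)
qed

lemma isum_shift: "isum (\<lambda>n. g (n + k)) = isum g"
  by (rule isum_bij) (auto intro!: bij_betw_byWitness[where f' = "\<lambda>n. n - k"])

lemma isum_uminus: "isum (\<lambda>n. g (- n)) = isum g"
  by (rule isum_bij) (auto intro!: bij_betw_byWitness[where f' = uminus])

lemma isum_scale: "isum (\<lambda>n. c * g n) = c * isum g" for c :: real
  by (cases "c = 0") (simp_all add: isum_def sum_distrib_left)

lemma isum_add:
  assumes "finite {n. f n \<noteq> 0}" "finite {n. g n \<noteq> 0}"
  shows "isum (\<lambda>n. f n + g n) = isum f + isum g"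
proof -
  define S where "S = {n. f n \<noteq> 0} \<union> {n. g n \<noteq> 0}"
  have "finite S" using assms by (simp add: S_def)
  then have "isum (\<lambda>n. f n + g n) = (\<Sum>n\<in>S. f n + g n)" "isum f = sum f S" "isum g = sum g S"
    by (intro isum_eq; auto simp: S_def)+
  then show ?thesis by (simp add: sum.distrib)
qed

lemma isum_even_odd:
  assumes "finite {n. g n \<noteq> 0}"
  shows "isum g = isum (\<lambda>n. g (2 * n)) + isum (\<lambda>n. g (2 * n + 1))"
proof -
  have "{n. g n \<noteq> 0} = (\<lambda>n. 2 * n) ` {n. g (2 * n) \<noteq> 0} \<union> (\<lambda>n. 2 * n + 1) ` {n. g (2 * n + 1) \<noteq> 0}"
    by (auto simp: image_iff) (metis oddE evenE)
  moreover have "finite {n. g (2 * n) \<noteq> 0}" "finite {n. g (2 * n + 1) \<noteq> 0}"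
    using finite_vimageI[OF assms, of "\<lambda>n. 2 * n"] finite_vimageI[OF assms, of "\<lambda>n. 2 * n + 1"]
    by (auto simp: inj_def vimage_def)
  ultimately have "sum g {n. g n \<noteq> 0} = sum g ((\<lambda>n. 2 * n) ` {n. g (2 * n) \<noteq> 0}) + sum g ((\<lambda>n. 2 * n + 1) ` {n. g (2 * n + 1) \<noteq> 0})"
    by (simp only:) (intro sum.union_disjoint, auto, presburger)
  then show ?thesis unfolding isum_def by (simp add: sum.reindex inj_on_def o_def)
qed

text \<open>Positive for an edge that rises through the height y, negative for one that descends.
  The form as a difference of endpoint indicators makes it telescope along paths and vanish around
  closed ones.\<close>

definition edge_sign :: "int \<times> int \<Rightarrow> int \<times> int \<Rightarrow> real \<Rightarrow> int" where
  "edge_sign a b y = of_bool (of_int (snd a) < y) - of_bool (of_int (snd a + snd b) < y)"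

text \<open>For a horizontal edge this is a junk value, which never contributes because \<^const>\<open>edge_sign\<close> vanishes.\<close>

definition edge_x :: "int \<times> int \<Rightarrow> int \<times> int \<Rightarrow> real \<Rightarrow> real" where
  "edge_x a b y = of_int (fst a) + (y - of_int (snd a)) * of_int (fst b) / of_int (snd b)"

lemma edge_sign_translate: "edge_sign (a + v) b (y + of_int (snd v)) = edge_sign a b y"
  by (simp add: edge_sign_def algebra_simps)

lemma edge_x_translate: "edge_x (a + v) b (y + of_int (snd v)) = edge_x a b y + of_int (fst v)"
  by (simp add: edge_x_def algebra_simps)

lemma edge_sign_flat: "snd b = 0 \<Longrightarrow> edge_sign a b y = 0"
  by (simp add: edge_sign_def)

lemma edge_sign_reverse: "edge_sign a (- b) y = - edge_sign (a - b) b y"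
  by (simp add: edge_sign_def)

lemma edge_x_reverse: "snd b \<noteq> 0 \<Longrightarrow> edge_x a (- b) y = edge_x (a - b) b y"
  by (simp add: edge_x_def field_simps)

text \<open>Point reflection carries the edge to the one between -a - b and -a. Nonintegrality of y
  is needed because reflection exchanges strict and weak inequalities at the endpoints.\<close>

lemma edge_sign_uminus:
  assumes "y \<notin> \<int>"
  shows "edge_sign a b (- y) = edge_sign (- a - b) b y"
proof -
  have "y \<noteq> of_int k" for k using assms by auto
  from this[of "- snd a"] this[of "- snd a - snd b"] show ?thesis
    by (auto simp: edge_sign_def)
qed

lemma edge_x_uminus: "snd b \<noteq> 0 \<Longrightarrow> edge_x a b (- y) = - edge_x (- a - b) b y"
  by (simp add: edge_x_def field_simps)

lemma finite_edge_sign_support: "finite {n::int. edge_sign a b (y + c * of_int n) \<noteq> 0}" if "c \<ge> 1"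
proof (rule finite_subset)
  let ?M = "\<lceil>\<bar>y\<bar>\<rceil> + \<bar>snd a\<bar> + \<bar>snd b\<bar> + 1"
  show "{n. edge_sign a b (y + c * of_int n) \<noteq> 0} \<subseteq> {- ?M..?M}"
  proof (intro subsetI, rule ccontr)
    fix n assume n: "n \<in> {n. edge_sign a b (y + c * of_int n) \<noteq> 0}" "n \<notin> {- ?M..?M}"
    have y: "\<bar>y\<bar> \<le> of_int \<lceil>\<bar>y\<bar>\<rceil>" by simp
    have M: "real_of_int ?M = of_int \<lceil>\<bar>y\<bar>\<rceil> + \<bar>of_int (snd a)\<bar> + \<bar>of_int (snd b)\<bar> + 1" by simp
    consider "n > ?M" | "n < - ?M" using n(2) by force
    then show False
    proof cases
      case 1
      then have "real_of_int n \<ge> of_int ?M" by linarith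
      moreover have "0 \<le> n" using 1 by (smt (verit) abs_ge_zero ceiling_mono ceiling_zero)
      then have "c * of_int n \<ge> 1 * of_int n" using that by (intro mult_right_mono) auto
      ultimately have "y + c * of_int n > of_int (snd a)" "y + c * of_int n > of_int (snd a + snd b)"
        using y unfolding M of_int_add by linarith+
      then show False using n(1) by (simp add: edge_sign_def)
    next
      case 2
      then have "real_of_int n \<le> - of_int ?M" by linarith
      moreover have "n \<le> 0" using 2 by (smt (verit) abs_ge_zero ceiling_mono ceiling_zero)
      then have "c * of_int n \<le> 1 * of_int n" using that by (intro mult_right_mono_neg) auto
      ultimately have "y + c * of_int n < of_int (snd a)" "y + c * of_int n < of_int (snd a + snd b)"
        using y unfolding M of_int_add by linarith+
      then show False using n(1) by (simp add: edge_sign_def)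
    qed
  qed
qed simp

section \<open>Lattice sums attached to a single edge\<close>

text \<open>The constant 1/2 makes this function of period one odd off the integers, so that the
  contributions of an edge and of its point reflection can cancel.\<close>

definition sawtooth :: "real \<Rightarrow> real" where
  "sawtooth z = of_int \<lfloor>z\<rfloor> - z + 1 / 2"

lemma sawtooth_shift: "sawtooth (z + of_int n) = sawtooth z"
  by (simp add: sawtooth_def)

lemma sawtooth_uminus: "z \<notin> \<int> \<Longrightarrow> sawtooth (- z) = - sawtooth z"
  by (simp add: sawtooth_def floor_minus ceiling_altdef) (metis Ints_of_int)

definition edge_saw :: "int \<times> int \<Rightarrow> int \<times> int \<Rightarrow> real \<Rightarrow> real \<Rightarrow> real" where
  "edge_saw a b x y = isum (\<lambda>n. of_int (edge_sign a b (y + 2 * of_int n)) *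
     sawtooth ((edge_x a b (y + 2 * of_int n) - x) / 2))"

definition edge_moment :: "int \<times> int \<Rightarrow> int \<times> int \<Rightarrow> real \<Rightarrow> real" where
  "edge_moment a b y = isum (\<lambda>n. of_int (edge_sign a b (y + 2 * of_int n)) * edge_x a b (y + 2 * of_int n))"

definition edge_degree :: "int \<times> int \<Rightarrow> int \<times> int \<Rightarrow> real \<Rightarrow> real" where
  "edge_degree a b y = isum (\<lambda>n. of_int (edge_sign a b (y + 2 * of_int n)))"

definition even_vector :: "int \<times> int \<Rightarrow> bool" where
  "even_vector v \<longleftrightarrow> even (fst v) \<and> even (snd v)"

lemma finite_edge_support: "finite {n::int. of_int (edge_sign a b (y + 2 * of_int n)) * f n \<noteq> (0::real)}"
  by (rule finite_subset[OF _ finite_edge_sign_support[of 2 a b y]]) auto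

text \<open>The vertical part of an even translation reindexes the heights y + 2n, and the
  horizontal part moves the argument of the sawtooth by an integer. The moment has no such
  invariance, hence the separation of the two.\<close>

lemma edge_saw_translate:
  assumes "even_vector v"
  shows "edge_saw (a + v) b x y = edge_saw a b x y"
proof -
  obtain i j where v: "fst v = 2 * i" "snd v = 2 * j" using assms by (auto simp: even_vector_def elim!: evenE)
  have "edge_saw (a + v) b x y = isum (\<lambda>n. of_int (edge_sign (a + v) b (y + 2 * of_int (n + j))) *
     sawtooth ((edge_x (a + v) b (y + 2 * of_int (n + j)) - x) / 2))"
    unfolding edge_saw_def by (rule isum_shift[symmetric])
  also have "\<dots> = edge_saw a b x y"
  proof -
    have "y + 2 * of_int (n + j) = (y + 2 * of_int n) + of_int (snd v)" for n using v by simp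
    moreover have "sawtooth ((z + of_int (fst v) - x) / 2) = sawtooth ((z - x) / 2)" for z
      using sawtooth_shift[of "(z - x) / 2" i] v by (simp add: field_simps)
    ultimately show ?thesis unfolding edge_saw_def by (simp only: edge_sign_translate edge_x_translate)
  qed
  finally show ?thesis .
qed

lemma edge_degree_translate:
  assumes "even_vector v"
  shows "edge_degree (a + v) b y = edge_degree a b y"
proof -
  obtain j where v: "snd v = 2 * j" using assms by (auto simp: even_vector_def elim!: evenE)
  have "edge_degree (a + v) b y = isum (\<lambda>n. of_int (edge_sign (a + v) b (y + 2 * of_int (n + j))))"
    unfolding edge_degree_def by (rule isum_shift[symmetric])
  also have "\<dots> = edge_degree a b y"
  proof -
    have "y + 2 * of_int (n + j) = (y + 2 * of_int n) + of_int (snd v)" for n using v by simp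
    then show ?thesis unfolding edge_degree_def by (simp only: edge_sign_translate)
  qed
  finally show ?thesis .
qed

lemma edge_reverse_term:
  "of_int (edge_sign a (- b) y) * f (edge_x a (- b) y) = - 1 * (of_int (edge_sign (a - b) b y) * f (edge_x (a - b) b y))"
  for f :: "real \<Rightarrow> real"
  by (cases "snd b = 0") (simp_all add: edge_sign_flat edge_sign_reverse edge_x_reverse)

lemma edge_saw_reverse: "edge_saw a (- b) x y = - edge_saw (a - b) b x y"
  unfolding edge_saw_def
  by (subst edge_reverse_term[where f = "\<lambda>z. sawtooth ((z - x) / 2)"], subst isum_scale) simp

lemma edge_moment_reverse: "edge_moment a (- b) y = - edge_moment (a - b) b y"
  unfolding edge_moment_def
  by (subst edge_reverse_term[where f = "\<lambda>z. z"], subst isum_scale) simp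

lemma edge_degree_reverse: "edge_degree a (- b) y = - edge_degree (a - b) b y"
  using isum_scale[of "-1"] unfolding edge_degree_def by (simp add: edge_sign_reverse)

lemma not_Ints_add_even: "y \<notin> \<int> \<Longrightarrow> y + 2 * of_int n \<notin> \<int>" for y :: real
  by (metis Ints_diff Ints_mult Ints_numeral Ints_of_int add_diff_cancel_right')

lemma edge_saw_uminus:
  assumes "y \<notin> \<int>" and x: "\<And>n::int. snd b \<noteq> 0 \<Longrightarrow> (edge_x (- a - b) b (y + 2 * of_int n) - x) / 2 \<notin> \<int>"
  shows "edge_saw a b (- x) (- y) = - edge_saw (- a - b) b x y"
proof -
  have "edge_saw a b (- x) (- y) = isum (\<lambda>n. of_int (edge_sign a b (- y + 2 * of_int (- n))) *
     sawtooth ((edge_x a b (- y + 2 * of_int (- n)) - - x) / 2))"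
    unfolding edge_saw_def by (rule isum_uminus[symmetric])
  also have "\<dots> = isum (\<lambda>n. - 1 * (of_int (edge_sign (- a - b) b (y + 2 * of_int n)) *
      sawtooth ((edge_x (- a - b) b (y + 2 * of_int n) - x) / 2)))"
  proof (intro arg_cong[where f = isum] ext)
    fix n :: int
    have y: "- y + 2 * of_int (- n) = - (y + 2 * of_int n)" by simp
    show "of_int (edge_sign a b (- y + 2 * of_int (- n))) * sawtooth ((edge_x a b (- y + 2 * of_int (- n)) - - x) / 2)
      = - 1 * (of_int (edge_sign (- a - b) b (y + 2 * of_int n)) * sawtooth ((edge_x (- a - b) b (y + 2 * of_int n) - x) / 2))"
    proof (cases "snd b = 0")
      case False
      have neg: "(- e - - x) / 2 = - ((e - x) / 2)" for e :: real by (simp add: field_simps)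
      show ?thesis unfolding y edge_sign_uminus[OF not_Ints_add_even[OF assms(1)]] edge_x_uminus[OF False] neg
        using sawtooth_uminus[OF x[OF False, of n]] by (simp only: mult_minus_right mult_1 mult_minus_left)
    qed (simp add: edge_sign_flat)
  qed
  also have "\<dots> = - edge_saw (- a - b) b x y" unfolding edge_saw_def by (subst isum_scale) simp
  finally show ?thesis .
qed

lemma edge_moment_uminus:
  assumes "y \<notin> \<int>"
  shows "edge_moment a b (- y) = - edge_moment (- a - b) b y"
proof -
  have "edge_moment a b (- y) = isum (\<lambda>n. of_int (edge_sign a b (- y + 2 * of_int (- n))) *
     edge_x a b (- y + 2 * of_int (- n)))"
    unfolding edge_moment_def by (rule isum_uminus[symmetric])
  also have "\<dots> = isum (\<lambda>n. - 1 * (of_int (edge_sign (- a - b) b (y + 2 * of_int n)) *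
      edge_x (- a - b) b (y + 2 * of_int n)))"
  proof (intro arg_cong[where f = isum] ext)
    fix n :: int
    have y: "- y + 2 * of_int (- n) = - (y + 2 * of_int n)" by simp
    show "of_int (edge_sign a b (- y + 2 * of_int (- n))) * edge_x a b (- y + 2 * of_int (- n))
      = - 1 * (of_int (edge_sign (- a - b) b (y + 2 * of_int n)) * edge_x (- a - b) b (y + 2 * of_int n))"
      unfolding y edge_sign_uminus[OF not_Ints_add_even[OF assms(1)]]
      by (cases "snd b = 0") (simp_all add: edge_sign_flat edge_x_uminus del: minus_add_distrib)
  qed
  also have "\<dots> = - edge_moment (- a - b) b y" unfolding edge_moment_def by (subst isum_scale) simp
  finally show ?thesis .
qed

lemma edge_moment_periodic: "edge_moment a b (y + 2 * of_int k) = edge_moment a b y"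
proof -
  have "y + 2 * of_int k + 2 * of_int n = y + 2 * of_int (n + k)" for n by simp
  then show ?thesis unfolding edge_moment_def by (simp only: isum_shift[of "\<lambda>n. of_int (edge_sign a b (y + 2 * of_int n)) * edge_x a b (y + 2 * of_int n)"])
qed

lemma edge_sign_same_band:
  assumes "\<lfloor>y\<rfloor> = \<lfloor>y'\<rfloor>" "y \<notin> \<int>" "y' \<notin> \<int>"
  shows "edge_sign a b y = edge_sign a b y'"
proof -
  have "of_int k < y \<longleftrightarrow> of_int k < y'" for k
    using assms by (metis Ints_of_int le_floor_iff order_le_less)
  from this[of "snd a"] this[of "snd a + snd b"] show ?thesis by (simp add: edge_sign_def)
qed

text \<open>No lattice height separates y from y', so all signs agree, and every crossed abscissa
  moves by the inverse slope times y' - y.\<close>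

lemma edge_moment_same_band:
  assumes "\<lfloor>y\<rfloor> = \<lfloor>y'\<rfloor>" "y \<notin> \<int>" "y' \<notin> \<int>"
  shows "edge_moment a b y' = edge_moment a b y + (y' - y) * of_int (fst b) / of_int (snd b) * edge_degree a b y"
proof -
  have s: "edge_sign a b (y' + 2 * of_int n) = edge_sign a b (y + 2 * of_int n)" for n
    using assms not_Ints_add_even[OF assms(2)] not_Ints_add_even[OF assms(3)] floor_add_int[of _ "2 * n"]
    by (intro edge_sign_same_band) auto
  have "edge_moment a b y' = isum (\<lambda>n. of_int (edge_sign a b (y + 2 * of_int n)) * edge_x a b (y + 2 * of_int n)
      + (y' - y) * of_int (fst b) / of_int (snd b) * of_int (edge_sign a b (y + 2 * of_int n)))"
    unfolding edge_moment_def s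
    by (intro arg_cong[where f = isum] ext) (simp add: edge_x_def field_simps diff_divide_distrib add_divide_distrib)
  also have "\<dots> = edge_moment a b y + (y' - y) * of_int (fst b) / of_int (snd b) * edge_degree a b y"
    unfolding edge_moment_def edge_degree_def isum_scale[symmetric]
    by (intro isum_add finite_edge_support finite_subset[OF _ finite_edge_sign_support[of 2 a b y]]) auto
  finally show ?thesis .
qed

text \<open>The heights y + 2n and y + 1 + 2n together are all y + n. The edge crosses
  \<open>snd b\<close> consecutive ones, at abscissae in arithmetic progression.\<close>

lemma edge_moment_sum_pos:
  assumes y: "y \<notin> \<int>" and b: "0 < snd b"
  shows "edge_moment a b y + edge_moment a b (y + 1) =
    of_int (snd b * fst a) + of_int (fst b * snd b) / 2 + of_int (fst b) * (frac y - 1 / 2)"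
proof -
  define g where "g n = of_int (edge_sign a b (y + of_int n)) * edge_x a b (y + of_int n)" for n
  have fin: "finite {n. g n \<noteq> 0}"
    by (rule finite_subset[OF _ finite_edge_sign_support[of 1 a b y]]) (auto simp: g_def)
  have "edge_moment a b y + edge_moment a b (y + 1) = isum g"
    unfolding isum_even_odd[OF fin] by (simp add: edge_moment_def g_def add_ac)
  define k where "k = nat (snd b)"
  have k: "int k = snd b" "real k = of_int (snd b)" "k > 0" using b by (auto simp: k_def)
  \<comment> \<open>The first index n for which y + n lies above the starting point of the
    edge.\<close>
  define c where "c = snd a - \<lfloor>y\<rfloor>"
  have less: "of_int j < y + of_int n \<longleftrightarrow> j - \<lfloor>y\<rfloor> \<le> n" for j n
  proof -
    have "of_int j < y + of_int n \<longleftrightarrow> of_int (j - n) < y" by auto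
    also have "\<dots> \<longleftrightarrow> of_int (j - n) \<le> y" using y by (metis Ints_of_int order_le_less)
    also have "\<dots> \<longleftrightarrow> j - n \<le> \<lfloor>y\<rfloor>" by (simp add: le_floor_iff)
    finally show ?thesis by auto
  qed
  have sgn: "edge_sign a b (y + of_int n) = of_bool (n \<in> {c..<c + int k})" for n
    unfolding edge_sign_def less using b by (auto simp: c_def k)
  have "isum g = sum g {c..<c + int k}"
    by (rule isum_eq) (auto simp: g_def sgn)
  also have "\<dots> = (\<Sum>m<k. g (c + int m))"
    by (rule sum.reindex_bij_witness[where i = "\<lambda>m. c + int m" and j = "\<lambda>n. nat (n - c)"]) auto
  also have "\<dots> = (\<Sum>m<k. of_int (fst a) + (real m + frac y) * of_int (fst b) / of_int (snd b))"
  proof (intro sum.cong refl)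
    fix m assume "m \<in> {..<k}"
    then have "edge_sign a b (y + of_int (c + int m)) = 1" unfolding sgn by auto
    moreover have "y + of_int (c + int m) - of_int (snd a) = real m + frac y"
      by (simp add: c_def frac_def)
    ultimately show "g (c + int m) = of_int (fst a) + (real m + frac y) * of_int (fst b) / of_int (snd b)"
      by (simp only: g_def edge_x_def) simp
  qed
  also have "\<dots> = real k * of_int (fst a) + ((\<Sum>m<k. real m) + real k * frac y) * of_int (fst b) / of_int (snd b)"
    by (simp add: sum.distrib sum_distrib_right[symmetric] sum_divide_distrib[symmetric])
  also have "(\<Sum>m<k. real m) = real k * (real k - 1) / 2"
    using k(3) by (induction k rule: nat_induct_non_zero) (auto simp: field_simps)
  also have "(real k * (real k - 1) / 2 + real k * frac y) * of_int (fst b) / of_int (snd b) =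
      ((real k - 1) / 2 + frac y) * of_int (fst b)"
    using k(3) unfolding k(2)[symmetric] by (simp add: field_simps)
  finally show ?thesis using \<open>_ = isum g\<close> unfolding k(2) by (simp add: field_simps)
qed

lemma edge_moment_sum:
  assumes y: "y \<notin> \<int>"
  shows "edge_moment a b y + edge_moment a b (y + 1) =
    of_int (snd b * fst a) + of_int (fst b * snd b) / 2 + (if snd b = 0 then 0 else of_int (fst b) * (frac y - 1 / 2))"
proof -
  consider "0 < snd b" | "snd b = 0" | "snd b < 0" by linarith
  then show ?thesis
  proof cases
    case 1 then show ?thesis using edge_moment_sum_pos[OF y] by simp
  next
    case 2
    then show ?thesis by (simp add: edge_moment_def edge_sign_flat isum_def)
  next
    case 3
    have "edge_moment a b z = - edge_moment (a + b) (- b) z" for z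
      using edge_moment_reverse[of a "- b" z] by simp
    then show ?thesis using edge_moment_sum_pos[OF y, of "- b" "a + b"] 3
      by (simp add: algebra_simps)
  qed
qed

section \<open>Lattice sums of crossing numbers for closed systems of edges\<close>

text \<open>This counts on the ray to the right of the point, while \<open>crossing\<close> uses the
  ray to the left. For a closed polygon the two signed counts are opposite.\<close>

definition edge_crossing :: "int \<times> int \<Rightarrow> int \<times> int \<Rightarrow> real \<Rightarrow> real \<Rightarrow> int" where
  "edge_crossing a b x y = edge_sign a b y * of_bool (x < edge_x a b y)"

text \<open>Far to the left all indicators are 1, and \<open>closed\<close> makes the sum vanish.
  Counting the m below a nonintegral z from a common lower bound gives its floor plus a constant;
  that constant, and the 1/2 in the sawtooth, cancel by \<open>closed\<close> as well.\<close>

lemma row_sum: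
  fixes c :: "'i \<Rightarrow> int" and z :: "'i \<Rightarrow> real"
  assumes I: "finite I" and closed: "(\<Sum>i\<in>I. c i) = 0" and z: "\<And>i. \<lbrakk>i \<in> I; c i \<noteq> 0\<rbrakk> \<Longrightarrow> z i \<notin> \<int>"
  defines "g \<equiv> \<lambda>m::int. \<Sum>i\<in>I. c i * of_bool (of_int m < z i)"
  shows "finite {m. g m \<noteq> 0}" "of_int (isum g) = (\<Sum>i\<in>I. of_int (c i) * (sawtooth (z i) + z i))"
proof -
  obtain M :: int where M: "\<And>i. i \<in> I \<Longrightarrow> \<bar>z i\<bar> < of_int M"
  proof -
    have "\<exists>M::int. \<forall>i\<in>I. \<bar>z i\<bar> < of_int M"
      using I
    proof (induction I rule: finite_induct)
      case (insert i F)
      then obtain M :: int where "\<forall>i\<in>F. \<bar>z i\<bar> < of_int M" by auto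
      moreover have "\<bar>z i\<bar> < of_int (\<lfloor>\<bar>z i\<bar>\<rfloor> + 1)" by linarith
      moreover have "real_of_int M \<le> of_int (max M (\<lfloor>\<bar>z i\<bar>\<rfloor> + 1))"
        "real_of_int (\<lfloor>\<bar>z i\<bar>\<rfloor> + 1) \<le> of_int (max M (\<lfloor>\<bar>z i\<bar>\<rfloor> + 1))"
        by (simp_all only: of_int_le_iff max.cobounded1 max.cobounded2)
      ultimately have "\<forall>j\<in>insert i F. \<bar>z j\<bar> < of_int (max M (\<lfloor>\<bar>z i\<bar>\<rfloor> + 1))"
        by (metis insert_iff less_le_trans)
      then show ?case by blast
    qed auto
    then show thesis using that by blast
  qed
  have out: "g m = 0" if m: "m \<notin> {- M..<M}" for m
  proof -
    consider "m \<ge> M" | "m < - M" using m by force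
    then show ?thesis
    proof cases
      case 1
      then have "\<not> of_int m < z i" if "i \<in> I" for i using M[OF that] by linarith
      then show ?thesis by (simp add: g_def)
    next
      case 2
      then have "of_int m < z i" if "i \<in> I" for i using M[OF that] by linarith
      then show ?thesis using closed by (simp add: g_def)
    qed
  qed
  then have "{m. g m \<noteq> 0} \<subseteq> {- M..<M}" by blast
  then show "finite {m. g m \<noteq> 0}" by (rule finite_subset) simp
  have count: "c i * (\<Sum>m\<in>{- M..<M}. of_bool (of_int m < z i)) = c i * (\<lfloor>z i\<rfloor> + 1 + M)" if i: "i \<in> I" for i
  proof (cases "c i = 0")
    case False
    have lt: "of_int m < z i \<longleftrightarrow> m \<le> \<lfloor>z i\<rfloor>" for m :: int
    proof -
      have "z i \<noteq> of_int m" using z[OF i False] by auto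
      then show ?thesis unfolding le_floor_iff by linarith
    qed
    have "\<lfloor>z i\<rfloor> < M" "- M \<le> \<lfloor>z i\<rfloor>" using M[OF i] by linarith+
    then have "{- M..<M} \<inter> {m. m \<le> \<lfloor>z i\<rfloor>} = {- M..\<lfloor>z i\<rfloor>}" by auto
    then have "(\<Sum>m\<in>{- M..<M}. of_bool (of_int m < z i)) = int (card {- M..\<lfloor>z i\<rfloor>})"
      unfolding lt of_bool_def by (simp add: sum.If_cases)
    then show ?thesis using \<open>- M \<le> \<lfloor>z i\<rfloor>\<close> by simp
  qed simp
  have "isum g = sum g {- M..<M}" by (rule isum_eq) (use out in auto)
  also have "\<dots> = (\<Sum>i\<in>I. c i * (\<Sum>m\<in>{- M..<M}. of_bool (of_int m < z i)))"
    unfolding g_def sum_distrib_left by (rule sum.swap)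
  also have "\<dots> = (\<Sum>i\<in>I. c i * \<lfloor>z i\<rfloor>) + (\<Sum>i\<in>I. c i) * (1 + M)"
    using count by (simp add: sum_distrib_right distrib_left sum.distrib cong: sum.cong)
  also have "\<dots> = (\<Sum>i\<in>I. c i * \<lfloor>z i\<rfloor>)" using closed by simp
  finally have "real_of_int (isum g) = (\<Sum>i\<in>I. of_int (c i) * of_int \<lfloor>z i\<rfloor>) + of_int (\<Sum>i\<in>I. c i) * (1 / 2)"
    using closed by simp
  also have "\<dots> = (\<Sum>i\<in>I. of_int (c i) * (sawtooth (z i) + z i))"
    by (simp add: sawtooth_def sum_distrib_right distrib_left sum.distrib)
  finally show "of_int (isum g) = (\<Sum>i\<in>I. of_int (c i) * (sawtooth (z i) + z i))" .
qed

definition edge_weight :: "int \<times> int \<Rightarrow> int \<times> int \<Rightarrow> real \<Rightarrow> real \<Rightarrow> real" where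
  "edge_weight a b x y = edge_saw a b x y + edge_moment a b y / 2"

text \<open>In each row the crossing condition reads m < (abscissa - x)/2, which is the situation of
  \<open>row_sum\<close>. The common term -x/2 cancels because the signs of a row add up to zero,
  leaving a sawtooth and half an abscissa per crossing.\<close>

lemma lattice_sum_of_crossings:
  fixes \<sigma> :: "'i \<Rightarrow> int" and a b :: "'i \<Rightarrow> int \<times> int" and x y :: real
  assumes I: "finite I" and closed: "\<And>y. (\<Sum>i\<in>I. \<sigma> i * edge_sign (a i) (b i) y) = 0"
    and x: "\<And>i n. \<lbrakk>i \<in> I; snd (b i) \<noteq> 0\<rbrakk> \<Longrightarrow> (edge_x (a i) (b i) (y + 2 * of_int n) - x) / 2 \<notin> \<int>"
  defines "W \<equiv> \<lambda>m n. \<Sum>i\<in>I. \<sigma> i * edge_crossing (a i) (b i) (x + 2 * of_int m) (y + 2 * of_int n)"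
  shows "finite {(m, n). W m n \<noteq> 0}"
    "of_int (\<Sum>(m, n)\<in>{(m, n). W m n \<noteq> 0}. W m n) =
      (\<Sum>i\<in>I. of_int (\<sigma> i) * edge_weight (a i) (b i) x y)"
proof -
  define c where "c n i = \<sigma> i * edge_sign (a i) (b i) (y + 2 * of_int n)" for n i
  define z where "z n i = (edge_x (a i) (b i) (y + 2 * of_int n) - x) / 2" for n i
  have W: "W m n = (\<Sum>i\<in>I. c n i * of_bool (of_int m < z n i))" for m n
    unfolding W_def c_def z_def edge_crossing_def by (intro sum.cong refl) (auto simp: field_simps)
  have z: "z n i \<notin> \<int>" if "i \<in> I" "c n i \<noteq> 0" for n i
    using x[OF that(1)] that(2) unfolding z_def by (cases "snd (b i) = 0") (auto simp: c_def edge_sign_flat)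
  have cl: "(\<Sum>i\<in>I. c n i) = 0" for n unfolding c_def by (rule closed)
  have row: "finite {m. W m n \<noteq> 0}"
    "of_int (isum (\<lambda>m. W m n)) = (\<Sum>i\<in>I. of_int (c n i) * (sawtooth (z n i) + z n i))" for n
    unfolding W by (rule row_sum[OF I cl[of n], of "z n"], erule (1) z)+
  define S where "S = (\<Union>i\<in>I. {n. edge_sign (a i) (b i) (y + 2 * of_int n) \<noteq> 0})"
  have S: "finite S" unfolding S_def using I by (intro finite_UN_I finite_edge_sign_support) auto
  have out: "c n i = 0" if "n \<notin> S" "i \<in> I" for n i using that by (auto simp: S_def c_def)
  have outW: "W m n = 0" if "n \<notin> S" for m n unfolding W using out[OF that] by simp
  have P: "{(m, n). W m n \<noteq> 0} = (\<lambda>(n, m). (m, n)) ` (SIGMA n:S. {m. W m n \<noteq> 0})"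
    using outW by force
  show "finite {(m, n). W m n \<noteq> 0}" unfolding P using S row(1) by (intro finite_imageI finite_SigmaI) auto
  have "(\<Sum>(m, n)\<in>{(m, n). W m n \<noteq> 0}. W m n) = (\<Sum>(n, m)\<in>(SIGMA n:S. {m. W m n \<noteq> 0}). W m n)"
    unfolding P by (subst sum.reindex) (auto simp: inj_on_def case_prod_unfold)
  also have "\<dots> = (\<Sum>n\<in>S. \<Sum>m\<in>{m. W m n \<noteq> 0}. W m n)"
    using S row(1) by (subst sum.Sigma) auto
  finally have "real_of_int (\<Sum>(m, n)\<in>{(m, n). W m n \<noteq> 0}. W m n) = (\<Sum>n\<in>S. of_int (isum (\<lambda>m. W m n)))"
    by (simp add: isum_def)
  also have "\<dots> = (\<Sum>n\<in>S. \<Sum>i\<in>I. of_int (c n i) * (sawtooth (z n i) + z n i))"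
    using row(2) by (intro sum.cong refl) auto
  also have "\<dots> = (\<Sum>n\<in>S. \<Sum>i\<in>I. of_int (c n i) * sawtooth (z n i) + of_int (c n i) * edge_x (a i) (b i) (y + 2 * of_int n) / 2)"
  proof (rule sum.cong[OF refl])
    fix n
    have "(\<Sum>i\<in>I. of_int (c n i) * (sawtooth (z n i) + z n i)) =
        (\<Sum>i\<in>I. of_int (c n i) * sawtooth (z n i) + of_int (c n i) * edge_x (a i) (b i) (y + 2 * of_int n) / 2)
        - (\<Sum>i\<in>I. of_int (c n i)) * (x / 2)"
      unfolding sum_distrib_right sum_subtractf[symmetric] z_def
      by (intro sum.cong refl) (simp add: field_simps)
    also have "(\<Sum>i\<in>I. real_of_int (c n i)) = 0" using cl[of n] by (metis of_int_0 of_int_sum)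
    finally show "(\<Sum>i\<in>I. of_int (c n i) * (sawtooth (z n i) + z n i)) =
        (\<Sum>i\<in>I. of_int (c n i) * sawtooth (z n i) + of_int (c n i) * edge_x (a i) (b i) (y + 2 * of_int n) / 2)"
      by simp
  qed
  also have "\<dots> = (\<Sum>i\<in>I. \<Sum>n\<in>S. of_int (c n i) * sawtooth (z n i) + of_int (c n i) * edge_x (a i) (b i) (y + 2 * of_int n) / 2)"
    by (rule sum.swap)
  also have "\<dots> = (\<Sum>i\<in>I. of_int (\<sigma> i) * edge_weight (a i) (b i) x y)"
  proof (intro sum.cong refl)
    fix i assume i: "i \<in> I"
    have "edge_saw (a i) (b i) x y = (\<Sum>n\<in>S. of_int (edge_sign (a i) (b i) (y + 2 * of_int n)) * sawtooth (z n i))"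
      unfolding edge_saw_def z_def by (rule isum_eq[OF S]) (use i in \<open>auto simp: S_def\<close>)
    moreover have "edge_moment (a i) (b i) y =
        (\<Sum>n\<in>S. of_int (edge_sign (a i) (b i) (y + 2 * of_int n)) * edge_x (a i) (b i) (y + 2 * of_int n))"
      unfolding edge_moment_def by (rule isum_eq[OF S]) (use i in \<open>auto simp: S_def\<close>)
    ultimately show "(\<Sum>n\<in>S. of_int (c n i) * sawtooth (z n i) + of_int (c n i) * edge_x (a i) (b i) (y + 2 * of_int n) / 2) =
        of_int (\<sigma> i) * edge_weight (a i) (b i) x y"
      by (simp add: edge_weight_def c_def sum.distrib distrib_left sum_distrib_left sum_divide_distrib mult.assoc)
  qed
  finally show "of_int (\<Sum>(m, n)\<in>{(m, n). W m n \<noteq> 0}. W m n) =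
      (\<Sum>i\<in>I. of_int (\<sigma> i) * edge_weight (a i) (b i) x y)" .
qed

lemma convex_hull_origin:
  "convex hull {(0, 0), (v, w)} = {(\<tau> * v, \<tau> * w) | \<tau>::real. 0 \<le> \<tau> \<and> \<tau> \<le> 1}"
  unfolding segment_convex_hull[symmetric] by (auto simp: closed_segment_def)

text \<open>A path without descending steps meets an intermediate nonintegral height in exactly one
  step, so summation against \<open>edge_sign\<close> picks out a single index.\<close>

lemma path_level:
  fixes a :: "int \<times> int" and v :: "nat \<Rightarrow> int \<times> int" and y :: real
  defines "P \<equiv> \<lambda>k. a + (\<Sum>j\<in>{1..<k}. v j)"
  assumes up: "\<And>j. j \<in> {1..N} \<Longrightarrow> 0 \<le> snd (v j)" and y: "y \<notin> \<int>"
    and lo: "of_int (snd a) < y" and hi: "y < of_int (snd (P (Suc N)))"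
  obtains k where "k \<in> {1..N}" "of_int (snd (P k)) < y" "y < of_int (snd (P k) + snd (v k))"
    "\<And>g::nat \<Rightarrow> int. (\<Sum>j\<in>{1..N}. edge_sign (P j) (v j) y * g j) = g k"
proof -
  have PS: "P (Suc j) = P j + v j" if "1 \<le> j" for j
    using that by (simp add: P_def add.assoc)
  have mono: "snd (P i) \<le> snd (P j)" if "1 \<le> i" "i \<le> j" "j \<le> Suc N" for i j
    using that(2,3)
  proof (induction j rule: dec_induct)
    case (step j)
    then show ?case using PS[of j] up[of j] that(1) by auto
  qed simp
  define k where "k = (LEAST k. y < of_int (snd (P (Suc k))))"
  have k: "y < of_int (snd (P (Suc k)))" "k \<le> N"
    unfolding k_def using hi by (rule LeastI, rule Least_le)
  have "k \<noteq> 0"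
  proof
    assume "k = 0"
    then have "y < of_int (snd a)" using k(1) by (simp add: P_def)
    then show False using lo by simp
  qed
  then have "k - 1 < k" by simp
  then have "\<not> y < of_int (snd (P (Suc (k - 1))))" unfolding k_def by (rule not_less_Least)
  moreover have "y \<noteq> of_int (snd (P k))" using y by auto
  ultimately have lt: "of_int (snd (P k)) < y" using \<open>k \<noteq> 0\<close> by simp
  show thesis
  proof
    show kN: "k \<in> {1..N}" using k(2) \<open>k \<noteq> 0\<close> by simp
    show "of_int (snd (P k)) < y" by (rule lt)
    show ub: "y < of_int (snd (P k) + snd (v k))" using k(1) PS[of k] \<open>k \<noteq> 0\<close> by simp
    fix g :: "nat \<Rightarrow> int"
    have "edge_sign (P j) (v j) y = 0" if j: "j \<in> {1..N}" "j \<noteq> k" for j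
    proof -
      have PSj: "snd (P j) + snd (v j) = snd (P (Suc j))" using PS[of j] j by simp
      consider "j < k" | "k < j" using j(2) by linarith
      then show ?thesis
      proof cases
        case 1
        then have "snd (P j) \<le> snd (P k)" "snd (P (Suc j)) \<le> snd (P k)" using mono[of j k] mono[of "Suc j" k] j kN by auto
        then have "of_int (snd (P j)) < y" "of_int (snd (P (Suc j))) < y" using lt by linarith+
        then show ?thesis by (simp add: edge_sign_def PSj del: of_int_add)
      next
        case 2
        then have "snd (P (Suc k)) \<le> snd (P j)" "snd (P (Suc k)) \<le> snd (P (Suc j))"
          using mono[of "Suc k" j] mono[of "Suc k" "Suc j"] j by auto
        then have "y < of_int (snd (P j))" "y < of_int (snd (P (Suc j)))" using k(1) by linarith+
        then show ?thesis by (simp add: edge_sign_def PSj del: of_int_add)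
      qed
    qed
    then have "(\<Sum>j\<in>{1..N}. edge_sign (P j) (v j) y * g j) = (\<Sum>j\<in>{1..N}. if j = k then edge_sign (P j) (v j) y * g j else 0)"
      by (intro sum.cong refl) auto
    also have "\<dots> = edge_sign (P k) (v k) y * g k" using kN by simp
    also have "edge_sign (P k) (v k) y = 1" using lt ub by (simp add: edge_sign_def)
    finally show "(\<Sum>j\<in>{1..N}. edge_sign (P j) (v j) y * g j) = g k" by simp
  qed
qed

section \<open>Multiplicity functions on the torus\<close>

lemma torus_proj_eq_iff:
  "torus_proj p = torus_proj q \<longleftrightarrow> (\<exists>m n. p = q + (2 * pi * real_of_int m, 2 * pi * real_of_int n))"
proof
  assume "torus_proj p = torus_proj q"
  moreover have "p \<in> torus_proj p" unfolding torus_proj_def by (auto simp: zero_prod_def intro!: exI[of _ "0::int"])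
  ultimately show "\<exists>m n. p = q + (2 * pi * real_of_int m, 2 * pi * real_of_int n)"
    unfolding torus_proj_def by blast
next
  assume "\<exists>m n. p = q + (2 * pi * real_of_int m, 2 * pi * real_of_int n)"
  then obtain m n where p: "p = q + (2 * pi * real_of_int m, 2 * pi * real_of_int n)" by blast
  have "p + (2 * pi * real_of_int i, 2 * pi * real_of_int j) = q + (2 * pi * real_of_int (m + i), 2 * pi * real_of_int (n + j))"
    "q + (2 * pi * real_of_int i, 2 * pi * real_of_int j) = p + (2 * pi * real_of_int (i - m), 2 * pi * real_of_int (j - n))" for i j
    by (simp_all add: p algebra_simps prod_eq_iff)
  then show "torus_proj p = torus_proj q" unfolding torus_proj_def by blast
qed

lemma torus_proj_shift: "torus_proj (pi * (x + 2 * of_int m), pi * (y + 2 * of_int n)) = torus_proj (pi * x, pi * y)"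
  unfolding torus_proj_eq_iff by (intro exI[of _ m] exI[of _ n]) (simp add: algebra_simps)

lemma torus_proj_eqE:
  assumes "torus_proj p = torus_proj (pi * x, pi * y)"
  obtains m n where "p = (pi * (x + 2 * of_int m), pi * (y + 2 * of_int n))"
proof -
  obtain m n where "p = (pi * x, pi * y) + (2 * pi * real_of_int m, 2 * pi * real_of_int n)"
    using assms unfolding torus_proj_eq_iff by blast
  then show thesis by (intro that[of m n]) (simp add: algebra_simps)
qed

lemma pushforward_lattice:
  assumes W: "\<And>m n. c (pi * (x + 2 * of_int m), pi * (y + 2 * of_int n)) = W m n"
  shows "pushforward c (torus_proj (pi * x, pi * y)) = (\<Sum>(m, n)\<in>{(m, n). W m n \<noteq> 0}. W m n)"
proof -
  let ?f = "\<lambda>(m::int, n::int). (pi * (x + 2 * of_int m), pi * (y + 2 * of_int n))"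
  have inj: "inj_on ?f S" for S by (auto simp: inj_on_def)
  have "{p. torus_proj p = torus_proj (pi * x, pi * y) \<and> c p \<noteq> 0} = ?f ` {(m, n). W m n \<noteq> 0}"
  proof (intro equalityI subsetI)
    fix p assume p: "p \<in> {p. torus_proj p = torus_proj (pi * x, pi * y) \<and> c p \<noteq> 0}"
    then obtain m n where "p = (pi * (x + 2 * of_int m), pi * (y + 2 * of_int n))"
      using torus_proj_eqE by blast
    then show "p \<in> ?f ` {(m, n). W m n \<noteq> 0}" using p W by auto
  qed (auto simp: torus_proj_shift W)
  then have "pushforward c (torus_proj (pi * x, pi * y)) = sum c (?f ` {(m, n). W m n \<noteq> 0})"
    unfolding pushforward_def by (simp only:)
  also have "\<dots> = (\<Sum>z\<in>{(m, n). W m n \<noteq> 0}. c (?f z))"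
    using sum.reindex[OF inj, of c] by (simp only: o_def)
  also have "\<dots> = (\<Sum>(m, n)\<in>{(m, n). W m n \<noteq> 0}. W m n)"
    by (intro sum.cong refl) (auto simp: W)
  finally show ?thesis .
qed

lemma negligible_segment: "negligible (closed_segment a b)" for a b :: "real \<times> real"
proof -
  have "interior (closed_segment a b) = {}" by (rule interior_closed_segment_ge2) simp
  then show ?thesis by (simp add: negligible_convex_interior)
qed

text \<open>The preimage in the plane is a countable union of translated segments, each of which is
  a null set.\<close>

lemma negligible_torus_segments:
  assumes "finite S"
  shows "negligible {p. torus_proj p \<in> torus_proj ` (\<Union>(a, c)\<in>S. closed_segment a c)}"
proof -
  have "{p. torus_proj p \<in> torus_proj ` (\<Union>(a, c)\<in>S. closed_segment a c)} =
      (\<Union>z\<in>range (\<lambda>(m::int, n::int). (2 * pi * real_of_int m, 2 * pi * real_of_int n)). \<Union>(a, c)\<in>S. (+) z ` closed_segment a c)"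
    (is "?B = ?U")
  proof (intro equalityI subsetI)
    fix p assume "p \<in> ?B"
    then obtain q a c where q: "torus_proj p = torus_proj q" "(a, c) \<in> S" "q \<in> closed_segment a c" by auto
    then obtain m n where "p = q + (2 * pi * real_of_int m, 2 * pi * real_of_int n)"
      unfolding torus_proj_eq_iff by blast
    then have "p \<in> (+) (2 * pi * real_of_int m, 2 * pi * real_of_int n) ` closed_segment a c"
      using q(3) by (auto simp: add.commute)
    then show "p \<in> ?U" using q(2) by blast
  next
    fix p assume "p \<in> ?U"
    then obtain m n a c q where "(a, c) \<in> S" "q \<in> closed_segment a c"
      "p = q + (2 * pi * real_of_int m, 2 * pi * real_of_int n)" by (auto simp: add.commute)
    then have "torus_proj p = torus_proj q" unfolding torus_proj_eq_iff by blast
    then show "p \<in> ?B" using \<open>(a, c) \<in> S\<close> \<open>q \<in> _\<close> by blast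
  qed
  moreover have "negligible (\<Union>(a, c)\<in>S. (+) z ` closed_segment a c)" for z
    using assms by (intro negligible_Union finite_imageI) (auto simp: negligible_translation negligible_segment)
  then have "negligible ?U"
    by (intro negligible_countable_Union countable_image) auto
  ultimately show ?thesis by simp
qed

text \<open>Integrating first in the direction of the derivative gives the difference of P at
  opposite sides of the square, which is zero by periodicity.\<close>

lemma periodic_partial_integrals:
  assumes "torus_C1 P G"
  shows "((\<lambda>p. fst (G p)) has_integral 0) (cbox (0, 0) (2 * pi, 2 * pi))"
    and "((\<lambda>p. snd (G p)) has_integral 0) (cbox (0, 0) (2 * pi, 2 * pi))"
proof -
  have per: "\<And>p q. torus_proj p = torus_proj q \<Longrightarrow> P p = P q"
    and der: "\<And>p. (P has_derivative (\<lambda>h. G p \<bullet> h)) (at p)" and G: "continuous_on UNIV G"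
    using assms unfolding torus_C1_def by blast+
  have c1: "continuous_on S (\<lambda>p. fst (G p))" and c2: "continuous_on S (\<lambda>p. snd (G p))" for S
    by (intro continuous_on_fst continuous_on_snd continuous_on_subset[OF G subset_UNIV])+
  have P1: "P (2 * pi, y) = P (0, y)" for y
    by (rule per) (auto simp: torus_proj_eq_iff intro!: exI[of _ 1] exI[of _ 0])
  have P2: "P (x, 2 * pi) = P (x, 0)" for x
    by (rule per) (auto simp: torus_proj_eq_iff intro!: exI[of _ 0] exI[of _ 1])
  have i2: "integral {0..2 * pi} (\<lambda>y. snd (G (x, y))) = 0" for x
  proof (rule integral_unique)
    have "((\<lambda>y. snd (G (x, y))) has_integral (P (x, 2 * pi) - P (x, 0))) {0..2 * pi}"
    proof (rule fundamental_theorem_of_calculus)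
      fix y
      have "((\<lambda>y. P (x, y)) has_derivative (\<lambda>h. G (x, y) \<bullet> (0, h))) (at y within {0..2 * pi})"
        by (rule has_derivative_compose[OF _ der]) (auto intro!: derivative_eq_intros)
      then show "((\<lambda>y. P (x, y)) has_vector_derivative snd (G (x, y))) (at y within {0..2 * pi})"
        by (simp add: has_vector_derivative_def inner_prod_def mult.commute)
    qed simp
    then show "((\<lambda>y. snd (G (x, y))) has_integral 0) {0..2 * pi}" by (simp add: P2)
  qed
  have i1: "integral {0..2 * pi} (\<lambda>x. fst (G (x, y))) = 0" for y
  proof (rule integral_unique)
    have "((\<lambda>x. fst (G (x, y))) has_integral (P (2 * pi, y) - P (0, y))) {0..2 * pi}"
    proof (rule fundamental_theorem_of_calculus)
      fix x
      have "((\<lambda>x. P (x, y)) has_derivative (\<lambda>h. G (x, y) \<bullet> (h, 0))) (at x within {0..2 * pi})"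
        by (rule has_derivative_compose[OF _ der]) (auto intro!: derivative_eq_intros)
      then show "((\<lambda>x. P (x, y)) has_vector_derivative fst (G (x, y))) (at x within {0..2 * pi})"
        by (simp add: has_vector_derivative_def inner_prod_def mult.commute)
    qed simp
    then show "((\<lambda>x. fst (G (x, y))) has_integral 0) {0..2 * pi}" by (simp add: P1)
  qed
  have "integral (cbox (0, 0) (2 * pi, 2 * pi)) (\<lambda>p. snd (G p)) =
      integral (cbox 0 (2 * pi)) (\<lambda>x. integral (cbox 0 (2 * pi)) (\<lambda>y. snd (G (x, y))))"
    by (rule integral_prod_continuous[OF c2])
  also have "\<dots> = 0" using i2 by simp
  finally show "((\<lambda>p. snd (G p)) has_integral 0) (cbox (0, 0) (2 * pi, 2 * pi))"
    using integrable_continuous[OF c2, of "(0, 0)" "(2 * pi, 2 * pi)"] by (simp add: has_integral_iff)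
  have "integral (cbox (0, 0) (2 * pi, 2 * pi)) (\<lambda>p. fst (G p)) =
      integral (cbox 0 (2 * pi)) (\<lambda>x. integral (cbox 0 (2 * pi)) (\<lambda>y. fst (G (x, y))))"
    by (rule integral_prod_continuous[OF c1])
  also have "\<dots> = integral (cbox 0 (2 * pi)) (\<lambda>y. integral (cbox 0 (2 * pi)) (\<lambda>x. fst (G (x, y))))"
    by (rule integral_swap_continuous) (use c1 in \<open>simp add: case_prod_unfold\<close>)
  also have "\<dots> = 0" using i1 by simp
  finally show "((\<lambda>p. fst (G p)) has_integral 0) (cbox (0, 0) (2 * pi, 2 * pi))"
    using integrable_continuous[OF c1, of "(0, 0)" "(2 * pi, 2 * pi)"] by (simp add: has_integral_iff)
qed

text \<open>The exceptional set is null, so the integrand may be replaced by m times an exterior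
  derivative, whose integral over the whole torus vanishes.\<close>

lemma torus_cycle_of_chain_eq:
  assumes "torus_chain_eq c (\<lambda>_. m)"
  shows "torus_cycle c"
  unfolding torus_cycle_def
proof (intro allI impI, elim conjE)
  fix P Q G H assume P: "torus_C1 P G" and Q: "torus_C1 Q H"
  obtain S where S: "finite S" "\<And>\<theta>. \<theta> \<in> torus - torus_proj ` (\<Union>(x, y)\<in>S. closed_segment x y) \<Longrightarrow> c \<theta> = m"
    using assms unfolding torus_chain_eq_def off_segments_def by blast
  have "((\<lambda>p. real_of_int m * (fst (H p) - snd (G p))) has_integral real_of_int m * (0 - 0)) (cbox (0, 0) (2 * pi, 2 * pi))"
    by (intro has_integral_mult_right has_integral_diff periodic_partial_integrals[OF P] periodic_partial_integrals[OF Q])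
  then have "((\<lambda>p. real_of_int m * (fst (H p) - snd (G p))) has_integral 0) (cbox (0, 0) (2 * pi, 2 * pi))" by simp
  then show "((\<lambda>p. real_of_int (c (torus_proj p)) * (fst (H p) - snd (G p))) has_integral 0) (cbox (0, 0) (2 * pi, 2 * pi))"
  proof (rule has_integral_spike[OF negligible_torus_segments[OF S(1)], rotated])
    fix p assume "p \<in> cbox (0, 0) (2 * pi, 2 * pi) - {p. torus_proj p \<in> torus_proj ` (\<Union>(a, c)\<in>S. closed_segment a c)}"
    then have "c (torus_proj p) = m" by (intro S(2)) (auto simp: torus_def)
    then show "real_of_int (c (torus_proj p)) * (fst (H p) - snd (G p)) = real_of_int m * (fst (H p) - snd (G p))" by simp
  qed
qed

section \<open>Boundary edges of the coamoeba and the zonotope\<close>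

lemma even_vector_add: "\<lbrakk>even_vector v; even_vector w\<rbrakk> \<Longrightarrow> even_vector (v + w)"
  by (simp add: even_vector_def)

lemma even_vector_sum: "(\<And>j. j \<in> A \<Longrightarrow> even_vector (f j)) \<Longrightarrow> even_vector (\<Sum>j\<in>A. f j)"
  by (auto simp: even_vector_def fst_sum snd_sum intro!: dvd_sum)

lemma sum_below_pairs:
  "(\<Sum>k\<in>{1..N::nat}. \<Sum>j\<in>{1..<k}. f j k) = (\<Sum>(j, k)\<in>{(j, k). 1 \<le> j \<and> j < k \<and> k \<le> N}. f j k)"
  by (subst sum.Sigma) (auto intro!: sum.reindex_bij_witness[of _ "\<lambda>(j, k). (k, j)" "\<lambda>(k, j). (j, k)"])

lemma sum_above_pairs:
  "(\<Sum>k\<in>{1..N::nat}. \<Sum>j\<in>{k<..N}. f j k) = (\<Sum>(j, k)\<in>{(j, k). 1 \<le> j \<and> j < k \<and> k \<le> N}. f k j)"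
  by (subst sum.Sigma) (auto intro!: sum.reindex_bij_witness[of _ "\<lambda>(k, j). (k, j)" "\<lambda>(k, j). (k, j)"])

lemma sum_split_at:
  fixes f :: "nat \<Rightarrow> 'a::comm_monoid_add"
  assumes "k \<in> {1..N::nat}"
  shows "(\<Sum>j\<in>{1..N}. f j) = (\<Sum>j\<in>{1..<k}. f j) + f k + (\<Sum>j\<in>{k<..N}. f j)"
proof -
  have "{1..N} = {1..<k} \<union> ({k} \<union> {k<..N})" using assms by auto
  then have "(\<Sum>j\<in>{1..N}. f j) = (\<Sum>j\<in>{1..<k}. f j) + (\<Sum>j\<in>{k} \<union> {k<..N}. f j)"
    by (simp only:) (rule sum.union_disjoint, auto)
  then show ?thesis by (simp add: add.assoc)
qed

locale sorted_rows =
  fixes N :: nat and b :: "nat \<Rightarrow> int \<times> int"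
  assumes rows_sum: "(\<Sum>j\<in>{1..N}. b j) = 0"
    and rows_nonzero: "j \<in> {1..N} \<Longrightarrow> b j \<noteq> 0"
    and rows_sorted: "\<lbrakk>1 \<le> j; j \<le> k; k \<le> N\<rbrakk> \<Longrightarrow> beta (b k) \<le> beta (b j)"
begin

abbreviation "pairs \<equiv> {(j, k). 1 \<le> j \<and> j < k \<and> k \<le> N}"

definition downward :: "nat \<Rightarrow> bool" where
  "downward j \<longleftrightarrow> snd (b j) < 0 \<or> snd (b j) = 0 \<and> fst (b j) < 0"

definition upward :: "nat \<Rightarrow> int \<times> int" where
  "upward j = (if downward j then - b j else b j)"

text \<open>In units of pi, the lowest vertex of the zonotope, the leftmost one if there are
  several. The same vector is an argument of the parametrization for real t beyond all slopes, where
  exactly the downward rows have negative linear factors.\<close>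

definition apex :: "int \<times> int" where
  "apex = (\<Sum>j\<in>{j \<in> {1..N}. downward j}. b j)"

text \<open>Reduction modulo 2 does not change the argument, and it brings the value on the ray into
  the four values prescribed by the normalization of the branch.\<close>

definition base :: "int \<times> int" where
  "base = (fst apex mod 2, snd apex mod 2)"

definition vertex :: "nat \<Rightarrow> int \<times> int" where
  "vertex k = base + (\<Sum>j\<in>{1..<k}. b j)"

definition left_vertex :: "nat \<Rightarrow> int \<times> int" where
  "left_vertex k = apex + (\<Sum>j\<in>{1..<k}. upward j)"

definition right_vertex :: "nat \<Rightarrow> int \<times> int" where
  "right_vertex k = apex + (\<Sum>j\<in>{k<..N}. upward j)"

lemma upward_cases: "upward j = b j \<or> upward j = - b j"
  by (simp add: upward_def)

lemma snd_upward: "0 \<le> snd (upward j)"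
  by (auto simp: upward_def downward_def)

lemma fst_upward: "\<lbrakk>j \<in> {1..N}; snd (upward j) = 0\<rbrakk> \<Longrightarrow> 0 < fst (upward j)"
  using rows_nonzero[of j] by (auto simp: upward_def downward_def prod_eq_iff split: if_splits)

text \<open>Ordering by \<beta> makes the upward rows turn clockwise, from left to right. Horizontal
  rows, oriented to the right, come last because their \<beta> is minus infinity.\<close>

lemma row_det_upward:
  assumes "1 \<le> j" "j \<le> k" "k \<le> N"
  shows "row_det (upward j) (upward k) \<le> 0"
proof -
  have beta: "beta (upward i) = beta (b i)" for i
    by (auto simp: upward_def beta_def)
  have le: "beta (upward k) \<le> beta (upward j)"
    unfolding beta using assms by (rule rows_sorted)
  show ?thesis
  proof (cases "snd (upward k) = 0")
    case True
    then show ?thesis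
      using fst_upward[of k] snd_upward[of j] assms by (simp add: row_det_def)
  next
    case False
    then have "snd (upward j) \<noteq> 0" using le by (auto simp: beta_def)
    then have p: "0 < snd (upward j)" "0 < snd (upward k)"
      using False snd_upward[of j] snd_upward[of k] by auto
    from le have "real_of_int (fst (upward j)) / real_of_int (snd (upward j)) \<le>
        real_of_int (fst (upward k)) / real_of_int (snd (upward k))"
      using p by (simp add: beta_def)
    then have "real_of_int (fst (upward j)) * real_of_int (snd (upward k)) \<le>
        real_of_int (fst (upward k)) * real_of_int (snd (upward j))"
      using p by (simp add: field_simps)
    then have "fst (upward j) * snd (upward k) \<le> fst (upward k) * snd (upward j)"
      by (metis of_int_le_iff of_int_mult)
    then show ?thesis by (simp add: row_det_def mult.commute)
  qed
qed

lemma even_apex_base: "even_vector (apex - base)"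
  by (simp add: even_vector_def base_def)

text \<open>Signs are irrelevant modulo 2, so partial sums of the upward rows agree with those of
  the given rows.\<close>

lemma even_left_vertex: "even_vector (left_vertex k - vertex k)"
proof -
  have "left_vertex k - vertex k = (apex - base) + (\<Sum>j\<in>{1..<k}. upward j - b j)"
    by (simp add: left_vertex_def vertex_def sum_subtractf)
  moreover have "even_vector (upward j - b j)" for j
    by (auto simp: even_vector_def upward_def)
  ultimately show ?thesis using even_apex_base by (auto intro: even_vector_add even_vector_sum)
qed

text \<open>As the rows sum to zero, those after k add up to minus those up to k; modulo 2 the signs
  do not matter.\<close>

lemma even_right_vertex:
  assumes "k \<in> {1..N}"
  shows "even_vector (right_vertex k - (vertex k + b k))"
proof -
  have "right_vertex k - (vertex k + b k) = (apex - base) + (\<Sum>j\<in>{k<..N}. upward j) - ((\<Sum>j\<in>{1..<k}. b j) + b k)"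
    by (simp add: right_vertex_def vertex_def)
  also have "(\<Sum>j\<in>{1..<k}. b j) + b k = - (\<Sum>j\<in>{k<..N}. b j)"
    unfolding eq_neg_iff_add_eq_0 by (rule trans[OF sum_split_at[OF assms, symmetric] rows_sum])
  also have "(apex - base) + (\<Sum>j\<in>{k<..N}. upward j) - - (\<Sum>j\<in>{k<..N}. b j) =
      (apex - base) + (\<Sum>j\<in>{k<..N}. upward j + b j)"
    by (simp add: sum.distrib)
  finally have eq: "right_vertex k - (vertex k + b k) = (apex - base) + (\<Sum>j\<in>{k<..N}. upward j + b j)" .
  have "even_vector (upward j + b j)" for j
    by (auto simp: even_vector_def upward_def)
  then show ?thesis unfolding eq 
    by (intro even_vector_add[OF even_apex_base] even_vector_sum)
qed

text \<open>On the torus the two coamoeba edges and the two zonotope edges parallel to \<open>b k\<close> cancel.\<close>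

lemma boundary_cancels:
  fixes T :: "int \<times> int \<Rightarrow> int \<times> int \<Rightarrow> real"
  assumes k: "k \<in> {1..N}"
    and per: "\<And>a v d. even_vector v \<Longrightarrow> T (a + v) d = T a d"
    and rev: "\<And>a d. T a (- d) = - T (a - d) d"
  shows "T (vertex k) (b k) - T (vertex k + b k) (b k) + T (right_vertex k) (upward k) - T (left_vertex k) (upward k) = 0"
proof -
  have per': "T a d = T a' d" if "even_vector (a - a')" for a a' d
    using per[OF that, of a' d] by simp
  show ?thesis
  proof (cases "downward k")
    case False
    then show ?thesis
      using per'[OF even_left_vertex[of k]] per'[OF even_right_vertex[OF k]] by (simp add: upward_def)
  next
    case True
    have "even_vector (right_vertex k - b k - vertex k)"
      using even_right_vertex[OF k] by (simp add: algebra_simps)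
    moreover have "even_vector (left_vertex k - b k - (vertex k + b k))"
    proof -
      have "left_vertex k - b k - (vertex k + b k) = (left_vertex k - vertex k) + (- b k - b k)" by simp
      then show ?thesis using even_left_vertex[of k] by (auto simp: even_vector_def)
    qed
    ultimately show ?thesis
      using True per'[of "right_vertex k - b k" "vertex k"] per'[of "left_vertex k - b k" "vertex k + b k"]
      by (simp add: upward_def rev)
  qed
qed

section \<open>Dependence of the multiplicity on the ordinate\<close>

text \<open>The four terms come from the upper half plane, the lower half plane, and the right and
  left boundary of the zonotope. The argument -y reflects the symmetry between the two half
  planes.\<close>

definition row_moment :: "nat \<Rightarrow> real \<Rightarrow> real" where
  "row_moment k y = edge_moment (vertex k) (b k) y + edge_moment (vertex k) (b k) (- y)
     + edge_moment (right_vertex k) (upward k) y - edge_moment (left_vertex k) (upward k) y"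

definition total_moment :: "real \<Rightarrow> real" where
  "total_moment y = (\<Sum>k\<in>{1..N}. row_moment k y) / 2"

text \<open>Within a band every moment is affine in y, with coefficient a degree times the inverse
  slope of the row. The four degrees of each row cancel by \<open>boundary_cancels\<close>.\<close>

lemma total_moment_same_band:
  assumes y: "\<lfloor>y\<rfloor> = \<lfloor>y'\<rfloor>" "y \<notin> \<int>" "y' \<notin> \<int>"
  shows "total_moment y' = total_moment y"
proof -
  define r where "r k = (y' - y) * of_int (fst (b k)) / of_int (snd (b k))" for k
  have r: "(y' - y) * of_int (fst (upward k)) / of_int (snd (upward k)) = r k" for k
    by (auto simp: r_def upward_def)
  note band = edge_moment_same_band[OF y]
  have neg: "edge_moment (vertex k) (b k) (- y') = edge_moment (vertex k) (b k) (- y)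
      - r k * edge_degree (vertex k + b k) (b k) y" for k
  proof -
    have "edge_degree (- vertex k - b k) (b k) y = edge_degree (vertex k + b k) (b k) y"
      using edge_degree_translate[of "- vertex k - b k - (vertex k + b k)" "vertex k + b k"]
      by (simp add: even_vector_def)
    then show ?thesis
      unfolding edge_moment_uminus[OF y(2)] edge_moment_uminus[OF y(3)] band r_def by simp
  qed
  have "row_moment k y' = row_moment k y"
    if k: "k \<in> {1..N}" for k
  proof -
    have "r k * (edge_degree (vertex k) (b k) y - edge_degree (vertex k + b k) (b k) y
        + edge_degree (right_vertex k) (upward k) y - edge_degree (left_vertex k) (upward k) y) = 0"
      using boundary_cancels[OF k, of "\<lambda>a d. edge_degree a d y"]
      by (simp add: edge_degree_translate edge_degree_reverse)
    then show ?thesis unfolding row_moment_def neg band r r_def[symmetric] by (simp add: algebra_simps)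
  qed
  then show ?thesis unfolding total_moment_def by simp
qed

text \<open>The rows sum to zero, so the upward rows sum to minus twice the apex. The zonotope is
  thus symmetric about the origin, and reflection exchanges its parallel boundary edges.\<close>

lemma right_left_vertex:
  assumes "k \<in> {1..N}"
  shows "- right_vertex k - upward k = left_vertex k"
proof -
  have "(\<Sum>j\<in>{1..N}. upward j) + apex + apex = (\<Sum>j\<in>{1..N}. b j)"
  proof -
    have "apex = (\<Sum>j\<in>{1..N}. if downward j then b j else 0)"
      unfolding apex_def by (rule sum.inter_filter) simp
    then show ?thesis
      by (simp only: sum.distrib[symmetric]) (auto intro!: sum.cong simp: upward_def)
  qed
  then have "(right_vertex k + upward k) + left_vertex k = 0"
    unfolding right_vertex_def left_vertex_def rows_sum sum_split_at[OF assms, of upward]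
    by (simp add: algebra_simps)
  then have "left_vertex k = - (right_vertex k + upward k)" by (simp only: add_eq_0_iff)
  then show ?thesis by simp
qed

lemma total_moment_uminus:
  assumes "y \<notin> \<int>"
  shows "total_moment (- y) = total_moment y"
proof -
  have y: "- y \<notin> \<int>" using assms by (metis Ints_minus minus_minus)
  have "edge_moment (right_vertex k) (upward k) (- y) = - edge_moment (left_vertex k) (upward k) y"
    "edge_moment (left_vertex k) (upward k) (- y) = - edge_moment (right_vertex k) (upward k) y"
    if "k \<in> {1..N}" for k
    using edge_moment_uminus[OF assms, of "right_vertex k" "upward k"]
      edge_moment_uminus[OF y, of "right_vertex k" "upward k"] right_left_vertex[OF that] by simp_all
  then have "row_moment k (- y) = row_moment k y" if "k \<in> {1..N}" for k
    using that by (simp add: row_moment_def)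
  then show ?thesis by (simp add: total_moment_def)
qed

lemma total_moment_periodic: "total_moment (y + 2 * of_int k) = total_moment y"
  using edge_moment_periodic[of _ _ "- y" "- k"]
  by (simp add: total_moment_def row_moment_def edge_moment_periodic)

lemma total_moment_add_1:
  assumes y: "y \<notin> \<int>"
  shows "total_moment (y + 1) = total_moment y"
proof -
  have y1: "y + 1 \<notin> \<int>" using y by (metis Ints_1 Ints_diff add_diff_cancel_right')
  \<comment> \<open>This is the reflection of y in the midpoint of its band. Evenness and period 2
    therefore compare y + 1 with another point of the band of y.\<close>
  define z where "z = - (y + 1) + 2 * of_int (\<lfloor>y\<rfloor> + 1)"
  have "z \<notin> \<int>" unfolding z_def using y1 by (intro not_Ints_add_even) (metis Ints_minus minus_minus)
  moreover have "\<lfloor>z\<rfloor> = \<lfloor>y\<rfloor>"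
  proof (rule floor_unique)
    have "y \<noteq> of_int \<lfloor>y\<rfloor>" using y by (metis Ints_of_int)
    then have "of_int \<lfloor>y\<rfloor> < y" "y < of_int \<lfloor>y\<rfloor> + 1" by linarith+
    moreover have "r \<le> - (y + 1) + 2 * (r + 1)" "- (y + 1) + 2 * (r + 1) < r + 1"
      if "r < y" "y < r + 1" for r :: real
      using that by auto
    ultimately show "of_int \<lfloor>y\<rfloor> \<le> z" "z < of_int \<lfloor>y\<rfloor> + 1"
      unfolding z_def of_int_add of_int_1 by blast+
  qed
  ultimately have "total_moment z = total_moment y" using y by (intro total_moment_same_band) auto
  then show ?thesis unfolding z_def total_moment_periodic total_moment_uminus[OF y1] by simp
qed

text \<open>Summing \<open>edge_moment_sum\<close> over a closed polygon is a shoelace formula. The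
  fractional parts cancel between the half planes since -(y + 1) has fractional part 1 -
  \<open>frac y\<close>, and between the two zonotope boundaries since they carry the same vectors.
  For each pair of rows the polygon gives the determinant and the zonotope its absolute value,
  together twice the positive part.\<close>

lemma total_moment_sum:
  assumes y: "y \<notin> \<int>"
  shows "total_moment y + total_moment (y + 1) = (\<Sum>(j, k)\<in>pairs. of_int (row_det_pos (b j) (b k)))"
proof -
  define z where "z = - (y + 1)"
  have z: "z \<notin> \<int>" "z + 1 = - y"
    using y unfolding z_def by (auto simp: minus_in_Ints_iff)
  have "frac z = 1 - frac y"
  proof -
    have "y + 1 \<notin> \<int>" using y by (metis Ints_1 Ints_diff add_diff_cancel_right')
    moreover have "frac (y + 1) = frac y" by (simp add: frac_def)
    ultimately show ?thesis unfolding z_def by (simp only: frac_neg if_False)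
  qed
  define f g where "f k = real_of_int (fst (b k))" and "g k = real_of_int (snd (b k))" for k
  define f' g' where "f' k = real_of_int (fst (upward k))" and "g' k = real_of_int (snd (upward k))" for k
  have sum0: "(\<Sum>k\<in>{1..N}. f k) = 0" "(\<Sum>k\<in>{1..N}. g k) = 0"
  proof -
    have "(\<Sum>k\<in>{1..N}. fst (b k)) = 0" "(\<Sum>k\<in>{1..N}. snd (b k)) = 0"
      using rows_sum by (metis fst_sum fst_zero, metis snd_sum snd_zero)
    then show "(\<Sum>k\<in>{1..N}. f k) = 0" "(\<Sum>k\<in>{1..N}. g k) = 0"
      unfolding f_def g_def by (metis of_int_0 of_int_sum)+
  qed
  have summand: "row_moment k y + row_moment k (y + 1) =
     2 * (g k * of_int (fst base)) + 2 * (\<Sum>j\<in>{1..<k}. f j * g k) + f k * g k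
     + ((\<Sum>j\<in>{k<..N}. f' j * g' k) - (\<Sum>j\<in>{1..<k}. f' j * g' k))" for k
  proof -
    have v: "edge_moment (vertex k) (b k) y + edge_moment (vertex k) (b k) (y + 1) +
        (edge_moment (vertex k) (b k) z + edge_moment (vertex k) (b k) (- y)) =
        2 * (g k * of_int (fst (vertex k))) + f k * g k"
      unfolding edge_moment_sum[OF y] edge_moment_sum[OF z(1), unfolded z(2)] \<open>frac z = _\<close>
      by (simp add: f_def g_def algebra_simps)
    have w: "(edge_moment (right_vertex k) (upward k) y + edge_moment (right_vertex k) (upward k) (y + 1)) -
        (edge_moment (left_vertex k) (upward k) y + edge_moment (left_vertex k) (upward k) (y + 1)) =
        g' k * (of_int (fst (right_vertex k)) - of_int (fst (left_vertex k)))"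
      unfolding edge_moment_sum[OF y] by (simp add: g'_def algebra_simps)
    have "real_of_int (fst (vertex k)) = of_int (fst base) + (\<Sum>j\<in>{1..<k}. f j)"
      "real_of_int (fst (right_vertex k)) = of_int (fst apex) + (\<Sum>j\<in>{k<..N}. f' j)"
      "real_of_int (fst (left_vertex k)) = of_int (fst apex) + (\<Sum>j\<in>{1..<k}. f' j)"
      by (simp_all add: vertex_def left_vertex_def right_vertex_def fst_sum f_def f'_def)
    moreover have "(\<Sum>j\<in>A. h j * c) = (\<Sum>j\<in>A. h j) * c" for h :: "nat \<Rightarrow> real" and A c
      by (rule sum_distrib_right[symmetric])
    ultimately show ?thesis using v w unfolding row_moment_def z_def[symmetric]
      by (simp only:) (simp add: algebra_simps)
  qed
  have "2 * (total_moment y + total_moment (y + 1)) = (\<Sum>k\<in>{1..N}. row_moment k y) + (\<Sum>k\<in>{1..N}. row_moment k (y + 1))"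
    by (simp add: total_moment_def)
  also have "\<dots> = (\<Sum>k\<in>{1..N}.
     2 * (g k * of_int (fst base)) + 2 * (\<Sum>j\<in>{1..<k}. f j * g k) + f k * g k
     + ((\<Sum>j\<in>{k<..N}. f' j * g' k) - (\<Sum>j\<in>{1..<k}. f' j * g' k)))"
    unfolding sum.distrib[symmetric] by (intro sum.cong[OF refl] summand)
  also have "\<dots> = 2 * (\<Sum>(j, k)\<in>pairs. f j * g k) + (\<Sum>k\<in>{1..N}. f k * g k)
      + ((\<Sum>(j, k)\<in>pairs. f' k * g' j) - (\<Sum>(j, k)\<in>pairs. f' j * g' k))"
    using sum0(2) sum_below_pairs[where f = "\<lambda>j k. f j * g k"] sum_below_pairs[where f = "\<lambda>j k. f' j * g' k"]
      sum_above_pairs[where f = "\<lambda>j k. f' j * g' k"]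
    by (simp add: sum.distrib sum_subtractf sum_distrib_left[symmetric] sum_distrib_right[symmetric])
  \<comment> \<open>The diagonal is eliminated by expanding the product of the two coordinate sums,
    which is zero.\<close>
  also have "(\<Sum>k\<in>{1..N}. f k * g k) = - (\<Sum>(j, k)\<in>pairs. f j * g k) - (\<Sum>(j, k)\<in>pairs. f k * g j)"
  proof -
    have "0 = (\<Sum>k\<in>{1..N}. (\<Sum>j\<in>{1..N}. f j) * g k)" using sum0 by simp
    also have "\<dots> = (\<Sum>k\<in>{1..N}. (\<Sum>j\<in>{1..<k}. f j * g k) + f k * g k + (\<Sum>j\<in>{k<..N}. f j * g k))"
      unfolding sum_distrib_right by (rule sum.cong[OF refl], rule sum_split_at)
    also have "\<dots> = (\<Sum>(j, k)\<in>pairs. f j * g k) + (\<Sum>k\<in>{1..N}. f k * g k) + (\<Sum>(j, k)\<in>pairs. f k * g j)"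
      using sum_below_pairs[where f = "\<lambda>j k. f j * g k"] sum_above_pairs[where f = "\<lambda>j k. f j * g k"]
      by (simp add: sum.distrib)
    finally show ?thesis by simp
  qed
  also have "2 * (\<Sum>(j, k)\<in>pairs. f j * g k) + (- (\<Sum>(j, k)\<in>pairs. f j * g k) - (\<Sum>(j, k)\<in>pairs. f k * g j))
      + ((\<Sum>(j, k)\<in>pairs. f' k * g' j) - (\<Sum>(j, k)\<in>pairs. f' j * g' k)) =
      (\<Sum>(j, k)\<in>pairs. (f j * g k - f k * g j) + (f' k * g' j - f' j * g' k))"
    by (simp add: sum.distrib sum_subtractf case_prod_unfold)
  also have "\<dots> = (\<Sum>(j, k)\<in>pairs. 2 * of_int (row_det_pos (b j) (b k)))"
  proof (intro sum.cong refl, clarify)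
    fix j k assume jk: "1 \<le> j" "j < k" "k \<le> N"
    have "row_det (upward j) (upward k) = row_det (b j) (b k) \<or> row_det (upward j) (upward k) = - row_det (b j) (b k)"
      by (auto simp: upward_def row_det_def)
    then have "row_det (upward j) (upward k) = - \<bar>row_det (b j) (b k)\<bar>"
      using row_det_upward[of j k] jk by auto
    then have "row_det (b j) (b k) - row_det (upward j) (upward k) = 2 * row_det_pos (b j) (b k)"
      by (auto simp: row_det_pos_def max_def)
    then have "real_of_int (row_det (b j) (b k) - row_det (upward j) (upward k)) = of_int (2 * row_det_pos (b j) (b k))"
      by (simp only:)
    then show "(f j * g k - f k * g j) + (f' k * g' j - f' j * g' k) = 2 * of_int (row_det_pos (b j) (b k))"
      by (simp add: f_def g_def f'_def g'_def row_det_def algebra_simps)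
  qed
  also have "\<dots> = 2 * (\<Sum>(j, k)\<in>pairs. of_int (row_det_pos (b j) (b k)))"
    by (simp add: sum_distrib_left case_prod_unfold)
  finally show ?thesis by simp
qed

lemma total_moment_eq:
  assumes "y \<notin> \<int>"
  shows "total_moment y = 1 / 2 * (\<Sum>(j, k)\<in>pairs. of_int (row_det_pos (b j) (b k)))"
  using total_moment_sum[OF assms] total_moment_add_1[OF assms] by simp

section \<open>The zonotope as a crossing number\<close>

text \<open>A downward row times \<tau> equals the row plus 1 - \<tau> times its negative; the full
  rows collected in this way form the apex.\<close>

lemma zonotope_iff:
  "(pi * x, pi * y) \<in> zonotope N b \<longleftrightarrow> (\<exists>\<mu>. (\<forall>k\<in>{1..N}. 0 \<le> \<mu> k \<and> \<mu> k \<le> 1) \<and>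
     x = of_int (fst apex) + (\<Sum>k\<in>{1..N}. \<mu> k * of_int (fst (upward k))) \<and>
     y = of_int (snd apex) + (\<Sum>k\<in>{1..N}. \<mu> k * of_int (snd (upward k))))"
proof -
  define flip where "flip \<tau> = (\<lambda>k. if downward k then 1 - \<tau> k else \<tau> k)" for \<tau> :: "nat \<Rightarrow> real"
  have ff: "flip (flip \<tau>) = \<tau>" for \<tau> by (auto simp: flip_def)
  have apex: "of_int (c apex) = (\<Sum>k\<in>{1..N}. if downward k then real_of_int (c (b k)) else 0)"
    if "c = fst \<or> c = snd" for c
  proof -
    have "c apex = (\<Sum>k\<in>{k \<in> {1..N}. downward k}. c (b k))"
      using that by (auto simp: apex_def fst_sum snd_sum)
    then have "real_of_int (c apex) = (\<Sum>k\<in>{k \<in> {1..N}. downward k}. real_of_int (c (b k)))"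
      by (simp only: of_int_sum)
    then show ?thesis by (simp only: sum.inter_filter[OF finite_atLeastAtMost])
  qed
  have flip_sum: "of_int (c apex) + (\<Sum>k\<in>{1..N}. flip \<tau> k * of_int (c (upward k))) = (\<Sum>k\<in>{1..N}. \<tau> k * of_int (c (b k)))"
    if "c = fst \<or> c = snd" for c \<tau>
    unfolding apex[OF that] sum.distrib[symmetric] using that
    by (intro sum.cong refl) (auto simp: flip_def upward_def algebra_simps)
  have "(pi * x, pi * y) \<in> zonotope N b \<longleftrightarrow> (\<exists>\<tau>. (\<forall>k\<in>{1..N}. 0 \<le> \<tau> k \<and> \<tau> k \<le> 1) \<and>
     x = (\<Sum>k\<in>{1..N}. \<tau> k * of_int (fst (b k))) \<and> y = (\<Sum>k\<in>{1..N}. \<tau> k * of_int (snd (b k))))"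
    (is "?L = ?R")
  proof
    assume ?L
    then obtain z where z: "(pi * x, pi * y) = (\<Sum>k=1..N. z k)"
      "\<forall>k\<in>{1..N}. \<exists>\<tau>. z k = (\<tau> * (pi * of_int (fst (b k))), \<tau> * (pi * of_int (snd (b k)))) \<and> 0 \<le> \<tau> \<and> \<tau> \<le> 1"
      unfolding zonotope_def convex_hull_origin by blast
    from bchoice[OF z(2)] obtain \<tau> where \<tau>: "\<And>k. k \<in> {1..N} \<Longrightarrow>
      z k = (\<tau> k * (pi * of_int (fst (b k))), \<tau> k * (pi * of_int (snd (b k)))) \<and> 0 \<le> \<tau> k \<and> \<tau> k \<le> 1"
      by blast
    have "pi * x = (\<Sum>k=1..N. fst (z k))" "pi * y = (\<Sum>k=1..N. snd (z k))"
      using z(1) by (metis fst_conv fst_sum, metis snd_conv snd_sum)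
    moreover have "(\<Sum>k=1..N. fst (z k)) = pi * (\<Sum>k\<in>{1..N}. \<tau> k * of_int (fst (b k)))"
      "(\<Sum>k=1..N. snd (z k)) = pi * (\<Sum>k\<in>{1..N}. \<tau> k * of_int (snd (b k)))"
      unfolding sum_distrib_left by (intro sum.cong refl; simp add: \<tau>)+
    ultimately show ?R using \<tau> by (intro exI[of _ \<tau>]) auto
  next
    assume ?R
    then obtain \<tau> where \<tau>: "\<forall>k\<in>{1..N}. 0 \<le> \<tau> k \<and> \<tau> k \<le> 1"
      "x = (\<Sum>k\<in>{1..N}. \<tau> k * of_int (fst (b k)))" "y = (\<Sum>k\<in>{1..N}. \<tau> k * of_int (snd (b k)))" by blast
    define z where "z k = (\<tau> k * (pi * of_int (fst (b k))), \<tau> k * (pi * of_int (snd (b k))))" for k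
    have "(pi * x, pi * y) = (\<Sum>k=1..N. z k)"
      by (simp add: prod_eq_iff fst_sum snd_sum z_def \<tau>(2,3) sum_distrib_left mult_ac)
    moreover have "\<forall>k\<in>{1..N}. z k \<in> convex hull {(0, 0), (pi * of_int (fst (b k)), pi * of_int (snd (b k)))}"
      unfolding convex_hull_origin z_def using \<tau>(1) by blast
    ultimately show ?L unfolding zonotope_def by blast
  qed
  also have "?R \<longleftrightarrow> (\<exists>\<mu>. (\<forall>k\<in>{1..N}. 0 \<le> \<mu> k \<and> \<mu> k \<le> 1) \<and>
     x = of_int (fst apex) + (\<Sum>k\<in>{1..N}. \<mu> k * of_int (fst (upward k))) \<and>
     y = of_int (snd apex) + (\<Sum>k\<in>{1..N}. \<mu> k * of_int (snd (upward k))))" (is "_ = ?R'")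
  proof
    assume ?R
    then obtain \<tau> where \<tau>: "\<forall>k\<in>{1..N}. 0 \<le> \<tau> k \<and> \<tau> k \<le> 1"
      "x = (\<Sum>k\<in>{1..N}. \<tau> k * of_int (fst (b k)))" "y = (\<Sum>k\<in>{1..N}. \<tau> k * of_int (snd (b k)))" by blast
    have "\<forall>k\<in>{1..N}. 0 \<le> flip \<tau> k \<and> flip \<tau> k \<le> 1" using \<tau>(1) by (auto simp: flip_def)
    then show ?R' using flip_sum[of fst \<tau>] flip_sum[of snd \<tau>] \<tau>(2,3) by (intro exI[of _ "flip \<tau>"]) auto
  next
    assume ?R'
    then obtain \<mu> where \<mu>: "\<forall>k\<in>{1..N}. 0 \<le> \<mu> k \<and> \<mu> k \<le> 1"
      "x = of_int (fst apex) + (\<Sum>k\<in>{1..N}. \<mu> k * of_int (fst (upward k)))"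
      "y = of_int (snd apex) + (\<Sum>k\<in>{1..N}. \<mu> k * of_int (snd (upward k)))" by blast
    have "\<forall>k\<in>{1..N}. 0 \<le> flip \<mu> k \<and> flip \<mu> k \<le> 1" using \<mu>(1) by (auto simp: flip_def)
    then show ?R using flip_sum[of fst "flip \<mu>"] flip_sum[of snd "flip \<mu>"] \<mu>(2,3)
      by (intro exI[of _ "flip \<mu>"]) (auto simp: ff)
  qed
  finally show ?thesis .
qed

lemma row_det_upward_of_int:
  "real_of_int (row_det (upward j) (upward k)) =
    of_int (fst (upward j)) * of_int (snd (upward k)) - of_int (snd (upward j)) * of_int (fst (upward k))"
  by (simp add: row_det_def)

text \<open>In the upward orientation, the left boundary of the zonotope runs through the segments in the
  given order and the right boundary in the opposite order.\<close>

lemma zonotope_between: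
  assumes z: "(pi * x, pi * y) \<in> zonotope N b" and k: "k \<in> {1..N}" "0 < snd (upward k)"
  shows "edge_x (left_vertex k) (upward k) y \<le> x" "x \<le> edge_x (right_vertex k) (upward k) y"
proof -
  obtain \<mu> where \<mu>: "\<forall>k\<in>{1..N}. 0 \<le> \<mu> k \<and> \<mu> k \<le> 1"
    and x: "x = of_int (fst apex) + (\<Sum>k\<in>{1..N}. \<mu> k * of_int (fst (upward k)))"
    and y: "y = of_int (snd apex) + (\<Sum>k\<in>{1..N}. \<mu> k * of_int (snd (upward k)))"
    using z unfolding zonotope_iff by blast
  \<comment> \<open>These are the displacements transverse to row k: nonpositive before k and
    nonnegative after it. Coefficients 1 before and 0 after k minimize the total and give the left
    edge; the opposite choice gives the right edge.\<close>
  define D where "D j = real_of_int (row_det (upward j) (upward k))" for j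
  define p q where "p = real_of_int (fst (upward k))" and "q = real_of_int (snd (upward k))"
  have q: "q > 0" using k(2) by (simp add: q_def)
  have D: "D j = of_int (fst (upward j)) * q - of_int (snd (upward j)) * p" for j
    by (simp add: D_def row_det_upward_of_int p_def q_def)
  have Dk: "D k = 0" by (simp add: D p_def q_def)
  have neg: "D j \<le> 0" if "j \<in> {1..<k}" for j using row_det_upward[of j k] that k by (simp add: D_def)
  have pos: "0 \<le> D j" if "j \<in> {k<..N}" for j
  proof -
    have "row_det (upward j) (upward k) = - row_det (upward k) (upward j)" by (simp add: row_det_def)
    then show ?thesis using row_det_upward[of k j] that k by (simp add: D_def)
  qed
  have tot: "(x - of_int (fst apex)) * q - (y - of_int (snd apex)) * p = (\<Sum>j\<in>{1..N}. \<mu> j * D j)"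
    unfolding x y D by (simp add: sum_distrib_right sum_subtractf right_diff_distrib mult.assoc)
  also have "\<dots> = (\<Sum>j\<in>{1..<k}. \<mu> j * D j) + (\<Sum>j\<in>{k<..N}. \<mu> j * D j)"
    using sum_split_at[OF k(1), of "\<lambda>j. \<mu> j * D j"] by (simp add: Dk)
  finally have tot: "(x - of_int (fst apex)) * q - (y - of_int (snd apex)) * p =
    (\<Sum>j\<in>{1..<k}. \<mu> j * D j) + (\<Sum>j\<in>{k<..N}. \<mu> j * D j)" .
  have l1: "(\<Sum>j\<in>{1..<k}. D j) \<le> (\<Sum>j\<in>{1..<k}. \<mu> j * D j)"
  proof (rule sum_mono)
    fix j assume j: "j \<in> {1..<k}"
    then have "j \<in> {1..N}" using k by auto
    then have "(1 - \<mu> j) * D j \<le> 0" using \<mu> neg[OF j] by (intro mult_nonneg_nonpos) auto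
    then show "D j \<le> \<mu> j * D j" by (simp add: algebra_simps)
  qed
  have l2: "0 \<le> (\<Sum>j\<in>{k<..N}. \<mu> j * D j)" using \<mu> pos by (intro sum_nonneg mult_nonneg_nonneg) auto
  have r1: "(\<Sum>j\<in>{1..<k}. \<mu> j * D j) \<le> 0"
  proof (rule sum_nonpos)
    fix j assume j: "j \<in> {1..<k}"
    then have "j \<in> {1..N}" using k by auto
    then show "\<mu> j * D j \<le> 0" using \<mu> neg[OF j] by (intro mult_nonneg_nonpos) auto
  qed
  have r2: "(\<Sum>j\<in>{k<..N}. \<mu> j * D j) \<le> (\<Sum>j\<in>{k<..N}. D j)"
  proof (rule sum_mono)
    fix j assume j: "j \<in> {k<..N}"
    then have "j \<in> {1..N}" using k by auto
    then have "0 \<le> (1 - \<mu> j) * D j" using \<mu> pos[OF j] by (intro mult_nonneg_nonneg) auto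
    then show "\<mu> j * D j \<le> D j" by (simp add: algebra_simps)
  qed
  have vl: "(of_int (fst (left_vertex k)) - of_int (fst apex)) * q - (of_int (snd (left_vertex k)) - of_int (snd apex)) * p = (\<Sum>j\<in>{1..<k}. D j)"
    and vr: "(of_int (fst (right_vertex k)) - of_int (fst apex)) * q - (of_int (snd (right_vertex k)) - of_int (snd apex)) * p = (\<Sum>j\<in>{k<..N}. D j)"
    unfolding D left_vertex_def right_vertex_def
    by (simp_all add: fst_sum snd_sum sum_distrib_right sum_subtractf)
  have X: "edge_x v (upward k) y * q = of_int (fst v) * q + (y - of_int (snd v)) * p" for v
    using q by (simp add: edge_x_def p_def q_def field_simps)
  have "edge_x (left_vertex k) (upward k) y * q \<le> x * q"
    unfolding X using tot l1 l2 vl by (simp add: algebra_simps)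
  then show "edge_x (left_vertex k) (upward k) y \<le> x" using q by simp
  have "x * q \<le> edge_x (right_vertex k) (upward k) y * q"
    unfolding X using tot r1 r2 vr by (simp add: algebra_simps)
  then show "x \<le> edge_x (right_vertex k) (upward k) y" using q by simp
qed

lemma boundary_in_zonotope:
  assumes k: "k \<in> {1..N}"
  shows "\<lbrakk>of_int (snd (left_vertex k)) < y; y < of_int (snd (left_vertex k) + snd (upward k))\<rbrakk> \<Longrightarrow>
      (pi * edge_x (left_vertex k) (upward k) y, pi * y) \<in> zonotope N b"
    and "\<lbrakk>of_int (snd (right_vertex k)) < y; y < of_int (snd (right_vertex k) + snd (upward k))\<rbrakk> \<Longrightarrow>
      (pi * edge_x (right_vertex k) (upward k) y, pi * y) \<in> zonotope N b"
proof -
  have mem: "(pi * edge_x v (upward k) y, pi * y) \<in> zonotope N b"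
    if y: "of_int (snd v) < y" "y < of_int (snd v + snd (upward k))"
      and v: "v = apex + (\<Sum>j\<in>S. upward j)" and S: "S \<subseteq> {1..N}" "k \<notin> S" for v S
  proof -
    define \<tau> where "\<tau> = (y - of_int (snd v)) / of_int (snd (upward k))"
    have pos: "real_of_int (snd (upward k)) > 0" using y by simp
    have \<tau>: "0 \<le> \<tau>" "\<tau> \<le> 1" using y pos by (auto simp: \<tau>_def field_simps)
    \<comment> \<open>A point of the edge is reached by the complete rows of S together with a
      fraction of row k.\<close>
    define \<mu> where "\<mu> j = (if j \<in> S then 1 else if j = k then \<tau> else 0)" for j
    have sum: "(\<Sum>j\<in>{1..N}. \<mu> j * f j) = (\<Sum>j\<in>S. f j) + \<tau> * f k" for f :: "nat \<Rightarrow> real"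
    proof -
      have "(\<Sum>j\<in>{1..N}. \<mu> j * f j) = (\<Sum>j\<in>insert k S. \<mu> j * f j)"
        using S k by (intro sum.mono_neutral_right) (auto simp: \<mu>_def)
      also have "\<dots> = \<mu> k * f k + (\<Sum>j\<in>S. \<mu> j * f j)"
        using S finite_subset[OF S(1)] by (intro sum.insert) auto
      also have "\<dots> = \<tau> * f k + (\<Sum>j\<in>S. f j)" using S by (auto simp: \<mu>_def intro!: sum.cong)
      finally show ?thesis by simp
    qed
    show ?thesis unfolding zonotope_iff
    proof (intro exI[of _ \<mu>] conjI ballI)
      show "0 \<le> \<mu> j" "\<mu> j \<le> 1" for j using \<tau> by (auto simp: \<mu>_def)
      show "edge_x v (upward k) y = of_int (fst apex) + (\<Sum>k\<in>{1..N}. \<mu> k * of_int (fst (upward k)))"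
        unfolding sum by (simp add: edge_x_def v fst_sum \<tau>_def)
      show "y = of_int (snd apex) + (\<Sum>k\<in>{1..N}. \<mu> k * of_int (snd (upward k)))"
        unfolding sum using pos by (simp add: \<tau>_def v snd_sum)
    qed
  qed
  show "\<lbrakk>of_int (snd (left_vertex k)) < y; y < of_int (snd (left_vertex k) + snd (upward k))\<rbrakk> \<Longrightarrow>
      (pi * edge_x (left_vertex k) (upward k) y, pi * y) \<in> zonotope N b"
    using k by (intro mem[where S = "{1..<k}"]) (auto simp: left_vertex_def)
  show "\<lbrakk>of_int (snd (right_vertex k)) < y; y < of_int (snd (right_vertex k) + snd (upward k))\<rbrakk> \<Longrightarrow>
      (pi * edge_x (right_vertex k) (upward k) y, pi * y) \<in> zonotope N b"
    using k by (intro mem[where S = "{k<..N}"]) (auto simp: right_vertex_def)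
qed

lemma zonotope_convex: "convex (zonotope N b)"
proof -
  have "zonotope N b = (\<Sum>k\<in>{1..N}. convex hull {(0, 0), (pi * of_int (fst (b k)), pi * of_int (snd (b k)))})"
    by (auto simp: zonotope_def set_sum_alt)
  then show ?thesis by (simp add: convex_set_sum)
qed

lemma right_vertex_reflect:
  assumes "i \<in> {1..Suc N}"
  shows "right_vertex (Suc N - i) = apex + (\<Sum>j\<in>{1..<i}. upward (Suc N - j))"
proof -
  have "(\<Sum>j\<in>{1..<i}. upward (Suc N - j)) = (\<Sum>j\<in>{Suc N - i<..N}. upward j)"
    using assms by (intro sum.reindex_bij_witness[where i = "\<lambda>j. Suc N - j" and j = "\<lambda>j. Suc N - j"]) auto
  then show ?thesis by (simp add: right_vertex_def)
qed

text \<open>At an intermediate height each boundary path is crossed once, at \<open>xl\<close> on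
  the left and \<open>xr\<close> on the right, and by convexity the slice is the interval between
  them. Its indicator is the difference of the two ray counts. Below and above the zonotope both
  sides vanish.\<close>

lemma zonotope_crossings:
  assumes y: "y \<notin> \<int>"
    and off: "\<And>k. \<lbrakk>k \<in> {1..N}; snd (upward k) \<noteq> 0\<rbrakk> \<Longrightarrow>
      edge_x (left_vertex k) (upward k) y \<noteq> x \<and> edge_x (right_vertex k) (upward k) y \<noteq> x"
  shows "(if (pi * x, pi * y) \<in> zonotope N b then 1 else 0) =
    (\<Sum>k\<in>{1..N}. edge_crossing (right_vertex k) (upward k) x y - edge_crossing (left_vertex k) (upward k) x y)"
proof -
  define top where "top = snd (apex + (\<Sum>j\<in>{1..N}. upward j))"
  have nonint: "y \<noteq> of_int n" for n using y by auto
  have left_range: "snd apex \<le> snd (left_vertex k)" "snd (left_vertex k) + snd (upward k) \<le> top"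
    and right_range: "snd apex \<le> snd (right_vertex k)" "snd (right_vertex k) + snd (upward k) \<le> top"
    if k: "k \<in> {1..N}" for k
  proof -
    have "0 \<le> (\<Sum>j\<in>A. snd (upward j))" for A by (intro sum_nonneg snd_upward)
    then show "snd apex \<le> snd (left_vertex k)" "snd apex \<le> snd (right_vertex k)"
      "snd (left_vertex k) + snd (upward k) \<le> top" "snd (right_vertex k) + snd (upward k) \<le> top"
      using sum_split_at[OF k, of "\<lambda>j. snd (upward j)"]
      by (auto simp: left_vertex_def right_vertex_def top_def snd_sum)
  qed
  consider "y < of_int (snd apex)" | "of_int top < y" | "of_int (snd apex) < y" "y < of_int top"
    using nonint[of "snd apex"] nonint[of top] by linarith
  then show ?thesis
  proof cases
    case 3
    obtain l where l: "l \<in> {1..N}" "of_int (snd (left_vertex l)) < y" "y < of_int (snd (left_vertex l) + snd (upward l))"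
      and suml: "\<And>g. (\<Sum>j\<in>{1..N}. edge_sign (left_vertex j) (upward j) y * g j) = g l"
    proof (rule path_level[where a = apex and v = upward and N = N and y = y])
      show "y < of_int (snd (apex + (\<Sum>j\<in>{1..<Suc N}. upward j)))"
        using 3 by (simp add: top_def atLeastLessThanSuc_atLeastAtMost)
    qed (use 3 y that snd_upward in \<open>auto simp: left_vertex_def\<close>)
    obtain r where r: "r \<in> {1..N}" "of_int (snd (right_vertex r)) < y" "y < of_int (snd (right_vertex r) + snd (upward r))"
      and sumr: "\<And>g. (\<Sum>j\<in>{1..N}. edge_sign (right_vertex j) (upward j) y * g j) = g r"
    \<comment> \<open>The right boundary becomes an upward path from the apex when the rows are read
      from last to first.\<close>
    proof (rule path_level[where a = apex and v = "\<lambda>j. upward (Suc N - j)" and N = N and y = y])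
      have "(\<Sum>j\<in>{1..<Suc N}. upward (Suc N - j)) = (\<Sum>j\<in>{1..N}. upward j)"
        by (intro sum.reindex_bij_witness[where i = "\<lambda>j. Suc N - j" and j = "\<lambda>j. Suc N - j"]) auto
      then show "y < of_int (snd (apex + (\<Sum>j\<in>{1..<Suc N}. upward (Suc N - j))))"
        using 3 by (simp add: top_def)
      fix k assume k: "k \<in> {1..N}"
        and k2: "of_int (snd (apex + (\<Sum>j\<in>{1..<k}. upward (Suc N - j)))) < y"
          "y < of_int (snd (apex + (\<Sum>j\<in>{1..<k}. upward (Suc N - j))) + snd (upward (Suc N - k)))"
        and g: "\<And>g. (\<Sum>j\<in>{1..N}. edge_sign (apex + (\<Sum>i\<in>{1..<j}. upward (Suc N - i))) (upward (Suc N - j)) y * g j) = g k"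
      have rv: "apex + (\<Sum>i\<in>{1..<j}. upward (Suc N - i)) = right_vertex (Suc N - j)" if "j \<in> {1..N}" for j
        using right_vertex_reflect[of j] that by simp
      show thesis
      proof (rule that[of "Suc N - k"])
        fix h :: "nat \<Rightarrow> int"
        have "(\<Sum>j\<in>{1..N}. edge_sign (right_vertex j) (upward j) y * h j) =
            (\<Sum>j\<in>{1..N}. edge_sign (right_vertex (Suc N - j)) (upward (Suc N - j)) y * h (Suc N - j))"
          by (intro sum.reindex_bij_witness[where i = "\<lambda>j. Suc N - j" and j = "\<lambda>j. Suc N - j"]) auto
        also have "\<dots> = h (Suc N - k)"
          unfolding g[of "\<lambda>j. h (Suc N - j)", symmetric] by (intro sum.cong refl) (simp only: rv)
        finally show "(\<Sum>j\<in>{1..N}. edge_sign (right_vertex j) (upward j) y * h j) = h (Suc N - k)" .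
      qed (use k k2[unfolded rv[OF k]] in auto)
    qed (use 3 y snd_upward in auto)
    define xl xr where "xl = edge_x (left_vertex l) (upward l) y" and "xr = edge_x (right_vertex r) (upward r) y"
    have up: "0 < snd (upward l)" "0 < snd (upward r)" using l(2,3) r(2,3) by linarith+
    have ne: "xl \<noteq> x" "xr \<noteq> x" using off[OF l(1)] off[OF r(1)] up by (auto simp: xl_def xr_def)
    have zl: "(pi * xl, pi * y) \<in> zonotope N b" unfolding xl_def by (rule boundary_in_zonotope(1)[OF l])
    have zr: "(pi * xr, pi * y) \<in> zonotope N b" unfolding xr_def by (rule boundary_in_zonotope(2)[OF r])
    have lr: "xl \<le> xr" unfolding xr_def by (rule zonotope_between(2)[OF zl r(1) up(2)])
    have iff: "(pi * x, pi * y) \<in> zonotope N b \<longleftrightarrow> xl < x \<and> x < xr"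
    proof
      assume "(pi * x, pi * y) \<in> zonotope N b"
      from zonotope_between(1)[OF this l(1) up(1)] zonotope_between(2)[OF this r(1) up(2)]
      show "xl < x \<and> x < xr" using ne by (auto simp: xl_def xr_def)
    next
      assume x: "xl < x \<and> x < xr"
      define u where "u = (x - xl) / (xr - xl)"
      have "u * (xr - xl) = x - xl" using x by (simp add: u_def)
      then have "x = (1 - u) * xl + u * xr" by (simp add: algebra_simps)
      moreover have "0 \<le> u" "u \<le> 1" using x by (auto simp: u_def)
      ultimately have u: "0 \<le> u" "u \<le> 1" "x = (1 - u) * xl + u * xr" by auto
      have "(1 - u) *\<^sub>R (pi * xl, pi * y) + u *\<^sub>R (pi * xr, pi * y) \<in> zonotope N b"
        by (rule convexD[OF zonotope_convex zl zr]) (use u in auto)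
      also have "(1 - u) *\<^sub>R (pi * xl, pi * y) + u *\<^sub>R (pi * xr, pi * y) = (pi * x, pi * y)"
        by (subst u(3)) (simp add: algebra_simps)
      finally show "(pi * x, pi * y) \<in> zonotope N b" .
    qed
    have "(\<Sum>k\<in>{1..N}. edge_crossing (right_vertex k) (upward k) x y - edge_crossing (left_vertex k) (upward k) x y) =
        of_bool (x < xr) - of_bool (x < xl)"
      unfolding edge_crossing_def sum_subtractf suml sumr xl_def xr_def ..
    also have "\<dots> = (if (pi * x, pi * y) \<in> zonotope N b then 1 else 0)"
      unfolding iff using lr ne by auto
    finally show ?thesis by simp
  next
    case 1
    have "edge_sign (right_vertex k) (upward k) y = 0" "edge_sign (left_vertex k) (upward k) y = 0" if "k \<in> {1..N}" for k
      using left_range[OF that] right_range[OF that] snd_upward[of k] 1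
      by (auto simp: edge_sign_def simp del: of_int_add)
    moreover have "(pi * x, pi * y) \<notin> zonotope N b"
    proof
      assume "(pi * x, pi * y) \<in> zonotope N b"
      then obtain \<mu> where "\<forall>k\<in>{1..N}. 0 \<le> \<mu> k \<and> \<mu> k \<le> 1"
        "y = of_int (snd apex) + (\<Sum>k\<in>{1..N}. \<mu> k * of_int (snd (upward k)))" unfolding zonotope_iff by blast
      moreover have "0 \<le> (\<Sum>k\<in>{1..N}. \<mu> k * of_int (snd (upward k)))"
        using calculation snd_upward by (intro sum_nonneg mult_nonneg_nonneg) auto
      ultimately show False using 1 by simp
    qed
    ultimately show ?thesis by (simp add: edge_crossing_def)
  next
    case 2
    have "edge_sign (right_vertex k) (upward k) y = 0" "edge_sign (left_vertex k) (upward k) y = 0" if "k \<in> {1..N}" for k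
      using left_range[OF that] right_range[OF that] snd_upward[of k] 2
      by (auto simp: edge_sign_def simp del: of_int_add)
    moreover have "(pi * x, pi * y) \<notin> zonotope N b"
    proof
      assume "(pi * x, pi * y) \<in> zonotope N b"
      then obtain \<mu> where \<mu>: "\<forall>k\<in>{1..N}. 0 \<le> \<mu> k \<and> \<mu> k \<le> 1"
        "y = of_int (snd apex) + (\<Sum>k\<in>{1..N}. \<mu> k * of_int (snd (upward k)))" unfolding zonotope_iff by blast
      have "(\<Sum>k\<in>{1..N}. \<mu> k * of_int (snd (upward k))) \<le> (\<Sum>k\<in>{1..N}. 1 * of_int (snd (upward k)))"
        using \<mu> snd_upward by (intro sum_mono mult_right_mono) auto
      then show False using 2 \<mu>(2) by (simp add: top_def snd_sum)
    qed
    ultimately show ?thesis by (simp add: edge_crossing_def)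
  qed
qed

section \<open>The rows of finite slope as a line arrangement\<close>

text \<open>The other rows have constant linear factors and contribute no varying angle.\<close>

definition sloped :: "nat set" where
  "sloped = {j \<in> {1..N}. snd (b j) \<noteq> 0}"

definition slope :: "nat \<Rightarrow> real" where
  "slope j = - of_int (fst (b j)) / of_int (snd (b j))"

definition row :: "nat \<Rightarrow> complex" where
  "row j = Complex (of_int (fst (b j))) (of_int (snd (b j)))"

lemma rows_sum_snd: "(\<Sum>j\<in>{1..N}. snd (b j)) = 0" and rows_sum_fst: "(\<Sum>j\<in>{1..N}. fst (b j)) = 0"
  using rows_sum by (metis snd_sum snd_zero, metis fst_sum fst_zero)

lemma beta_slope: "j \<in> sloped \<Longrightarrow> beta (b j) = ereal (slope j)"
  by (simp add: beta_def slope_def sloped_def)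

lemma beta_flat: "j \<in> {1..N} - sloped \<Longrightarrow> beta (b j) = -\<infinity>"
  by (simp add: beta_def sloped_def)

sublocale angles: line_arrangement sloped slope row
proof
  show "finite sloped" by (simp add: sloped_def)
  show "Re (row j) + slope j * Im (row j) = 0" if "j \<in> sloped" for j
    using that by (simp add: row_def slope_def sloped_def)
  have "(\<Sum>j\<in>sloped. Im (row j)) = (\<Sum>j\<in>{1..N}. real_of_int (snd (b j)))"
    unfolding row_def sloped_def by (intro sum.mono_neutral_cong_left) auto
  also have "\<dots> = 0" using rows_sum_snd by (metis of_int_0 of_int_sum)
  finally show "(\<Sum>j\<in>sloped. Im (row j)) = 0" .
qed

lemma initial_segment:
  fixes S :: "nat set"
  assumes "S \<subseteq> {1..N}" "\<And>j k. \<lbrakk>k \<in> S; 1 \<le> j; j \<le> k\<rbrakk> \<Longrightarrow> j \<in> S"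
  obtains n where "n \<le> N" "S = {1..n}"
proof (cases "S = {}")
  case False
  have fin: "finite S" using assms(1) by (rule finite_subset) simp
  then have "Max S \<in> S" using False by (rule Max_in)
  then have "S = {1..Max S}" using assms fin by (auto intro: Max_ge)
  then show thesis using that[of "Max S"] \<open>Max S \<in> S\<close> assms(1) by auto
qed (use that[of 0] in auto)

text \<open>Rows are sorted by decreasing \<beta>, and rows without a slope stand last. This is what
  makes the boundary values of the angle sum partial sums of the rows in the given order.\<close>

lemma slope_levels:
  obtains n m where "n \<le> m" "m \<le> N" "{j \<in> sloped. r < slope j} = {1..n}" "{j \<in> sloped. r \<le> slope j} = {1..m}"
proof -
  have "(j \<in> sloped \<and> r < slope j) = (j \<in> {1..N} \<and> ereal r < beta (b j))"
    "(j \<in> sloped \<and> r \<le> slope j) = (j \<in> {1..N} \<and> ereal r \<le> beta (b j))" for j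
  proof -
    have "sloped \<subseteq> {1..N}" by (auto simp: sloped_def)
    then show "(j \<in> sloped \<and> r < slope j) = (j \<in> {1..N} \<and> ereal r < beta (b j))"
      "(j \<in> sloped \<and> r \<le> slope j) = (j \<in> {1..N} \<and> ereal r \<le> beta (b j))"
      by (cases "j \<in> sloped"; cases "j \<in> {1..N}"; auto simp: beta_slope beta_flat)+
  qed
  then have "{j \<in> sloped. r < slope j} = {j \<in> {1..N}. ereal r < beta (b j)}"
    "{j \<in> sloped. r \<le> slope j} = {j \<in> {1..N}. ereal r \<le> beta (b j)}"
    by blast+
  moreover obtain n where "n \<le> N" "{j \<in> {1..N}. ereal r < beta (b j)} = {1..n}"
    by (rule initial_segment[of "{j \<in> {1..N}. ereal r < beta (b j)}"])
      (use rows_sorted in \<open>auto intro: less_le_trans\<close>)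
  moreover obtain m where "m \<le> N" "{j \<in> {1..N}. ereal r \<le> beta (b j)} = {1..m}"
    by (rule initial_segment[of "{j \<in> {1..N}. ereal r \<le> beta (b j)}"])
      (use rows_sorted in \<open>auto intro: order_trans\<close>)
  moreover have "{1..n} \<subseteq> {1..m}"
    using calculation by (metis (mono_tags, lifting) Collect_mono order_less_imp_le)
  then have "n \<le> m" by (cases "n = 0") auto
  ultimately show thesis using that by simp
qed

section \<open>Fibres of the coamoeba as crossing numbers\<close>

lemma sloped_subset: "sloped \<subseteq> {1..N}" "finite sloped"
  by (auto simp: sloped_def)

lemma snd_vertex_nonint: "y \<notin> \<int> \<Longrightarrow> of_int (snd v) \<noteq> (y::real)"
  by auto

lemma sum_row_prefix:
  "S = {1..n} \<Longrightarrow> (\<Sum>j\<in>S. row j) = Complex (of_int (fst (vertex (Suc n)) - fst base)) (of_int (snd (vertex (Suc n)) - snd base))"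
  by (simp add: vertex_def row_def complex_eq_iff fst_sum snd_sum atLeastLessThanSuc_atLeastAtMost)

lemma edge_sign_vertex:
  assumes "1 \<le> k"
  shows "edge_sign (vertex k) (b k) y =
    of_bool (of_int (snd (vertex (Suc (k - 1)))) < y) - of_bool (of_int (snd (vertex (Suc k))) < y)"
proof -
  have "vertex (Suc k) = vertex k + b k" "Suc (k - 1) = k" using assms by (simp_all add: vertex_def add.assoc)
  then show ?thesis by (simp add: edge_sign_def)
qed

lemma vertex_closed: "(\<Sum>k\<in>{1..N}. edge_sign (vertex k) (b k) y) = 0"
proof -
  define h :: "nat \<Rightarrow> int" where "h m = of_bool (of_int (snd (vertex (Suc m))) < y)" for m
  have "(\<Sum>k\<in>{1..N}. edge_sign (vertex k) (b k) y) = (\<Sum>k\<in>{Suc 0..N}. h (k - 1) - h k)"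
    by (intro sum.cong) (auto simp: edge_sign_vertex h_def)
  also have "\<dots> = h 0 - h N" by (induction N) auto
  also have "vertex (Suc N) = vertex (Suc 0)" using rows_sum by (simp add: vertex_def atLeastLessThanSuc_atLeastAtMost)
  then have "h 0 - h N = 0" by (simp add: h_def)
  finally show ?thesis .
qed

definition angle_target :: "real \<Rightarrow> real \<Rightarrow> complex" where
  "angle_target x y = Complex (pi * (x - of_int (fst base))) (pi * (y - of_int (snd base)))"

text \<open>The crossing numbers of the argument principle are attached to slopes, so parallel rows
  are grouped and their signs telescope. They count on the leftward ray; since the signs around the
  closed polygon add up to zero, the rightward count is its negative.\<close>

lemma fibre_card:
  fixes x y :: real
  assumes y: "y \<notin> \<int>"
    and off: "\<And>k. k \<in> sloped \<Longrightarrow> edge_x (vertex k) (b k) y \<noteq> x"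
    and nc: "\<And>t. \<lbrakk>0 < Im t; angles.angle_sum t = angle_target x y\<rbrakk> \<Longrightarrow> angles.slope_sum t \<noteq> 0"
  defines "F \<equiv> {t. 0 < Im t \<and> angles.angle_sum t = angle_target x y}"
  shows "finite F" "int (card F) = (\<Sum>k\<in>{1..N}. edge_crossing (vertex k) (b k) x y)"
proof -
  define p where "p = angle_target x y"
  have step: "angles.step r - p = of_real pi * Complex (of_int (fst (vertex (Suc n))) - x) (of_int (snd (vertex (Suc n))) - y)"
    if "{j \<in> sloped. r < slope j} = {1..n}" for r n
    unfolding angles.step_def sum_row_prefix[OF that] p_def angle_target_def by (simp add: complex_eq_iff algebra_simps)
  have left: "angles.left_step r - p = of_real pi * Complex (of_int (fst (vertex (Suc m))) - x) (of_int (snd (vertex (Suc m))) - y)"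
    if "{j \<in> sloped. r \<le> slope j} = {1..m}" for r m
  proof -
    have "{j \<in> sloped. r \<le> slope j} = {j \<in> sloped. r < slope j} \<union> {j \<in> sloped. slope j = r}" by auto
    then have "(\<Sum>j\<in>{j \<in> sloped. r \<le> slope j}. row j) = (\<Sum>j\<in>{j \<in> sloped. r < slope j}. row j) + (\<Sum>j\<in>{j \<in> sloped. slope j = r}. row j)"
      using sloped_subset(2) by (simp only:) (intro sum.union_disjoint, auto)
    then have "angles.left_step r = of_real pi * (\<Sum>j\<in>{j \<in> sloped. r \<le> slope j}. row j)"
      by (simp add: angles.left_step_def angles.step_def distrib_left)
    then show ?thesis unfolding sum_row_prefix[OF that] p_def angle_target_def by (simp add: complex_eq_iff algebra_simps)
  qed
  define \<eta> where "\<eta> k = edge_x (vertex k) (b k) y - x" for k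
  have \<eta>_eq: "Re (angles.step r - p) + r * Im (angles.step r - p) = pi * \<eta> k"
    if k: "k \<in> sloped" "slope k = r" and n: "{j \<in> sloped. r < slope j} = {1..n}" for r n k
  proof -
    have kb: "snd (b k) \<noteq> 0" "k \<in> {1..N}" using k by (auto simp: sloped_def)
    have kn: "n < k" using n k by (metis (mono_tags, lifting) atLeastAtMost_iff kb(2) less_irrefl mem_Collect_eq not_le)
    define c where "c j = of_int (fst (b j)) + r * of_int (snd (b j))" for j
    \<comment> \<open>Rows between the start of the group and k have the same slope r, so the
      functional does not change along them and all these edges lie on one line.\<close>
    have c0: "c j = 0" if j: "j \<in> {1..<k} - {1..n}" for j
    proof -
      have jN: "j \<in> {1..N}" "1 \<le> j" "j \<le> k" using j kb by auto
      have "beta (b k) \<le> beta (b j)" using jN kb by (intro rows_sorted) auto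
      then have "beta (b j) \<noteq> -\<infinity>" using beta_slope[OF k(1)] by auto
      then have js: "j \<in> sloped" using beta_flat[of j] jN by auto
      have "r \<le> slope j" using \<open>beta (b k) \<le> beta (b j)\<close> k js beta_slope by auto
      moreover have "\<not> r < slope j" using n js j by auto
      ultimately have "slope j = r" by simp
      then show ?thesis using js by (auto simp: c_def slope_def sloped_def)
    qed
    have vc: "of_int (fst (vertex i)) + r * of_int (snd (vertex i)) =
        of_int (fst base) + r * of_int (snd base) + (\<Sum>j\<in>{1..<i}. c j)" for i
      by (simp add: vertex_def c_def fst_sum snd_sum sum.distrib sum_distrib_left algebra_simps)
    have "(\<Sum>j\<in>{1..<k}. c j) = (\<Sum>j\<in>{1..n}. c j)"
      using c0 kn by (intro sum.mono_neutral_right) auto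
    then have eq: "of_int (fst (vertex k)) + r * of_int (snd (vertex k)) =
      of_int (fst (vertex (Suc n))) + r * of_int (snd (vertex (Suc n)))"
      unfolding vc by (simp add: atLeastLessThanSuc_atLeastAtMost)
    have "of_int (fst (b k)) / of_int (snd (b k)) = - r" using k(2) by (simp add: slope_def)
    then have "edge_x (vertex k) (b k) y = of_int (fst (vertex k)) - r * (y - of_int (snd (vertex k)))"
      unfolding edge_x_def times_divide_eq_right[symmetric] by simp
    then have "\<eta> k = (of_int (fst (vertex (Suc n))) + r * of_int (snd (vertex (Suc n)))) - r * y - x"
      unfolding eq[symmetric] by (simp add: \<eta>_def algebra_simps)
    then show ?thesis unfolding step[OF n] by (simp only:) (simp add: algebra_simps)
  qed
  have Im_neq: "Im p \<noteq> Im (angles.step r)" for r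
  proof -
    obtain n m where n: "{j \<in> sloped. r < slope j} = {1..n}" by (rule slope_levels)
    have "Im (angles.step r - p) = pi * (of_int (snd (vertex (Suc n))) - y)" unfolding step[OF n] by simp
    moreover have "of_int (snd (vertex (Suc n))) - y \<noteq> 0" using y by auto
    ultimately show ?thesis by auto
  qed
  have off_lines: "Re (angles.step r - p) + r * Im (angles.step r - p) \<noteq> 0" if r: "r \<in> slope ` sloped" for r
  proof -
    obtain n m where n: "{j \<in> sloped. r < slope j} = {1..n}" by (rule slope_levels)
    obtain k where k: "k \<in> sloped" "slope k = r" using r by auto
    show ?thesis unfolding \<eta>_eq[OF k n] using off[OF k(1)] by (simp add: \<eta>_def)
  qed
  interpret fib: arrangement_fibre sloped slope row p
    by unfold_locales (use Im_neq off_lines nc in \<open>auto simp: p_def\<close>)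
  have F: "F = fib.fibre" unfolding F_def fib.fibre_def by (simp only: p_def)
  show "finite F" unfolding F by (rule fib.finite_fibre)
  define h :: "nat \<Rightarrow> int" where "h m = of_bool (of_int (snd (vertex (Suc m))) < y)" for m
  have sign: "edge_sign (vertex k) (b k) y = h (k - 1) - h k" if "1 \<le> k" for k
    using edge_sign_vertex[OF that] by (simp add: h_def)
  have group: "(\<Sum>k\<in>{k \<in> sloped. slope k = r}. edge_sign (vertex k) (b k) y * of_bool (\<eta> k < 0)) = - fib.crossing r"
    if r: "r \<in> slope ` sloped" for r
  proof -
    obtain n m where nm: "n \<le> m" "m \<le> N" and n: "{j \<in> sloped. r < slope j} = {1..n}"
      and m: "{j \<in> sloped. r \<le> slope j} = {1..m}" by (rule slope_levels)
    have G: "{k \<in> sloped. slope k = r} = {Suc n..m}"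
    proof -
      have "{k \<in> sloped. slope k = r} = {j \<in> sloped. r \<le> slope j} - {j \<in> sloped. r < slope j}" by auto
      also have "\<dots> = {1..m} - {1..n}" by (simp only: n m)
      also have "\<dots> = {Suc n..m}" by auto
      finally show ?thesis .
    qed
    define c where "c = Re (angles.step r - p) + r * Im (angles.step r - p)"
    have neg: "\<eta> k < 0 \<longleftrightarrow> c < 0" if "k \<in> {Suc n..m}" for k
    proof -
      have "k \<in> {k \<in> sloped. slope k = r}" using that unfolding G .
      then have "c = pi * \<eta> k" unfolding c_def by (intro \<eta>_eq[OF _ _ n]) auto
      then show ?thesis by (simp add: mult_less_0_iff)
    qed
    have "(\<Sum>k\<in>{k \<in> sloped. slope k = r}. edge_sign (vertex k) (b k) y * of_bool (\<eta> k < 0)) =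
        (\<Sum>k\<in>{Suc n..m}. (h (k - 1) - h k) * of_bool (c < 0))"
      unfolding G using neg sign by (intro sum.cong refl) auto
    also have "\<dots> = (\<Sum>k\<in>{Suc n..m}. h (k - 1) - h k) * of_bool (c < 0)"
      by (rule sum_distrib_right[symmetric])
    also have "(\<Sum>k\<in>{Suc n..m}. h (k - 1) - h k) = h n - h m"
      using nm(1) by (induction m rule: dec_induct) auto
    also have "(h n - h m) * of_bool (c < 0) = - fib.crossing r"
    proof -
      have lt: "0 < pi * (v - y) \<longleftrightarrow> y < v" for v by (simp add: zero_less_mult_iff)
      have "Im (angles.step r) - Im p = pi * (of_int (snd (vertex (Suc n))) - y)"
        "Im (angles.left_step r) - Im p = pi * (of_int (snd (vertex (Suc m))) - y)"
        using arg_cong[OF step[OF n], of Im] arg_cong[OF left[OF m], of Im] by simp_all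
      then have "Im p < Im (angles.step r) \<longleftrightarrow> y < of_int (snd (vertex (Suc n)))"
        "Im p < Im (angles.left_step r) \<longleftrightarrow> y < of_int (snd (vertex (Suc m)))"
        using lt by (metis diff_gt_0_iff_gt)+
      then have "Im p < Im (angles.step r) \<longleftrightarrow> h n = 0" "Im p < Im (angles.left_step r) \<longleftrightarrow> h m = 0"
        using snd_vertex_nonint[OF y, of "vertex (Suc n)"] snd_vertex_nonint[OF y, of "vertex (Suc m)"]
        by (auto simp: h_def)
      then show ?thesis unfolding fib.crossing_def c_def[symmetric] by (auto simp: h_def)
    qed
    finally show ?thesis .
  qed
  have "(\<Sum>k\<in>{1..N}. edge_crossing (vertex k) (b k) x y) =
      (\<Sum>k\<in>{1..N}. edge_sign (vertex k) (b k) y - edge_sign (vertex k) (b k) y * of_bool (\<eta> k < 0))"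
  proof (intro sum.cong refl)
    fix k assume k: "k \<in> {1..N}"
    show "edge_crossing (vertex k) (b k) x y = edge_sign (vertex k) (b k) y - edge_sign (vertex k) (b k) y * of_bool (\<eta> k < 0)"
    proof (cases "k \<in> sloped")
      case True
      then show ?thesis using off[OF True] by (auto simp: edge_crossing_def \<eta>_def)
    next
      case False
      then show ?thesis using k by (simp add: edge_crossing_def edge_sign_flat sloped_def)
    qed
  qed
  also have "\<dots> = - (\<Sum>k\<in>{1..N}. edge_sign (vertex k) (b k) y * of_bool (\<eta> k < 0))"
    by (simp only: sum_subtractf vertex_closed diff_0)
  also have "(\<Sum>k\<in>{1..N}. edge_sign (vertex k) (b k) y * of_bool (\<eta> k < 0)) =
      (\<Sum>k\<in>sloped. edge_sign (vertex k) (b k) y * of_bool (\<eta> k < 0))"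
    using sloped_subset by (intro sum.mono_neutral_right) (auto simp: sloped_def edge_sign_flat)
  also have "\<dots> = (\<Sum>r\<in>slope ` sloped. \<Sum>k\<in>{k \<in> sloped. slope k = r}. edge_sign (vertex k) (b k) y * of_bool (\<eta> k < 0))"
    by (rule sum.image_gen[OF sloped_subset(2)])
  also have "\<dots> = (\<Sum>r\<in>slope ` sloped. - fib.crossing r)"
    by (rule sum.cong[OF refl group])
  also have "- \<dots> = int (card F)" unfolding F fib.card_fibre by (simp add: sum_negf)
  finally show "int (card F) = (\<Sum>k\<in>{1..N}. edge_crossing (vertex k) (b k) x y)" by simp
qed

section \<open>The principal branch\<close>

text \<open>In the lower half plane the angles are the negatives of their mirror images. The factor
  \<open>sgn (Im t)\<close> does no harm on the real axis, because the angle sum vanishes on the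
  real points of the slit plane.\<close>

definition branch :: "complex \<Rightarrow> real \<times> real" where
  "branch t = (pi * of_int (fst base) + sgn (Im t) * Re (angles.angle_sum t), pi * of_int (snd base) + sgn (Im t) * Im (angles.angle_sum t))"

text \<open>Right of all slopes no angle contributes. Left of all slopes, which is possible only if
  every row has a slope, each angle is pi and the rows sum to zero.\<close>

lemma slit_plane_real:
  assumes "of_real x \<in> slit_plane N b"
  shows "x \<notin> slope ` sloped" "angles.angle_sum (of_real x) = 0"
proof -
  have x: "ereal x < beta (b N) \<or> beta (b 1) < ereal x"
    using assms by (auto simp: slit_plane_def not_le)
  have lt: "(\<forall>j\<in>sloped. slope j < x) \<or> (sloped = {1..N} \<and> (\<forall>j\<in>sloped. x < slope j))"
  proof (rule disjE[OF x])
    assume N: "ereal x < beta (b N)"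
    have "ereal x < beta (b j)" if "j \<in> {1..N}" for j
      using rows_sorted[of j N] that N by (auto intro: less_le_trans)
    moreover from this have "j \<in> sloped" if "j \<in> {1..N}" for j
      using beta_flat[of j] that by force
    then have "sloped = {1..N}" using sloped_subset(1) by blast
    ultimately show ?thesis using beta_slope by auto
  next
    assume 1: "beta (b 1) < ereal x"
    have "beta (b j) < ereal x" if "j \<in> {1..N}" for j
      using rows_sorted[of 1 j] that 1 by (auto intro: le_less_trans)
    then show ?thesis using beta_slope by (force simp: sloped_def)
  qed
  then show nB: "x \<notin> slope ` sloped" by auto
  have "(\<Sum>j\<in>{j \<in> sloped. x < slope j}. row j) = 0"
    using lt
  proof
    assume "\<forall>j\<in>sloped. slope j < x"
    then have "{j \<in> sloped. x < slope j} = {}" by force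
    then show ?thesis by (simp only: sum.empty)
  next
    assume *: "sloped = {1..N} \<and> (\<forall>j\<in>sloped. x < slope j)"
    then have "{j \<in> sloped. x < slope j} = {1..N}" by auto
    then show ?thesis
      using rows_sum_fst rows_sum_snd by (simp add: row_def complex_eq_iff flip: of_int_sum)
  qed
  then show "angles.angle_sum (of_real x) = 0"
    unfolding angles.angle_sum_of_real[OF nB] angles.step_def by simp
qed

lemma slit_plane_cases:
  assumes "t \<in> slit_plane N b"
  obtains "Im t \<noteq> 0" | x where "t = of_real x" "x \<notin> slope ` sloped" "angles.angle_sum t = 0"
proof (cases "Im t = 0")
  case True
  then have "t = of_real (Re t)" by (simp add: complex_eq_iff)
  then show thesis using that(2) slit_plane_real assms by metis
qed (use that in blast)

lemma slit_plane_avoids: "t \<in> slit_plane N b \<Longrightarrow> t \<notin> of_real ` slope ` sloped"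
  by (erule slit_plane_cases) auto

lemma continuous_on_branch: "continuous_on (slit_plane N b) branch"
  unfolding continuous_on_eq_continuous_within
proof
  fix t assume t: "t \<in> slit_plane N b"
  have A: "(angles.angle_sum \<longlongrightarrow> angles.angle_sum t) (at t within slit_plane N b)"
    using angles.isCont_angle_sum[OF slit_plane_avoids[OF t]] by (simp add: isCont_def tendsto_within_subset[where S = UNIV])
  show "continuous (at t within slit_plane N b) branch"
    using t
  proof (cases rule: slit_plane_cases)
    case 1
    then show ?thesis unfolding branch_def continuous_within
      by (intro tendsto_intros A tendsto_sgn) auto
  next
    case (2 x)
    have 0: "((\<lambda>u. sgn (Im u) * f (angles.angle_sum u)) \<longlongrightarrow> 0) (at t within slit_plane N b)"
      if "((f \<circ> angles.angle_sum) \<longlongrightarrow> 0) (at t within slit_plane N b)" for f :: "complex \<Rightarrow> real"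
      by (rule Lim_null_comparison[OF _ tendsto_norm_zero[OF that]]) (auto simp: abs_mult sgn_if intro!: always_eventually)
    have "((Re \<circ> angles.angle_sum) \<longlongrightarrow> 0) (at t within slit_plane N b)" "((Im \<circ> angles.angle_sum) \<longlongrightarrow> 0) (at t within slit_plane N b)"
      using tendsto_Re[OF A] tendsto_Im[OF A] 2(3) by (simp_all add: o_def)
    then have "((\<lambda>u. (pi * of_int (fst base) + sgn (Im u) * Re (angles.angle_sum u), pi * of_int (snd base) + sgn (Im u) * Im (angles.angle_sum u)))
        \<longlongrightarrow> (pi * of_int (fst base) + 0, pi * of_int (snd base) + 0)) (at t within slit_plane N b)"
      by (intro tendsto_Pair tendsto_add tendsto_const 0)
    then show ?thesis using 2(1) unfolding continuous_within branch_def by simp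
  qed
qed

lemma branch_at_infinity:
  assumes "beta (b N) \<noteq> -\<infinity>"
  shows "(branch \<longlongrightarrow> (pi * of_int (fst base), pi * of_int (snd base))) at_infinity"
proof -
  have "j \<in> sloped" if "j \<in> {1..N}" for j
  proof (rule ccontr)
    assume "j \<notin> sloped"
    then have "beta (b j) = -\<infinity>" using beta_flat[of j] that by simp
    moreover have "beta (b N) \<le> beta (b j)" using rows_sorted[of j N] that by simp
    ultimately show False using assms by simp
  qed
  then have "sloped = {1..N}" using sloped_subset(1) by blast
  then have "(\<Sum>j\<in>sloped. row j) = 0"
    using rows_sum_fst rows_sum_snd by (simp add: row_def complex_eq_iff flip: of_int_sum)
  then have A: "(angles.angle_sum \<longlongrightarrow> 0) at_infinity" by (rule angles.angle_sum_at_infinity)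
  have 0: "((\<lambda>u. sgn (Im u) * f (angles.angle_sum u)) \<longlongrightarrow> 0) at_infinity"
    if "((f \<circ> angles.angle_sum) \<longlongrightarrow> 0) at_infinity" for f :: "complex \<Rightarrow> real"
    by (rule Lim_null_comparison[OF _ tendsto_norm_zero[OF that]]) (auto simp: abs_mult sgn_if intro!: always_eventually)
  have "((Re \<circ> angles.angle_sum) \<longlongrightarrow> 0) at_infinity" "((Im \<circ> angles.angle_sum) \<longlongrightarrow> 0) at_infinity"
    using tendsto_Re[OF A] tendsto_Im[OF A] by (simp_all add: o_def)
  then have "((\<lambda>u. (pi * of_int (fst base) + sgn (Im u) * Re (angles.angle_sum u), pi * of_int (snd base) + sgn (Im u) * Im (angles.angle_sum u)))
      \<longlongrightarrow> (pi * of_int (fst base) + 0, pi * of_int (snd base) + 0)) at_infinity"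
    by (intro tendsto_Pair tendsto_add tendsto_const 0)
  then show ?thesis unfolding branch_def by simp
qed

text \<open>A sloped row has linear factor \<open>snd (b j)\<close> times the displacement of t from
  its slope. The sign of the real coefficient accounts for the term pi of a downward row.\<close>

lemma linear_factor_is_Arg:
  assumes t: "t \<in> slit_plane N b" and j: "j \<in> {1..N}"
  shows "linear_factor (b j) t \<noteq> 0"
    and "is_Arg (linear_factor (b j) t)
      (pi * of_bool (downward j) + (if Im t < 0 then -1 else 1) * (if j \<in> sloped then line_angle (slope j) t else 0))"
proof -
  define s :: real where "s = (if Im t < 0 then -1 else 1)"
  define q where "q = (if downward j then - 1 else 1 :: real)"
  have exq: "exp (\<i> * of_real (pi * of_bool (downward j))) = of_real q"
    by (simp add: q_def exp_eq_polar cis.ctr complex_eq_iff)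
  have "linear_factor (b j) t \<noteq> 0 \<and> is_Arg (linear_factor (b j) t)
      (pi * of_bool (downward j) + s * (if j \<in> sloped then line_angle (slope j) t else 0))"
  proof (cases "j \<in> sloped")
    case True
    define \<alpha> where "\<alpha> = line_angle (slope j) t"
    define z where "z = t - of_real (slope j)"
    have z0: "z \<noteq> 0" using slit_plane_avoids[OF t] True by (auto simp: z_def)
    have z: "z = of_real (cmod z) * exp (\<i> * of_real (s * \<alpha>))"
    proof (cases "Im t < 0")
      case False
      then show ?thesis using cis_line_angle[of t "slope j"] by (simp add: z_def \<alpha>_def s_def cis_conv_exp)
    next
      case True
      then have "cnj z = of_real (cmod (cnj z)) * cis \<alpha>"
        using cis_line_angle[of "cnj t" "slope j"] by (simp add: z_def \<alpha>_def line_angle_cnj)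
      then have "cnj (cnj z) = cnj (of_real (cmod (cnj z)) * cis \<alpha>)" by (rule arg_cong)
      then show ?thesis using True by (simp add: s_def cis_conv_exp exp_cnj)
    qed
    have s2: "snd (b j) \<noteq> 0" using True by (simp add: sloped_def)
    then have lf: "linear_factor (b j) t = of_real (of_int (snd (b j))) * z"
      by (simp add: linear_factor_def z_def slope_def field_simps)
    have sn: "real_of_int (snd (b j)) = \<bar>of_int (snd (b j))\<bar> * q"
      using s2 by (auto simp: q_def downward_def)
    have "linear_factor (b j) t = of_real (cmod (linear_factor (b j) t)) * exp (\<i> * of_real (pi * of_bool (downward j) + s * \<alpha>))"
    proof -
      have "linear_factor (b j) t = of_real (\<bar>of_int (snd (b j))\<bar> * q) * (of_real (cmod z) * exp (\<i> * of_real (s * \<alpha>)))"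
        unfolding lf using z sn by metis
      also have "\<dots> = of_real (cmod (linear_factor (b j) t)) * (of_real q * exp (\<i> * of_real (s * \<alpha>)))"
        unfolding lf by (simp add: norm_mult)
      finally show ?thesis unfolding exq[symmetric] by (simp add: distrib_left exp_add)
    qed
    then show ?thesis using True z0 s2 unfolding lf by (simp add: is_Arg_def \<alpha>_def lf)
  next
    case False
    then have f: "snd (b j) = 0" "fst (b j) \<noteq> 0"
      using j rows_nonzero[OF j] by (auto simp: sloped_def prod_eq_iff)
    then have lf: "linear_factor (b j) t = of_real (of_int (fst (b j)))" by (simp add: linear_factor_def)
    have "real_of_int (fst (b j)) = \<bar>of_int (fst (b j))\<bar> * q" using f by (auto simp: q_def downward_def)
    then have "linear_factor (b j) t = of_real (cmod (linear_factor (b j) t)) * of_real q"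
      unfolding lf by (metis norm_of_real of_real_mult)
    then show ?thesis using False f unfolding exq[symmetric] by (simp add: is_Arg_def lf)
  qed
  then show "linear_factor (b j) t \<noteq> 0"
    and "is_Arg (linear_factor (b j) t)
      (pi * of_bool (downward j) + (if Im t < 0 then -1 else 1) * (if j \<in> sloped then line_angle (slope j) t else 0))"
    unfolding s_def by auto
qed

lemma branch_is_Arg:
  assumes t: "t \<in> slit_plane N b"
  shows "is_Arg (fst (horn_kapranov N b t)) (fst (branch t))" "is_Arg (snd (horn_kapranov N b t)) (snd (branch t))"
    and "fst (horn_kapranov N b t) \<noteq> 0" "snd (horn_kapranov N b t) \<noteq> 0"
proof -
  define s :: real where "s = (if Im t < 0 then -1 else 1)"
  define \<alpha> where "\<alpha> j = (if j \<in> sloped then line_angle (slope j) t else 0)" for j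
  have sgn_s: "sgn (Im t) * Re (angles.angle_sum t) = s * Re (angles.angle_sum t)" "sgn (Im t) * Im (angles.angle_sum t) = s * Im (angles.angle_sum t)"
    using t by (cases rule: slit_plane_cases; auto simp: s_def sgn_if)+
  have main: "is_Arg (\<Prod>j=1..N. linear_factor (b j) t powi c (b j)) (pi * of_int (c base) + s * (\<Sum>j\<in>{1..N}. \<alpha> j * of_int (c (b j))))"
    if c: "c = fst \<or> c = snd" for c
  proof -
    have "is_Arg (\<Prod>j=1..N. linear_factor (b j) t powi c (b j))
        (\<Sum>j=1..N. of_int (c (b j)) * (pi * of_bool (downward j) + s * \<alpha> j))"
      unfolding s_def \<alpha>_def by (intro is_Arg_prod is_Arg_power_int linear_factor_is_Arg t)
    also have "(\<Sum>j=1..N. of_int (c (b j)) * (pi * of_bool (downward j) + s * \<alpha> j)) =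
        pi * of_int (c apex) + s * (\<Sum>j\<in>{1..N}. \<alpha> j * of_int (c (b j)))"
    proof -
      have "c apex = (\<Sum>j\<in>{j \<in> {1..N}. downward j}. c (b j))"
        using c by (auto simp: apex_def fst_sum snd_sum)
      also have "\<dots> = (\<Sum>j\<in>{1..N}. if downward j then c (b j) else 0)"
        by (rule sum.inter_filter) simp
      also have "\<dots> = (\<Sum>j\<in>{1..N}. c (b j) * of_bool (downward j))" by (intro sum.cong) auto
      finally have "real_of_int (c apex) = (\<Sum>j\<in>{1..N}. of_int (c (b j)) * of_bool (downward j))"
        by (simp only: of_int_sum of_int_mult of_int_of_bool)
      then have "pi * of_int (c apex) = (\<Sum>j\<in>{1..N}. pi * (of_int (c (b j)) * of_bool (downward j)))"
        by (simp only: sum_distrib_left)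
      then show ?thesis
        by (simp add: distrib_left sum.distrib sum_distrib_left mult_ac)
    qed
    \<comment> \<open>The apex differs from the base by an even vector, which changes the argument
      by a multiple of 2 pi.\<close>
    also have "pi * of_int (c apex) + s * (\<Sum>j\<in>{1..N}. \<alpha> j * of_int (c (b j))) =
      (pi * of_int (c base) + s * (\<Sum>j\<in>{1..N}. \<alpha> j * of_int (c (b j)))) + of_int ((c apex - c base) div 2) * (2 * pi)"
    proof -
      have "even (c apex - c base)" using even_apex_base c by (auto simp: even_vector_def)
      then have "real_of_int (c apex - c base) = 2 * of_int ((c apex - c base) div 2)"
        by (metis dvd_mult_div_cancel of_int_mult of_int_numeral)
      then have "real_of_int (c apex) = of_int (c base) + 2 * of_int ((c apex - c base) div 2)" by simp
      then show ?thesis by (simp only:) (simp add: algebra_simps)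
    qed
    finally show ?thesis unfolding is_Arg_2pi_iff .
  qed
  have "(\<Sum>j\<in>{1..N}. \<alpha> j * g j) = (\<Sum>j\<in>sloped. line_angle (slope j) t * g j)" for g
    using sloped_def by (intro sum.mono_neutral_cong_right) (auto simp: \<alpha>_def)
  then have A: "(\<Sum>j\<in>{1..N}. \<alpha> j * of_int (fst (b j))) = Re (angles.angle_sum t)"
    "(\<Sum>j\<in>{1..N}. \<alpha> j * of_int (snd (b j))) = Im (angles.angle_sum t)"
    by (simp_all add: angles.angle_sum_def row_def)
  show "is_Arg (fst (horn_kapranov N b t)) (fst (branch t))" "is_Arg (snd (horn_kapranov N b t)) (snd (branch t))"
    using main[of fst] main[of snd] unfolding horn_kapranov_def branch_def fst_conv snd_conv A sgn_s by blast+
  show "fst (horn_kapranov N b t) \<noteq> 0" "snd (horn_kapranov N b t) \<noteq> 0"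
    using linear_factor_is_Arg(1)[OF t] by (auto simp: horn_kapranov_def power_int_eq_0_iff)
qed

lemma base_cases: "fst base = 0 \<or> fst base = 1" "snd base = 0 \<or> snd base = 1"
  by (auto simp: base_def)

lemma branch_is_principal: "is_principal_branch N b branch"
proof -
  have "branch (of_real x) \<in> {(0, 0), (0, pi), (pi, 0), (pi, pi)}" for x :: real
    using base_cases by (auto simp: branch_def)
  then show ?thesis unfolding is_principal_branch_def
    using continuous_on_branch branch_at_infinity branch_is_Arg by blast
qed

text \<open>An open half plane with one point of the normalized ray attached is connected, so two
  branches differ there by a constant multiple of 2 pi. On the ray each component of the difference
  is 0 or plus or minus pi, hence 0.\<close>

lemma principal_branch_unique:
  assumes f: "is_principal_branch N b f" and t: "Im t \<noteq> 0"
  shows "f t = branch t"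
proof -
  define \<epsilon> :: real where "\<epsilon> = sgn (Im t)"
  have \<epsilon>: "\<epsilon> = 1 \<or> \<epsilon> = -1" using t by (auto simp: \<epsilon>_def sgn_if)
  obtain x0 :: real where x0: "beta (b 1) < ereal x0"
  proof -
    have "beta (b 1) \<noteq> \<infinity>" by (simp add: beta_def)
    then show thesis using less_PInf_Ex_of_nat that by blast
  qed
  define T where "T = insert (of_real x0) {u. 0 < \<epsilon> * Im u}"
  have tT: "t \<in> T" using t by (auto simp: T_def \<epsilon>_def sgn_if)
  have sub: "T \<subseteq> slit_plane N b"
  proof
    fix u assume "u \<in> T"
    then show "u \<in> slit_plane N b" using x0 by (auto simp: T_def slit_plane_def)
  qed
  have "starlike T" unfolding starlike_def
  proof (intro bexI[of _ "of_real \<epsilon> * \<i>"] ballI subsetI)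
    fix x u assume x: "x \<in> T" and "u \<in> closed_segment (of_real \<epsilon> * \<i>) x"
    then obtain v where v: "0 \<le> v" "v \<le> 1" "u = (1 - v) *\<^sub>R (of_real \<epsilon> * \<i>) + v *\<^sub>R x"
      by (auto simp: closed_segment_def)
    have im: "0 \<le> \<epsilon> * Im x" using x by (auto simp: T_def)
    show "u \<in> T"
    proof (cases "v = 1")
      case False
      have "Im u = (1 - v) * \<epsilon> + v * Im x" using v(3) by simp
      then have "\<epsilon> * Im u = (1 - v) + v * (\<epsilon> * Im x)" using \<epsilon> by auto
      then have "0 < \<epsilon> * Im u" using v False im by (simp add: add_pos_nonneg)
      then show ?thesis by (simp add: T_def)
    qed (use v x in simp)
  qed (use \<epsilon> in \<open>auto simp: T_def\<close>)
  then have conn: "connected T" by (rule starlike_imp_connected)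
  have cont_f: "continuous_on T f" and arg_f: "\<And>u. u \<in> slit_plane N b \<Longrightarrow>
      is_Arg (fst (horn_kapranov N b u)) (fst (f u)) \<and> is_Arg (snd (horn_kapranov N b u)) (snd (f u))"
    and fx0: "f (of_real x0) \<in> {(0, 0), (0, pi), (pi, 0), (pi, pi)}"
    using f x0 continuous_on_subset[OF _ sub] unfolding is_principal_branch_def by blast+
  have cont_b: "continuous_on T branch" using continuous_on_branch sub by (rule continuous_on_subset)
  have x0T: "of_real x0 \<in> T" by (simp add: T_def)
  have zero: "r = 0" if "exp (\<i> * of_real r) = 1" "r \<in> {0, pi, - pi}" for r :: real
    using that by (auto simp: exp_eq_polar cis.ctr complex_eq_iff)
  have "c (f t) = c (branch t)" if c: "c = fst \<or> c = snd" for c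
  proof -
    have ex: "exp (\<i> * of_real (c (f u) - c (branch u))) = 1" if "u \<in> T" for u
      using c arg_f[of u] branch_is_Arg[of u] that sub is_Arg_diff_exp by auto
    have "\<i> * of_real (c (f t) - c (branch t)) = \<i> * of_real (c (f (of_real x0)) - c (branch (of_real x0)))"
    proof (rule continuous_exp_const_imp_const[OF conn _ ex tT x0T])
      have "continuous_on T (\<lambda>u. c (f u))" "continuous_on T (\<lambda>u. c (branch u))"
        using c cont_f cont_b by (auto intro: continuous_on_fst continuous_on_snd)
      then show "continuous_on T (\<lambda>u. \<i> * of_real (c (f u) - c (branch u)))"
        by (intro continuous_intros)
    qed
    moreover have "c (f (of_real x0)) - c (branch (of_real x0)) = 0"
    proof (rule zero[OF ex[OF x0T]])
      show "c (f (of_real x0)) - c (branch (of_real x0)) \<in> {0, pi, - pi}"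
        using c fx0 base_cases by (auto simp: branch_def)
    qed
    ultimately show ?thesis by simp
  qed
  then show ?thesis by (simp add: prod_eq_iff)
qed

lemma principal_branch_eq: "Im t \<noteq> 0 \<Longrightarrow> principal_branch N b t = branch t"
  unfolding principal_branch_def
  by (rule principal_branch_unique[OF someI[of "is_principal_branch N b", OF branch_is_principal]])

lemma upper_fibre:
  "{t. Im t > 0 \<and> principal_branch N b t = (pi * x, pi * y)} =
    {t. 0 < Im t \<and> angles.angle_sum t = angle_target x y}"
  by (auto simp: principal_branch_eq branch_def angle_target_def complex_eq_iff right_diff_distrib)

text \<open>Complex conjugation of t acts on the values of the branch as the point reflection about
  pi times the base.\<close>

lemma lower_fibre:
  "{t. Im t < 0 \<and> principal_branch N b t = (pi * x, pi * y)} =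
    cnj ` {t. 0 < Im t \<and> angles.angle_sum t = angle_target (2 * of_int (fst base) - x) (2 * of_int (snd base) - y)}" (is "?L = cnj ` ?R")
proof -
  have "t \<in> ?L \<longleftrightarrow> cnj t \<in> ?R" for t
    by (auto simp: principal_branch_eq branch_def angle_target_def complex_eq_iff right_diff_distrib angles.angle_sum_cnj)
  then have "?L = cnj -` ?R" by blast
  also have "\<dots> = cnj ` ?R"
  proof (intro equalityI subsetI)
    fix t assume "t \<in> cnj -` ?R"
    then show "t \<in> cnj ` ?R" by (intro image_eqI[of t cnj "cnj t"]) auto
  qed auto
  finally show ?thesis .
qed

section \<open>The multiplicity at generic points\<close>

text \<open>These are critical values in the plane of arguments: those of the upper half plane and
  their point reflections, which come from the lower one.\<close>

definition critical_points :: "(real \<times> real) set" where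
  "critical_points = (\<Union>t\<in>{t. 0 < Im t \<and> angles.slope_sum t = 0}.
     {(pi * of_int (fst base) + Re (angles.angle_sum t), pi * of_int (snd base) + Im (angles.angle_sum t)),
      (pi * of_int (fst base) - Re (angles.angle_sum t), pi * of_int (snd base) - Im (angles.angle_sum t))})"

lemma finite_critical_points: "finite critical_points"
proof -
  have "critical_points = (\<Union>z\<in>angles.angle_sum ` {t. 0 < Im t \<and> angles.slope_sum t = 0}.
     {(pi * of_int (fst base) + Re z, pi * of_int (snd base) + Im z),
      (pi * of_int (fst base) - Re z, pi * of_int (snd base) - Im z)})"
    by (simp add: critical_points_def)
  also have "finite \<dots>" by (intro finite_UN_I angles.finite_critical_values) auto
  finally show ?thesis .
qed

text \<open>In units of pi, the middle condition excludes every line through an integral point in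
  the direction of a sloped row. These lines contain all sloped edges of the polygon and the
  zonotope, their point reflections and all lattice translates.\<close>

definition generic :: "real \<Rightarrow> real \<Rightarrow> bool" where
  "generic x y \<longleftrightarrow> y \<notin> \<int> \<and>
     (\<forall>k\<in>sloped. \<forall>i j::int. (x - of_int i) * of_int (snd (b k)) \<noteq> (y - of_int j) * of_int (fst (b k))) \<and>
     torus_proj (pi * x, pi * y) \<notin> torus_proj ` critical_points"

lemma generic_not_Ints: "generic x y \<Longrightarrow> y \<notin> \<int>"
  by (simp add: generic_def)

lemma generic_shift:
  assumes "generic x y"
  shows "generic (x + 2 * of_int m) (y + 2 * of_int n)"
proof -
  have "(x + 2 * of_int m - of_int i) * of_int (snd (b k)) \<noteq> (y + 2 * of_int n - of_int j) * of_int (fst (b k))"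
    if "k \<in> sloped" for k i j
  proof -
    have "(x - of_int (i - 2 * m)) * of_int (snd (b k)) \<noteq> (y - of_int (j - 2 * n)) * of_int (fst (b k))"
      using assms that unfolding generic_def by blast
    then show ?thesis by (simp add: algebra_simps)
  qed
  then show ?thesis
    using assms not_Ints_add_even[of y n] unfolding generic_def torus_proj_shift by blast
qed

lemma generic_edge_x:
  assumes "generic x y" "snd u \<noteq> 0" and u: "u = b k \<or> u = - b k" "k \<in> {1..N}"
  shows "(edge_x v u (y + 2 * of_int n) - x) / 2 \<notin> \<int>"
proof
  assume "(edge_x v u (y + 2 * of_int n) - x) / 2 \<in> \<int>"
  then obtain m where "(edge_x v u (y + 2 * of_int n) - x) / 2 = of_int m" by (auto simp: Ints_def)
  then have x: "x = edge_x v u (y + 2 * of_int n) - 2 * of_int m" by simp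
  have k: "k \<in> sloped" using u assms(2) by (auto simp: sloped_def)
  have s: "real_of_int (snd (b k)) \<noteq> 0" using k by (simp add: sloped_def)
  have r: "of_int (fst u) / of_int (snd u) = (of_int (fst (b k)) / of_int (snd (b k)) :: real)" using u by auto
  have "x = of_int (fst v - 2 * m) + (y - of_int (snd v - 2 * n)) * (of_int (fst (b k)) / of_int (snd (b k)))"
    unfolding x edge_x_def times_divide_eq_right[symmetric] r by simp
  then have "(x - of_int (fst v - 2 * m)) * of_int (snd (b k)) = (y - of_int (snd v - 2 * n)) * of_int (fst (b k))"
    using s by simp
  then show False using assms(1) k unfolding generic_def by blast
qed

lemma generic_edge_x_neq:
  assumes "generic x y" "snd u \<noteq> 0" "u = b k \<or> u = - b k" "k \<in> {1..N}"
  shows "edge_x v u y \<noteq> x"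
  using generic_edge_x[OF assms, of v 0] by auto

lemma generic_uminus_lines:
  assumes "generic x y" "k \<in> {1..N}" "snd (b k) \<noteq> 0"
  shows "(edge_x v (b k) (- y + 2 * of_int n) - (- x)) / 2 \<notin> \<int>"
proof
  assume "(edge_x v (b k) (- y + 2 * of_int n) - (- x)) / 2 \<in> \<int>"
  moreover have "- y + 2 * of_int n = - (y + 2 * of_int (- n))" by simp
  ultimately have "(- edge_x (- v - b k) (b k) (y + 2 * of_int (- n)) - (- x)) / 2 \<in> \<int>"
    using edge_x_uminus[OF assms(3)] by metis
  then have "- ((- edge_x (- v - b k) (b k) (y + 2 * of_int (- n)) - (- x)) / 2) \<in> \<int>" by (rule Ints_minus)
  moreover have "- ((- e - (- x)) / 2) = (e - x) / 2" for e :: real by (simp add: field_simps)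
  ultimately have "(edge_x (- v - b k) (b k) (y + 2 * of_int (- n)) - x) / 2 \<in> \<int>" by (simp only:)
  then show False using generic_edge_x[OF assms(1,3) _ assms(2)] by blast
qed

definition coamoeba_crossings :: "real \<Rightarrow> real \<Rightarrow> int" where
  "coamoeba_crossings x y = (\<Sum>k\<in>{1..N}. edge_crossing (vertex k) (b k) x y)"

lemma upper_chain_eq:
  assumes "generic x y"
  shows "finite {t. Im t > 0 \<and> principal_branch N b t = (pi * x, pi * y)}"
    "upper_chain N b (pi * x, pi * y) = coamoeba_crossings x y"
proof -
  have nc: "angles.slope_sum t \<noteq> 0"
    if t: "0 < Im t" "angles.angle_sum t = angle_target x y" for t
  proof
    assume "angles.slope_sum t = 0"
    then have "(pi * of_int (fst base) + Re (angles.angle_sum t), pi * of_int (snd base) + Im (angles.angle_sum t)) \<in> critical_points"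
      using t(1) unfolding critical_points_def by blast
    then have "(pi * x, pi * y) \<in> critical_points" unfolding t(2) angle_target_def by (simp add: algebra_simps)
    then show False using assms unfolding generic_def by blast
  qed
  have off: "edge_x (vertex k) (b k) y \<noteq> x" if "k \<in> sloped" for k
    using generic_edge_x_neq[OF assms, of "b k" k] that by (simp add: sloped_def)
  note card = fibre_card[OF generic_not_Ints[OF assms] off nc]
  show "finite {t. Im t > 0 \<and> principal_branch N b t = (pi * x, pi * y)}"
    unfolding upper_fibre by (rule card(1))
  show "upper_chain N b (pi * x, pi * y) = coamoeba_crossings x y"
    unfolding upper_chain_def upper_fibre coamoeba_crossings_def by (rule card(2))
qed

lemma lower_chain_eq:
  assumes "generic x y"
  shows "finite {t. Im t < 0 \<and> principal_branch N b t = (pi * x, pi * y)}"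
    "lower_chain N b (pi * x, pi * y) =
      coamoeba_crossings (- x + 2 * of_int (fst base)) (- y + 2 * of_int (snd base))"
proof -
  define x' y' where "x' = - x + 2 * of_int (fst base)" and "y' = - y + 2 * of_int (snd base)"
  have y': "y' \<notin> \<int>" unfolding y'_def
    using generic_not_Ints[OF assms] by (intro not_Ints_add_even) (metis Ints_minus minus_minus)
  have nc: "angles.slope_sum t \<noteq> 0"
    if t: "0 < Im t" "angles.angle_sum t = angle_target x' y'" for t
  proof
    assume "angles.slope_sum t = 0"
    then have "(pi * of_int (fst base) - Re (angles.angle_sum t), pi * of_int (snd base) - Im (angles.angle_sum t)) \<in> critical_points"
      using t(1) unfolding critical_points_def by blast
    then have "(pi * x, pi * y) \<in> critical_points" unfolding t(2) angle_target_def by (simp add: algebra_simps x'_def y'_def)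
    then show False using assms unfolding generic_def by blast
  qed
  have off: "edge_x (vertex k) (b k) y' \<noteq> x'" if "k \<in> sloped" for k
  proof
    assume "edge_x (vertex k) (b k) y' = x'"
    then have "(edge_x (vertex k) (b k) y' - (- x)) / 2 = of_int (fst base)" by (simp add: x'_def)
    then have "(edge_x (vertex k) (b k) y' - (- x)) / 2 \<in> \<int>" by (simp only: Ints_of_int)
    then show False
      using generic_uminus_lines[OF assms, of k] that unfolding y'_def by (auto simp: sloped_def)
  qed
  note card = fibre_card[OF y' off nc]
  have set: "{t. Im t < 0 \<and> principal_branch N b t = (pi * x, pi * y)} =
    cnj ` {t. 0 < Im t \<and> angles.angle_sum t = angle_target x' y'}"
    unfolding lower_fibre x'_def y'_def by simp
  show "finite {t. Im t < 0 \<and> principal_branch N b t = (pi * x, pi * y)}"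
    unfolding set by (intro finite_imageI card(1))
  have "inj_on cnj S" for S by (simp add: inj_on_def)
  then show "lower_chain N b (pi * x, pi * y) =
      coamoeba_crossings (- x + 2 * of_int (fst base)) (- y + 2 * of_int (snd base))"
    using card(2) unfolding lower_chain_def set coamoeba_crossings_def x'_def y'_def by (simp add: card_image)
qed

lemma zonotope_chain_eq:
  assumes "generic x y"
  shows "zonotope_chain N b (pi * x, pi * y) =
    (\<Sum>k\<in>{1..N}. edge_crossing (right_vertex k) (upward k) x y - edge_crossing (left_vertex k) (upward k) x y)"
  unfolding zonotope_chain_def
proof (rule zonotope_crossings[OF generic_not_Ints[OF assms]])
  fix k assume "k \<in> {1..N}" "snd (upward k) \<noteq> 0"
  then show "edge_x (left_vertex k) (upward k) y \<noteq> x \<and> edge_x (right_vertex k) (upward k) y \<noteq> x"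
    using generic_edge_x_neq[OF assms _ upward_cases] by blast
qed

lemma coamoeba_lattice_sum:
  assumes x: "\<And>k n. \<lbrakk>k \<in> {1..N}; snd (b k) \<noteq> 0\<rbrakk> \<Longrightarrow> (edge_x (vertex k) (b k) (y + 2 * of_int n) - x) / 2 \<notin> \<int>"
  defines "W \<equiv> \<lambda>m n. coamoeba_crossings (x + 2 * of_int m) (y + 2 * of_int n)"
  shows "finite {(m, n). W m n \<noteq> 0}"
    "of_int (\<Sum>(m, n)\<in>{(m, n). W m n \<noteq> 0}. W m n) =
      (\<Sum>k\<in>{1..N}. edge_weight (vertex k) (b k) x y)"
  using lattice_sum_of_crossings[where I = "{1..N}" and \<sigma> = "\<lambda>_. 1" and a = vertex and b = b and x = x and y = y]
    x vertex_closed
  by (simp_all add: W_def coamoeba_crossings_def del: One_nat_def)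

text \<open>Both boundary paths run from the common bottom vertex to the common top vertex, so their
  telescoped signs agree.\<close>

lemma zonotope_closed:
  "(\<Sum>(k, r)\<in>{1..N} \<times> {True, False}. (if r then 1 else -1) *
     edge_sign (if r then right_vertex k else left_vertex k) (upward k) y) = 0"
proof -
  define h :: "int \<times> int \<Rightarrow> int" where "h v = of_bool (of_int (snd v) < y)" for v
  have sg: "edge_sign v u y = h v - h (v + u)" for v u by (simp add: edge_sign_def h_def)
  have l: "left_vertex k + upward k = left_vertex (Suc k)" if "k \<in> {1..N}" for k
    using that by (simp add: left_vertex_def add.assoc)
  have r: "right_vertex k + upward k = right_vertex (k - 1)" if "k \<in> {1..N}" for k
  proof -
    have "{k - 1<..N} = insert k {k<..N}" using that by auto
    then show ?thesis by (simp add: right_vertex_def add.assoc add.commute)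
  qed
  have tel': "(\<Sum>k\<in>{Suc 0..M}. g k - g (Suc k)) = g (Suc 0) - g (Suc M)" for g :: "nat \<Rightarrow> int" and M
    by (induction M) auto
  have "(\<Sum>k\<in>{1..N}. edge_sign (left_vertex k) (upward k) y) = (\<Sum>k\<in>{Suc 0..N}. h (left_vertex k) - h (left_vertex (Suc k)))"
    using l by (intro sum.cong) (auto simp: sg)
  also have "\<dots> = h (left_vertex (Suc 0)) - h (left_vertex (Suc N))" by (rule tel')
  finally have L: "(\<Sum>k\<in>{1..N}. edge_sign (left_vertex k) (upward k) y) = h (left_vertex (Suc 0)) - h (left_vertex (Suc N))" .
  have tel: "(\<Sum>k\<in>{Suc 0..M}. g k - g (k - 1)) = g M - g 0" for g :: "nat \<Rightarrow> int" and M
    by (induction M) auto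
  have "(\<Sum>k\<in>{1..N}. edge_sign (right_vertex k) (upward k) y) = (\<Sum>k\<in>{Suc 0..N}. h (right_vertex k) - h (right_vertex (k - 1)))"
    using r by (intro sum.cong) (auto simp: sg)
  also have "\<dots> = h (right_vertex N) - h (right_vertex 0)" by (rule tel)
  finally have R: "(\<Sum>k\<in>{1..N}. edge_sign (right_vertex k) (upward k) y) = h (right_vertex N) - h (right_vertex 0)" .
  have "{0<..N} = {1..<Suc N}" by auto
  then have "left_vertex (Suc 0) = right_vertex N" "left_vertex (Suc N) = right_vertex 0"
    by (simp_all add: left_vertex_def right_vertex_def)
  then have "(\<Sum>k\<in>{1..N}. edge_sign (right_vertex k) (upward k) y - edge_sign (left_vertex k) (upward k) y) = 0"
    using L R by (simp add: sum_subtractf)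
  then show ?thesis by (simp add: sum.cartesian_product' del: One_nat_def)
qed

lemma zonotope_lattice_sum:
  assumes g: "generic x y"
  defines "W \<equiv> \<lambda>m n. zonotope_chain N b (pi * (x + 2 * of_int m), pi * (y + 2 * of_int n))"
  shows "finite {(m, n). W m n \<noteq> 0}"
    "of_int (\<Sum>(m, n)\<in>{(m, n). W m n \<noteq> 0}. W m n) =
      (\<Sum>k\<in>{1..N}. edge_weight (right_vertex k) (upward k) x y - edge_weight (left_vertex k) (upward k) x y)"
proof -
  define I where "I = {1..N} \<times> {True, False}"
  define \<sigma> where "\<sigma> = (\<lambda>(k::nat, r). if r then 1 else -1 :: int)"
  define a where "a = (\<lambda>(k, r). if r then right_vertex k else left_vertex k)"
  define u where "u = (\<lambda>(k, r::bool). upward k)"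
  have W: "W = (\<lambda>m n. \<Sum>i\<in>I. \<sigma> i * edge_crossing (a i) (u i) (x + 2 * of_int m) (y + 2 * of_int n))"
    unfolding W_def zonotope_chain_eq[OF generic_shift[OF g]]
    by (simp add: I_def \<sigma>_def a_def u_def sum.cartesian_product' del: One_nat_def)
  have closed: "(\<Sum>i\<in>I. \<sigma> i * edge_sign (a i) (u i) z) = 0" for z
    using zonotope_closed[of z] by (simp add: I_def \<sigma>_def a_def u_def case_prod_unfold)
  have off: "(edge_x (a i) (u i) (y + 2 * of_int n) - x) / 2 \<notin> \<int>" if "i \<in> I" "snd (u i) \<noteq> 0" for i n
  proof -
    have "u i = upward (fst i)" "fst i \<in> {1..N}" using that(1) by (auto simp: I_def u_def)
    then show ?thesis using generic_edge_x[OF g that(2), of "fst i"] upward_cases by auto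
  qed
  have "finite I" by (simp add: I_def)
  note sums = lattice_sum_of_crossings[OF this closed off, folded W]
  show "finite {(m, n). W m n \<noteq> 0}" using sums(1) unfolding W .
  have "of_int (\<Sum>(m, n)\<in>{(m, n). W m n \<noteq> 0}. W m n) =
      (\<Sum>i\<in>I. of_int (\<sigma> i) * edge_weight (a i) (u i) x y)"
    using sums(2) unfolding W .
  also have "\<dots> = (\<Sum>k\<in>{1..N}. edge_weight (right_vertex k) (upward k) x y - edge_weight (left_vertex k) (upward k) x y)"
    by (simp add: I_def \<sigma>_def a_def u_def sum.cartesian_product' del: One_nat_def)
  finally show "of_int (\<Sum>(m, n)\<in>{(m, n). W m n \<noteq> 0}. W m n) =
      (\<Sum>k\<in>{1..N}. edge_weight (right_vertex k) (upward k) x y - edge_weight (left_vertex k) (upward k) x y)" .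
qed

text \<open>The lattice sums for both half planes and the zonotope split into sawtooth and moment
  terms. The former cancel for each row, and the latter add up to \<open>total_moment y\<close>,
  already known to be the required constant.\<close>

lemma generic_multiplicity:
  assumes g: "generic x y"
  shows "of_int (coamoeba_chain N b (torus_proj (pi * x, pi * y)) + torus_zonotope_chain N b (torus_proj (pi * x, pi * y))) =
      1 / 2 * (\<Sum>(j, k)\<in>pairs. real_of_int (row_det_pos (b j) (b k)))"
    and "finite {t. Im t \<noteq> 0 \<and> torus_proj (principal_branch N b t) = torus_proj (pi * x, pi * y)}"
proof -
  define \<theta> where "\<theta> = torus_proj (pi * x, pi * y)"
  define U where "U m n = upper_chain N b (pi * (x + 2 * of_int m), pi * (y + 2 * of_int n))" for m n
  define L where "L m n = lower_chain N b (pi * (x + 2 * of_int m), pi * (y + 2 * of_int n))" for m n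
  define V where "V m n = coamoeba_crossings (- x + 2 * of_int m) (- y + 2 * of_int n)" for m n
  note gs = generic_shift[OF g]
  have U: "U = (\<lambda>m n. coamoeba_crossings (x + 2 * of_int m) (y + 2 * of_int n))"
    unfolding U_def upper_chain_eq(2)[OF gs] ..
  have LV: "L m n = V (fst base - m) (snd base - n)" for m n
  proof -
    have "- (x + 2 * of_int m) + 2 * of_int (fst base) = - x + 2 * of_int (fst base - m)"
      "- (y + 2 * of_int n) + 2 * of_int (snd base) = - y + 2 * of_int (snd base - n)" by simp_all
    then show ?thesis unfolding L_def lower_chain_eq(2)[OF gs] V_def by (simp only:)
  qed
  have U_sum: "finite {(m, n). U m n \<noteq> 0}"
    "of_int (\<Sum>(m, n)\<in>{(m, n). U m n \<noteq> 0}. U m n) =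
      (\<Sum>k\<in>{1..N}. edge_weight (vertex k) (b k) x y)"
    unfolding U using generic_edge_x[OF g] by (intro coamoeba_lattice_sum; blast)+
  have V_sum: "finite {(m, n). V m n \<noteq> 0}"
    "of_int (\<Sum>(m, n)\<in>{(m, n). V m n \<noteq> 0}. V m n) =
      (\<Sum>k\<in>{1..N}. edge_weight (vertex k) (b k) (- x) (- y))"
    unfolding V_def using generic_uminus_lines[OF g] by (intro coamoeba_lattice_sum; blast)+
  let ?r = "\<lambda>(m, n). (fst base - m, snd base - n)"
  have bij: "bij_betw ?r {(m, n). L m n \<noteq> 0} {(m, n). V m n \<noteq> 0}"
    by (rule bij_betw_byWitness[where f' = ?r]) (auto simp: LV)
  have L_fin: "finite {(m, n). L m n \<noteq> 0}" using bij_betw_finite[OF bij] V_sum(1) by simp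
  have L_sum: "(\<Sum>(m, n)\<in>{(m, n). L m n \<noteq> 0}. L m n) = (\<Sum>(m, n)\<in>{(m, n). V m n \<noteq> 0}. V m n)"
    using sum.reindex_bij_betw[OF bij, of "\<lambda>(m, n). V m n"] by (simp add: LV case_prod_unfold)
  have coamoeba: "coamoeba_chain N b \<theta> =
      (\<Sum>(m, n)\<in>{(m, n). U m n \<noteq> 0}. U m n) + (\<Sum>(m, n)\<in>{(m, n). L m n \<noteq> 0}. L m n)"
  proof -
    let ?S = "{(m, n). U m n \<noteq> 0} \<union> {(m, n). L m n \<noteq> 0}"
    have fin: "finite ?S" using U_sum(1) L_fin by simp
    have "coamoeba_chain N b \<theta> = (\<Sum>(m, n)\<in>{(m, n). U m n + L m n \<noteq> 0}. U m n + L m n)"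
      unfolding coamoeba_chain_def \<theta>_def
      by (rule pushforward_lattice) (simp add: principal_coamoeba_chain_def U_def L_def)
    also have "\<dots> = (\<Sum>(m, n)\<in>?S. U m n + L m n)"
      by (rule sum.mono_neutral_left[OF fin]) auto
    also have "\<dots> = (\<Sum>(m, n)\<in>?S. U m n) + (\<Sum>(m, n)\<in>?S. L m n)"
      by (simp add: sum.distrib case_prod_unfold)
    also have "(\<Sum>(m, n)\<in>?S. U m n) = (\<Sum>(m, n)\<in>{(m, n). U m n \<noteq> 0}. U m n)"
      by (rule sum.mono_neutral_right[OF fin]) auto
    also have "(\<Sum>(m, n)\<in>?S. L m n) = (\<Sum>(m, n)\<in>{(m, n). L m n \<noteq> 0}. L m n)"
      by (rule sum.mono_neutral_right[OF fin]) auto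
    finally show ?thesis .
  qed
  have zonotope: "torus_zonotope_chain N b \<theta> =
      (\<Sum>(m, n)\<in>{(m, n). zonotope_chain N b (pi * (x + 2 * of_int m), pi * (y + 2 * of_int n)) \<noteq> 0}.
        zonotope_chain N b (pi * (x + 2 * of_int m), pi * (y + 2 * of_int n)))"
    unfolding torus_zonotope_chain_def \<theta>_def by (rule pushforward_lattice) simp
  \<comment> \<open>Reflection turns the edge at \<open>vertex k\<close> into minus one at
    \<open>vertex k + b k\<close>, up to an even translation; then the four boundary edges cancel on
    the torus.\<close>
  have saw: "edge_saw (vertex k) (b k) x y + edge_saw (vertex k) (b k) (- x) (- y)
      + edge_saw (right_vertex k) (upward k) x y - edge_saw (left_vertex k) (upward k) x y = 0"
    if k: "k \<in> {1..N}" for k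
  proof -
    have "edge_saw (vertex k) (b k) (- x) (- y) = - edge_saw (- vertex k - b k) (b k) x y"
      using generic_edge_x[OF g] k by (intro edge_saw_uminus generic_not_Ints[OF g]) blast
    also have "edge_saw (- vertex k - b k) (b k) x y = edge_saw (vertex k + b k) (b k) x y"
      using edge_saw_translate[of "- vertex k - b k - (vertex k + b k)" "vertex k + b k"]
      by (simp add: even_vector_def)
    finally show ?thesis
      using boundary_cancels[OF k, of "\<lambda>a d. edge_saw a d x y"]
      by (simp add: edge_saw_translate edge_saw_reverse)
  qed
  have "of_int (coamoeba_chain N b \<theta> + torus_zonotope_chain N b \<theta>) =
    (\<Sum>k\<in>{1..N}. (edge_saw (vertex k) (b k) x y + edge_saw (vertex k) (b k) (- x) (- y)
      + edge_saw (right_vertex k) (upward k) x y - edge_saw (left_vertex k) (upward k) x y) + row_moment k y / 2)"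
    unfolding coamoeba zonotope of_int_add U_sum(2) L_sum V_sum(2) zonotope_lattice_sum(2)[OF g] sum.distrib[symmetric]
    by (intro sum.cong refl) (simp add: edge_weight_def row_moment_def field_simps)
  also have "\<dots> = total_moment y"
    unfolding total_moment_def sum_divide_distrib by (intro sum.cong refl) (simp add: saw)
  also have "\<dots> = 1 / 2 * (\<Sum>(j, k)\<in>pairs. real_of_int (row_det_pos (b j) (b k)))"
    by (rule total_moment_eq[OF generic_not_Ints[OF g]])
  finally show "of_int (coamoeba_chain N b (torus_proj (pi * x, pi * y)) + torus_zonotope_chain N b (torus_proj (pi * x, pi * y))) =
      1 / 2 * (\<Sum>(j, k)\<in>pairs. real_of_int (row_det_pos (b j) (b k)))" unfolding \<theta>_def .

  let ?fu = "\<lambda>(m::int, n::int). {t. Im t > 0 \<and> principal_branch N b t = (pi * (x + 2 * of_int m), pi * (y + 2 * of_int n))}"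
  let ?fl = "\<lambda>(m::int, n::int). {t. Im t < 0 \<and> principal_branch N b t = (pi * (x + 2 * of_int m), pi * (y + 2 * of_int n))}"
  have fu: "finite (?fu z)" and fl: "finite (?fl z)" for z
    using upper_chain_eq(1)[OF gs] lower_chain_eq(1)[OF gs] by (auto simp: case_prod_unfold)
  \<comment> \<open>Each preimage lies over some lattice translate. Its fibre in that half plane is
    finite and nonempty, so the chain is nonzero there, which happens for only finitely many
    translates.\<close>
  have "{t. Im t \<noteq> 0 \<and> torus_proj (principal_branch N b t) = \<theta>} \<subseteq>
      (\<Union>z\<in>{(m, n). U m n \<noteq> 0}. ?fu z) \<union> (\<Union>z\<in>{(m, n). L m n \<noteq> 0}. ?fl z)"
  proof
    fix t assume t: "t \<in> {t. Im t \<noteq> 0 \<and> torus_proj (principal_branch N b t) = \<theta>}"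
    then obtain m n where mn: "principal_branch N b t = (pi * (x + 2 * of_int m), pi * (y + 2 * of_int n))"
      using torus_proj_eqE unfolding \<theta>_def by blast
    show "t \<in> (\<Union>z\<in>{(m, n). U m n \<noteq> 0}. ?fu z) \<union> (\<Union>z\<in>{(m, n). L m n \<noteq> 0}. ?fl z)"
    proof (cases "Im t > 0")
      case True
      then have "t \<in> ?fu (m, n)" using mn by simp
      moreover from this have "U m n \<noteq> 0" using fu[of "(m, n)"] by (auto simp: U_def upper_chain_def)
      ultimately show ?thesis by blast
    next
      case False
      then have "t \<in> ?fl (m, n)" using mn t by simp
      moreover from this have "L m n \<noteq> 0" using fl[of "(m, n)"] by (auto simp: L_def lower_chain_def)
      ultimately show ?thesis by blast
    qed
  qed
  moreover have "finite ((\<Union>z\<in>{(m, n). U m n \<noteq> 0}. ?fu z) \<union> (\<Union>z\<in>{(m, n). L m n \<noteq> 0}. ?fl z))"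
    using U_sum(1) L_fin fu fl by (intro finite_UnI finite_UN_I) auto
  ultimately show "finite {t. Im t \<noteq> 0 \<and> torus_proj (principal_branch N b t) = torus_proj (pi * x, pi * y)}"
    unfolding \<theta>_def by (rule finite_subset)
qed

section \<open>The exceptional set on the torus and the conclusion\<close>

text \<open>A segment with displacement 2 pi \<open>b k\<close> closes up on the torus, so finitely
  many segments cover the projections of infinitely many parallel lines: it suffices to start at the
  four classes of integral points modulo 2. Critical values enter as degenerate segments.\<close>

definition exceptional_segments :: "((real \<times> real) \<times> (real \<times> real)) set" where
  "exceptional_segments =
     (\<lambda>p. (p, p)) ` critical_points \<union>
     (\<lambda>j. ((0, pi * of_int j), (2 * pi, pi * of_int j))) ` {0, 1::int} \<union>
     (\<lambda>(k, i, j). ((pi * of_int i, pi * of_int j),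
        (pi * (of_int i + 2 * of_int (fst (b k))), pi * (of_int j + 2 * of_int (snd (b k)))))) `
       (sloped \<times> {0, 1::int} \<times> {0, 1::int})"

lemma finite_exceptional_segments: "finite exceptional_segments"
  using finite_critical_points sloped_subset(2) by (simp add: exceptional_segments_def)

lemma off_exceptional_segments_generic:
  assumes "torus_proj (pi * x, pi * y) \<notin> torus_proj ` (\<Union>(a, c)\<in>exceptional_segments. closed_segment a c)"
  shows "generic x y"
proof -
  have off: False if "(a, c) \<in> exceptional_segments" "q \<in> closed_segment a c" "torus_proj (pi * x, pi * y) = torus_proj q" for a c q
    using assms that by blast
  have red: "torus_proj (pi * x, pi * y) = torus_proj (pi * x', pi * y')"
    if "x = x' + 2 * of_int m" "y = y' + 2 * of_int n" for x' y' m n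
    unfolding that by (rule torus_proj_shift)
  have crit: "torus_proj (pi * x, pi * y) \<notin> torus_proj ` critical_points"
  proof
    assume "torus_proj (pi * x, pi * y) \<in> torus_proj ` critical_points"
    then obtain q where "q \<in> critical_points" "torus_proj (pi * x, pi * y) = torus_proj q" by blast
    then show False by (intro off[of q q q]) (auto simp: exceptional_segments_def)
  qed
  have y: "y \<notin> \<int>"
  proof
    assume "y \<in> \<int>"
    then obtain l where l: "y = of_int l" by (auto simp: Ints_def)
    define x' where "x' = x - 2 * of_int \<lfloor>x / 2\<rfloor>"
    have x': "0 \<le> x'" "x' \<le> 2" unfolding x'_def by linarith+
    have ly: "y = of_int (l mod 2) + 2 * of_int (l div 2)" unfolding l
      by (metis add.commute mult_div_mod_eq of_int_add of_int_mult of_int_numeral)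
    show False
    proof (rule off)
      show "((0, pi * of_int (l mod 2)), (2 * pi, pi * of_int (l mod 2))) \<in> exceptional_segments"
        unfolding exceptional_segments_def by (cases "even l") (auto simp: even_iff_mod_2_eq_zero odd_iff_mod_2_eq_one)
      show "(pi * x', pi * of_int (l mod 2)) \<in> closed_segment (0, pi * of_int (l mod 2)) (2 * pi, pi * of_int (l mod 2))"
        unfolding closed_segment_def using x' by (auto intro!: exI[of _ "x' / 2"] simp: algebra_simps)
      show "torus_proj (pi * x, pi * y) = torus_proj (pi * x', pi * of_int (l mod 2))"
        by (rule red[where m = "\<lfloor>x / 2\<rfloor>", OF _ ly]) (simp add: x'_def)
    qed
  qed
  have "(x - of_int i) * of_int (snd (b k)) \<noteq> (y - of_int j) * of_int (fst (b k))" if k: "k \<in> sloped" for k i j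
  proof
    assume eq: "(x - of_int i) * of_int (snd (b k)) = (y - of_int j) * of_int (fst (b k))"
    have s0: "real_of_int (snd (b k)) \<noteq> 0" using k by (simp add: sloped_def)
    define s where "s = (y - of_int j) / of_int (snd (b k))"
    define l where "l = \<lfloor>s / 2\<rfloor>"
    \<comment> \<open>The parameter along the line is reduced to one circuit of the closed curve on
      the torus; the discarded integer l is a lattice translation by multiples of 2
      \<open>b k\<close>.\<close>
    define u where "u = s / 2 - of_int l"
    have u: "0 \<le> u" "u \<le> 1" unfolding u_def l_def by linarith+
    have s: "s = 2 * u + 2 * of_int l" by (simp add: u_def)
    have xy0: "y = of_int j + s * of_int (snd (b k))" "x = of_int i + s * of_int (fst (b k))"
      using s0 eq by (auto simp: s_def field_simps)
    have md: "real_of_int z = of_int (z mod 2) + 2 * of_int (z div 2)" for z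
      by (metis add.commute mult_div_mod_eq of_int_add of_int_mult of_int_numeral)
    have xy: "x = (of_int (i mod 2) + u * (2 * of_int (fst (b k)))) + 2 * of_int (i div 2 + l * fst (b k))"
      "y = (of_int (j mod 2) + u * (2 * of_int (snd (b k)))) + 2 * of_int (j div 2 + l * snd (b k))"
      unfolding xy0 s by (simp_all add: md[of i] md[of j] algebra_simps)
    have mod2: "z mod 2 \<in> {0, 1}" for z :: int by auto
    show False
    proof (rule off)
      show "((pi * of_int (i mod 2), pi * of_int (j mod 2)),
          (pi * (of_int (i mod 2) + 2 * of_int (fst (b k))), pi * (of_int (j mod 2) + 2 * of_int (snd (b k))))) \<in> exceptional_segments"
        unfolding exceptional_segments_def using k mod2[of i] mod2[of j] by (intro UnI2 image_eqI[of _ _ "(k, i mod 2, j mod 2)"]) auto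
      show "(pi * (of_int (i mod 2) + u * (2 * of_int (fst (b k)))), pi * (of_int (j mod 2) + u * (2 * of_int (snd (b k))))) \<in>
          closed_segment (pi * of_int (i mod 2), pi * of_int (j mod 2))
          (pi * (of_int (i mod 2) + 2 * of_int (fst (b k))), pi * (of_int (j mod 2) + 2 * of_int (snd (b k))))"
        unfolding closed_segment_def using u by (auto intro!: exI[of _ u] simp: algebra_simps)
      show "torus_proj (pi * x, pi * y) = torus_proj
          (pi * (of_int (i mod 2) + u * (2 * of_int (fst (b k)))), pi * (of_int (j mod 2) + u * (2 * of_int (snd (b k)))))"
        by (rule red[OF xy])
    qed
  qed
  then show ?thesis using y crit unfolding generic_def by blast
qed

lemma off_segments_generic:
  assumes "\<And>x y. generic x y \<Longrightarrow> Q (torus_proj (pi * x, pi * y))"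
  shows "off_segments Q"
  unfolding off_segments_def
proof (intro exI[of _ exceptional_segments] conjI ballI finite_exceptional_segments)
  fix \<theta> assume \<theta>: "\<theta> \<in> torus - torus_proj ` (\<Union>(x, y)\<in>exceptional_segments. closed_segment x y)"
  then obtain p where p: "\<theta> = torus_proj p" by (auto simp: torus_def)
  have "generic (fst p / pi) (snd p / pi)"
    using \<theta> unfolding p by (intro off_exceptional_segments_generic) simp
  from assms[OF this] show "Q \<theta>" unfolding p by simp
qed

lemma generic_exists: obtains x y where "generic x y"
proof -
  have "{p. torus_proj p \<in> torus_proj ` (\<Union>(a, c)\<in>exceptional_segments. closed_segment a c)} \<noteq> UNIV"
    using negligible_torus_segments[OF finite_exceptional_segments] non_negligible_UNIV by metis
  then obtain p where p: "torus_proj p \<notin> torus_proj ` (\<Union>(a, c)\<in>exceptional_segments. closed_segment a c)" by blast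
  have "p = (pi * (fst p / pi), pi * (snd p / pi))" by simp
  then show thesis using p off_exceptional_segments_generic that by metis
qed

end

theorem theorem2:
  fixes N :: nat and b :: "nat \<Rightarrow> int \<times> int"
  assumes sum_zero: "(\<Sum>j=1..N. b j) = (0, 0)"
    and nonzero: "\<forall>j\<in>{1..N}. b j \<noteq> (0, 0)"
    and minors: "Gcd {row_det (b j) (b k) | j k. 1 \<le> j \<and> j < k \<and> k \<le> N} = 1"
    and ordered: "\<forall>j k. 1 \<le> j \<and> j \<le> k \<and> k \<le> N \<longrightarrow> beta (b k) \<le> beta (b j)"
  shows "off_segments (\<lambda>\<theta>. finite {t. Im t \<noteq> 0 \<and> torus_proj (principal_branch N b t) = \<theta>})
    \<and> torus_cycle (\<lambda>\<theta>. coamoeba_chain N b \<theta> + torus_zonotope_chain N b \<theta>)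
    \<and> (\<exists>m::int.
         torus_chain_eq (\<lambda>\<theta>. coamoeba_chain N b \<theta> + torus_zonotope_chain N b \<theta>) (\<lambda>_. m)
       \<and> real_of_int m =
           1 / 2 * (\<Sum>(j, k) \<in> {(j, k). 1 \<le> j \<and> j < k \<and> k \<le> N}. real_of_int (row_det_pos (b j) (b k))))"
proof -
  interpret sorted_rows N b
    by unfold_locales (use sum_zero nonzero ordered in \<open>auto simp: zero_prod_def\<close>)
  obtain x0 y0 where g0: "generic x0 y0" by (rule generic_exists)
  \<comment> \<open>Taking m as the value at an actual generic point makes it an integer by
    construction; the integrality of the half sum follows.\<close>
  define m where "m = coamoeba_chain N b (torus_proj (pi * x0, pi * y0)) + torus_zonotope_chain N b (torus_proj (pi * x0, pi * y0))"
  have m: "real_of_int m = 1 / 2 * (\<Sum>(j, k)\<in>pairs. real_of_int (row_det_pos (b j) (b k)))"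
    unfolding m_def by (rule generic_multiplicity(1)[OF g0])
  have eq: "torus_chain_eq (\<lambda>\<theta>. coamoeba_chain N b \<theta> + torus_zonotope_chain N b \<theta>) (\<lambda>_. m)"
    unfolding torus_chain_eq_def
  proof (rule off_segments_generic)
    fix x y assume "generic x y"
    from generic_multiplicity(1)[OF this] m
    show "coamoeba_chain N b (torus_proj (pi * x, pi * y)) + torus_zonotope_chain N b (torus_proj (pi * x, pi * y)) = m"
      by (metis of_int_eq_iff)
  qed
  moreover have "off_segments (\<lambda>\<theta>. finite {t. Im t \<noteq> 0 \<and> torus_proj (principal_branch N b t) = \<theta>})"
    by (rule off_segments_generic) (rule generic_multiplicity(2))
  ultimately show ?thesis using m torus_cycle_of_chain_eq[OF eq] by blast
qed

end
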